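(* Let $\mathcal{C}(K,\mathfrak{o}_p)$ be the Fréchet space of continuous functions $K\to\mathfrak{o}_p$, and let $\mathcal{D}(K,\mathfrak{o}_p)=\mathrm{Hom}^{\mathrm{cts}}_{\mathfrak{o}_p}(\mathcal{C}(K,\mathfrak{o}_p),\mathfrak{o}_p)$ be its continuous linear dual. Choose a compatible system of primitive $\ell$-power roots of unity $\zeta=(\zeta_n)_{n\ge 0}\in\varprojlim_n \mu_{\ell^n}$ in $\mathfrak{o}_p$. Then the map $$\mathcal{D}(K,\mathfrak{o}_p)\hookrightarrow \mathcal{C}(K,\mathfrak{o}_p),\qquad \mu\mapsto\hat\mu_\zeta,$$ is an embedding, which identifies $\mathcal{D}(K,\mathfrak{o}_p)$ with the uniformly continuous functions $K\to\mathfrak{o}_p$. Furthermore, let $dx$ denote the linear functional on compactly supported locally constant functions on $K$ defined by $dx(\mathbf{1}_{a+\mathfrak{l}^n})=q^{-\delta/2-n}$ for $a\in K$, $n\in\mathbf{Z}$. Then for any $f\in\mathcal{C}(K,\mathfrak{o}_p)$ such that $\lim_{x\to\infty}f(x)=0$, we have $f\,dx\in\mathcal{D}(K,\mathfrak{o}_p)$, and for all $\xi\in K$ $$(f\,dx)^\wedge_\zeta(\xi)=\int_K f(x)\,\zeta^{\mathrm{tr}(x\xi)}\,dx .$$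
   Context: $\ell\neq p$ are primes; $K$ is a finite extension of $\mathbf{Q}_\ell$ with valuation ring $\mathfrak{o}_K$, maximal ideal $\mathfrak{l}=(\pi)$, residue cardinality $q=\#\mathfrak{o}_K/(\pi)$; $\mathfrak{d}=(\pi^\delta)$ is the different of $\mathfrak{o}_K/\mathbf{Z}_\ell$; $\mathrm{tr}:K\to\mathbf{Q}_\ell$ is the trace. $\mathbf{C}_p$ is the completion of an algebraic closure of $\mathbf{Q}_p$, with absolute value $|\cdot|_p$, $|p|_p=1/p$, and $\mathfrak{o}_p$ is its ring of integers. A square root $q^{1/2}$ of $q$ in $\mathbf{C}_p$ is fixed and $q^{-\delta/2}=(q^{1/2})^{-\delta}$. $\mathbf{1}_E$ is the characteristic function of $E\subset K$. Topology of $\mathcal{C}(K,\mathfrak{o}_p)$: defined by the seminorms $\|f\|_U=\sup_{x\in U}|f(x)|_p$, $U$ ranging over compact open subsets of $K$. Roots of unity: $\zeta_n$ is a primitive $\ell^n$-th root of unity in $\mathfrak{o}_p$ and $\zeta_{n+1}^\ell=\zeta_n$. For $x\in\mathbf{Q}_\ell$, write $x=\ell^t u$ with $u\in\mathbf{Z}_\ell$ and set $\zeta^x=\zeta_{-t}^u$, where $\zeta_n=1$ for $n<0$. For $\mu\in\mathcal{D}(K,\mathfrak{o}_p)$, the function $\hat\mu_\zeta:K\to\mathfrak{o}_p$ is $\hat\mu_\zeta(r)=\int_K\zeta^{\mathrm{tr}(rx)}\mu(x)$, i.e. the value of $\mu$ at the continuous function $x\mapsto\zeta^{\mathrm{tr}(rx)}$.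 Integration against $dx$: for continuous $f:K\to\mathfrak{o}_p$ with $\lim_{x\to\infty}f(x)=0$, $\int_K f(x)\,dx$ is the value at $f$ of the extension of $dx$ by continuity for the sup norm (compactly supported locally constant functions are sup-norm dense among such $f$). For such $f$, $f\,dx$ denotes the functional $g\mapsto\int_K f(x)g(x)\,dx$ on $\mathcal{C}(K,\mathfrak{o}_p)$. *)

theory Defs
  imports
    "HOL-Analysis.Analysis"
    "HOL-Computational_Algebra.Polynomial"
    "HOL-Computational_Algebra.Primes"
begin

section \<open>Fields with a non-archimedean absolute value\<close>

text \<open>
  The absolute value is \<open>\<bar>x\<bar> = dist x 0\<close>, so that the topology and the uniform
  structure of the field are those of the library class \<open>metric_space\<close>.
\<close>

class nonarch_field = field + metric_space +
  assumes dist_eq_dist_diff: "dist x y = dist (x - y) 0"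
    and dist_mult_0: "dist (x * y) 0 = dist x 0 * dist y 0"
    and dist_ultrametric: "dist x z \<le> max (dist x y) (dist y z)"

definition vabs :: "'a::nonarch_field \<Rightarrow> real"
  where "vabs x = dist x 0"

definition valuation_ring :: "'a::nonarch_field set"
  where "valuation_ring = {x. vabs x \<le> 1}"

definition maximal_ideal :: "'a::nonarch_field set"
  where "maximal_ideal = {x. vabs x < 1}"

definition residue_card :: "'a::nonarch_field itself \<Rightarrow> nat"
  where "residue_card _ =
    card ((valuation_ring :: 'a set) //
      {(x, y). x \<in> valuation_ring \<and> y \<in> valuation_ring \<and> x - y \<in> maximal_ideal})"

definition frac_ideal :: "'a::nonarch_field \<Rightarrow> int \<Rightarrow> 'a set"
  where "frac_ideal \<pi> n = {\<pi> powi n * y | y. y \<in> valuation_ring}"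

definition is_uniformizer :: "'a::nonarch_field \<Rightarrow> bool"
  where "is_uniformizer \<pi> \<longleftrightarrow> maximal_ideal = {\<pi> * y | y. y \<in> valuation_ring}"

definition valued_field_hom :: "('a::nonarch_field \<Rightarrow> 'b::nonarch_field) \<Rightarrow> bool"
  where "valued_field_hom j \<longleftrightarrow>
    j 1 = 1 \<and> (\<forall>x y. j (x + y) = j x + j y) \<and> (\<forall>x y. j (x * y) = j x * j y) \<and>
    (\<forall>x. vabs (j x) = vabs x)"


section \<open>The fields \<open>Q\<^sub>l\<close>, \<open>K\<close> and \<open>C\<^sub>p\<close>\<close>

text \<open>
  \<open>Q\<^sub>l\<close> is a completion of the rationals for the \<open>l\<close>-adic absolute value: a complete field
  (sort \<open>complete_space\<close>) in which the rationals are dense and carry this absolute value.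
  It is determined by this up to a unique isometric isomorphism.
\<close>

definition is_padic_field ::
    "nat \<Rightarrow> 'q::{nonarch_field, field_char_0, complete_space} itself \<Rightarrow> bool"
  where "is_padic_field l _ \<longleftrightarrow>
    prime l \<and>
    (\<forall>n::nat. n > 0 \<longrightarrow> vabs (of_nat n :: 'q) = 1 / real l ^ multiplicity l n) \<and>
    closure (\<rat> :: 'q set) = UNIV"

definition ext_scale :: "('q::field \<Rightarrow> 'k::field) \<Rightarrow> 'q \<Rightarrow> 'k \<Rightarrow> 'k"
  where "ext_scale j a x = j a * x"

definition is_finite_extension ::
    "nat \<Rightarrow> ('q::{nonarch_field, field_char_0, complete_space} \<Rightarrow> 'k::nonarch_field) \<Rightarrow> bool"
  where "is_finite_extension l j \<longleftrightarrow>
    is_padic_field l TYPE('q) \<and> valued_field_hom j \<and>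
    (\<exists>B. finite_dimensional_vector_space (ext_scale j) B)"

definition algebraic_elements :: "('q::field \<Rightarrow> 'c::field) \<Rightarrow> 'c set"
  where "algebraic_elements j = {x. \<exists>P. P \<noteq> 0 \<and> poly (map_poly j P) x = 0}"

text \<open>
  A completion of an algebraic closure of \<open>Q\<^sub>p\<close>: the elements algebraic over \<open>Q\<^sub>p\<close> form an
  algebraically closed subfield, which is dense in the complete field \<open>'c\<close>.
\<close>

definition is_Cp ::
    "nat \<Rightarrow> ('q::{nonarch_field, field_char_0, complete_space} \<Rightarrow>
      'c::{nonarch_field, complete_space}) \<Rightarrow> bool"
  where "is_Cp p j \<longleftrightarrow>
    is_padic_field p TYPE('q) \<and> valued_field_hom j \<and>
    (\<forall>P. set (coeffs P) \<subseteq> algebraic_elements j \<and> degree P > 0 \<longrightarrow>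
      (\<exists>x \<in> algebraic_elements j. poly P x = 0)) \<and>
    closure (algebraic_elements j) = UNIV"


section \<open>Trace and different\<close>

text \<open>The trace of \<open>y \<mapsto> x * y\<close>, computed in a basis; it does not depend on the basis.\<close>

definition field_trace :: "('q::field \<Rightarrow> 'k::field) \<Rightarrow> 'k \<Rightarrow> 'q"
  where "field_trace j x =
    (let B = (SOME B. finite_dimensional_vector_space (ext_scale j) B)
     in \<Sum>b\<in>B. module.representation (ext_scale j) B (x * b) b)"

definition codifferent :: "('q::nonarch_field \<Rightarrow> 'k::nonarch_field) \<Rightarrow> 'k set"
  where "codifferent j =
    {x. \<forall>y \<in> valuation_ring. field_trace j (x * y) \<in> valuation_ring}"

definition different :: "('q::nonarch_field \<Rightarrow> 'k::nonarch_field) \<Rightarrow> 'k set"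
  where "different j = {y. \<forall>x \<in> codifferent j. x * y \<in> valuation_ring}"


section \<open>Continuous functions and measures\<close>

definition cont_funs :: "('k::nonarch_field \<Rightarrow> 'c::nonarch_field) set"
  where "cont_funs = {f. continuous_on UNIV f \<and> range f \<subseteq> valuation_ring}"

text \<open>Inserting \<open>0\<close> only matters for empty \<open>U\<close>.\<close>

definition sup_seminorm :: "'k set \<Rightarrow> ('k \<Rightarrow> 'c::nonarch_field) \<Rightarrow> real"
  where "sup_seminorm U f = Sup (insert 0 ((\<lambda>x. vabs (f x)) ` U))"

definition cont_funs_topology :: "('k::nonarch_field \<Rightarrow> 'c::nonarch_field) topology"
  where "cont_funs_topology =
    topology_generated_by
      {{g \<in> cont_funs. sup_seminorm U (\<lambda>x. g x - f x) < \<epsilon>} | f U \<epsilon>.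
        f \<in> cont_funs \<and> compact U \<and> open U \<and> \<epsilon> > 0}"

text \<open>
  \<open>integral_linear F\<close> is the set of functionals on \<open>F\<close> that are linear over the valuation ring,
  with values in the valuation ring; they are made extensional (\<open>undefined\<close> off \<open>F\<close>) so that
  equality of functionals is equality on \<open>F\<close>.
\<close>

definition integral_linear ::
    "('k \<Rightarrow> 'c::nonarch_field) set \<Rightarrow> (('k \<Rightarrow> 'c) \<Rightarrow> 'c) set"
  where "integral_linear F =
    {\<mu> \<in> F \<rightarrow>\<^sub>E valuation_ring.
      (\<forall>f\<in>F. \<forall>g\<in>F. \<mu> (\<lambda>x. f x + g x) = \<mu> f + \<mu> g) \<and>
      (\<forall>a\<in>valuation_ring. \<forall>f\<in>F. \<mu> (\<lambda>x. a * f x) = a * \<mu> f)}"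

definition cont_dual :: "(('k::nonarch_field \<Rightarrow> 'c::nonarch_field) \<Rightarrow> 'c) set"
  where "cont_dual =
    {\<mu> \<in> integral_linear cont_funs.
      continuous_map cont_funs_topology (top_of_set valuation_ring) \<mu>}"


section \<open>Roots of unity and the Fourier transform\<close>

definition compatible_roots :: "nat \<Rightarrow> (nat \<Rightarrow> 'c::field) \<Rightarrow> bool"
  where "compatible_roots l \<zeta> \<longleftrightarrow>
    (\<forall>n. \<zeta> n ^ (l ^ n) = 1 \<and> (\<forall>k. 0 < k \<and> k < l ^ n \<longrightarrow> \<zeta> n ^ k \<noteq> 1)) \<and>
    (\<forall>n. \<zeta> (Suc n) ^ l = \<zeta> n)"

text \<open>
  \<open>zeta_int_pow l \<zeta> n u\<close> is \<open>\<zeta>\<^sub>n\<close> to the power \<open>u \<in> Z\<^sub>l\<close>, that is \<open>\<zeta>\<^sub>n\<close> to the power of the residue of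
  \<open>u\<close> modulo \<open>l^n\<close>.
\<close>

definition zeta_int_pow ::
    "nat \<Rightarrow> (nat \<Rightarrow> 'c::field) \<Rightarrow> int \<Rightarrow> 'q::nonarch_field \<Rightarrow> 'c"
  where "zeta_int_pow l \<zeta> n u =
    (if n < 0 then 1
     else \<zeta> (nat n) ^ (THE k. k < l ^ nat n \<and>
       (\<exists>v \<in> valuation_ring. u - of_nat k = of_nat (l ^ nat n) * v)))"

definition zeta_pow :: "nat \<Rightarrow> (nat \<Rightarrow> 'c::field) \<Rightarrow> 'q::nonarch_field \<Rightarrow> 'c"
  where "zeta_pow l \<zeta> x =
    (THE z. \<exists>t u. u \<in> valuation_ring \<and> x = of_nat l powi t * u \<and> z = zeta_int_pow l \<zeta> (- t) u)"

definition fourier ::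
    "nat \<Rightarrow> ('q::nonarch_field \<Rightarrow> 'k::nonarch_field) \<Rightarrow> (nat \<Rightarrow> 'c::nonarch_field) \<Rightarrow>
      (('k \<Rightarrow> 'c) \<Rightarrow> 'c) \<Rightarrow> 'k \<Rightarrow> 'c"
  where "fourier l j \<zeta> \<mu> r = \<mu> (\<lambda>x. zeta_pow l \<zeta> (field_trace j (r * x)))"


section \<open>The functional \<open>dx\<close>\<close>

definition lc_funs :: "('k::nonarch_field \<Rightarrow> 'c::nonarch_field) set"
  where "lc_funs =
    {f. (\<forall>x. \<exists>U. open U \<and> x \<in> U \<and> (\<forall>y\<in>U. f y = f x)) \<and>
        compact (closure {x. f x \<noteq> 0}) \<and> range f \<subseteq> valuation_ring}"

text \<open>
  In the following, \<open>\<pi>\<close> is a uniformizer of \<open>K\<close>, \<open>s\<close> the square root of the residue cardinality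
  and \<open>\<delta>\<close> the exponent of the different.
\<close>

definition haar ::
    "'k::nonarch_field \<Rightarrow> 'c::nonarch_field \<Rightarrow> nat \<Rightarrow> ('k \<Rightarrow> 'c) \<Rightarrow> 'c"
  where "haar \<pi> s \<delta> =
    (THE I. I \<in> integral_linear lc_funs \<and>
      (\<forall>a n. I (indicator ((+) a ` frac_ideal \<pi> n)) =
        s powi (- int \<delta>) * of_nat (residue_card TYPE('k)) powi (- n)))"

text \<open>Extension of \<open>dx\<close> by continuity for the sup norm.\<close>

definition haar_integral ::
    "'k::nonarch_field \<Rightarrow> 'c::nonarch_field \<Rightarrow> nat \<Rightarrow> ('k \<Rightarrow> 'c) \<Rightarrow> 'c"
  where "haar_integral \<pi> s \<delta> f =
    (THE L. \<exists>g. (\<forall>n. g n \<in> lc_funs) \<and> uniform_limit UNIV g f sequentially \<and>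
      (\<lambda>n. haar \<pi> s \<delta> (g n)) \<longlonglongrightarrow> L)"

definition haar_density ::
    "'k::nonarch_field \<Rightarrow> 'c::nonarch_field \<Rightarrow> nat \<Rightarrow> ('k \<Rightarrow> 'c) \<Rightarrow> ('k \<Rightarrow> 'c) \<Rightarrow> 'c"
  where "haar_density \<pi> s \<delta> f =
    restrict (\<lambda>g. haar_integral \<pi> s \<delta> (\<lambda>x. f x * g x)) cont_funs"

end

theory Submission
  imports Defs "HOL-Number_Theory.Cong"
begin

text \<open>
  The function \<open>\<psi> x = \<zeta>\<^bsup>tr x\<^esup>\<close> is a smooth nontrivial additive character of \<open>K\<close>. The balls \<open>\<pi>\<^sup>n o\<^sub>K\<close>
  are compact, their relative indices are powers of \<open>q\<close> and hence powers of \<open>l\<close>, so they are units in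
  \<open>o\<^sub>p\<close> because \<open>l \<noteq> p\<close>. Thus Fourier inversion on the finite quotients is integral, and finite sums
  \<open>\<Sum> c\<^sub>r \<psi>(r x)\<close> with \<open>c\<^sub>r \<in> o\<^sub>p\<close> are dense in the continuous functions, which gives injectivity.

  For surjectivity let \<open>h\<close> be uniformly continuous, with variation at most \<open>\<epsilon>\<close> on the cosets of a ball
  \<open>B\<close>. By orthogonality the sum of the \<open>c\<^sub>r\<close> over a coset of \<open>B\<close> is bounded by the supremum of
  \<open>\<bar>\<Sum> c\<^sub>r \<psi>(r x)\<bar>\<close> over the dual ball, whence \<open>\<bar>\<Sum> c\<^sub>r h(r)\<bar> \<le> \<epsilon>\<close> as soon as that supremum is at most
  \<open>\<epsilon>\<close>. So the functional \<open>\<Sum> c\<^sub>r \<psi>(r x) \<mapsto> \<Sum> c\<^sub>r h(r)\<close> is continuous and extends to a measure with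
  transform \<open>h\<close>. The functional \<open>dx\<close> is extended in the same way, starting from locally constant
  functions; \<open>f dx\<close> is continuous since \<open>f\<close> is small off a ball.
\<close>

section \<open>Non-archimedean absolute values\<close>

text \<open>Compactness of o_K is derived, not assumed: the coordinates of x in a basis of K over
  Q_l are bounded by a multiple of the absolute value of x. This is equivalence of norms, and it
  uses completeness of Q_l, not of K. The same bound makes the trace continuous, hence \<psi>
  smooth; \<psi> is nontrivial because the trace is onto in characteristic zero. Both extensions by
  continuity are instances of the locale \<open>functional_extension\<close>. It works with indices
  (coefficient families, or locally constant functions) instead of the functions they give, and its
  estimate \<open>small\<close> replaces a proof of well-definedness: two families with the same
  trigonometric sum have the same value because the estimate holds for every e. The test set
  \<open>D e\<close> has to depend on e, since the modulus of continuity of h does: it comes from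
  the ball dual to one on whose cosets h varies by at most e. For dx it is all of K, because volumes
  have absolute value at most 1 and so the integral is bounded by the sup norm.\<close>

lemma vabs_0 [simp]: "vabs 0 = 0"
  by (simp add: vabs_def)

lemma vabs_ge_0 [simp]: "0 \<le> vabs x"
  by (simp add: vabs_def)

lemma vabs_eq_0_iff [simp]: "vabs x = 0 \<longleftrightarrow> x = 0"
  by (simp add: vabs_def)

lemma vabs_pos_iff [simp]: "0 < vabs x \<longleftrightarrow> x \<noteq> 0"
  by (simp add: vabs_def)

lemma vabs_mult: "vabs (x * y) = vabs x * vabs y"
  by (simp add: vabs_def dist_mult_0)

lemma dist_eq_vabs: "dist x y = vabs (x - y)"
  unfolding vabs_def by (rule dist_eq_dist_diff)

lemma vabs_minus_commute: "vabs (x - y) = vabs (y - x)"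
  by (metis dist_commute dist_eq_vabs)

lemma vabs_minus [simp]: "vabs (- x) = vabs x"
  using vabs_minus_commute[of 0 x] by simp

lemma vabs_add_max: "vabs (x + y) \<le> max (vabs x) (vabs y)"
proof -
  have "dist x (- y) \<le> max (dist x 0) (dist 0 (- y))"
    by (rule dist_ultrametric)
  then show ?thesis
    by (simp add: dist_eq_vabs)
qed

lemma vabs_add_le: "vabs x \<le> e \<Longrightarrow> vabs y \<le> e \<Longrightarrow> vabs (x + y) \<le> e"
  using vabs_add_max[of x y] by auto

lemma vabs_diff_le: "vabs x \<le> e \<Longrightarrow> vabs y \<le> e \<Longrightarrow> vabs (x - y) \<le> e"
  using vabs_add_le[of x e "- y"] by simp

lemma vabs_diff_trans: "vabs (x - y) \<le> e \<Longrightarrow> vabs (y - z) \<le> e \<Longrightarrow> vabs (x - z) \<le> e"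
  using vabs_add_le[of "x - y" e "y - z"] by simp


lemma vabs_sum_le: "0 \<le> e \<Longrightarrow> (\<And>x. x \<in> A \<Longrightarrow> vabs (f x) \<le> e) \<Longrightarrow> vabs (sum f A) \<le> e"
  by (induction A rule: infinite_finite_induct) (auto intro: vabs_add_le)

lemma vabs_1 [simp]: "vabs 1 = 1"
  using vabs_mult[of 1 1] by simp

lemma vabs_power: "vabs (x ^ n) = vabs x ^ n"
  by (induction n) (simp_all add: vabs_mult)

lemma vabs_inverse: "vabs (inverse x) = inverse (vabs x)"
proof (cases "x = 0")
  case False
  then have "vabs (inverse x) * vabs x = 1"
    by (simp flip: vabs_mult)
  then show ?thesis
    by (metis inverse_unique mult.commute)
qed simp

lemma vabs_divide: "vabs (x / y) = vabs x / vabs y"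
  by (simp add: divide_inverse vabs_mult vabs_inverse)

lemma vabs_powi: "vabs (x powi n) = vabs x powi n"
  by (simp add: power_int_def vabs_power vabs_inverse)

lemma vabs_of_nat_le_1: "vabs (of_nat n) \<le> 1"
  by (induction n) (auto intro: vabs_add_le)


lemma vabs_eq_1_of_power_eq_1: "x ^ n = 1 \<Longrightarrow> 0 < n \<Longrightarrow> vabs x = 1"
  by (metis power_eq_1_iff vabs_1 vabs_ge_0 vabs_power abs_of_nonneg not_gr_zero real_norm_def)

lemma vabs_le_all_imp_eq: "(\<And>e. 0 < e \<Longrightarrow> vabs (x - y) \<le> e) \<Longrightarrow> x = y"
  using field_le_epsilon[of "vabs (x - y)" 0] vabs_ge_0[of "x - y"] vabs_eq_0_iff[of "x - y"]
  by (simp del: vabs_ge_0 vabs_eq_0_iff)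

lemma valuation_ring_iff: "x \<in> valuation_ring \<longleftrightarrow> vabs x \<le> 1"
  by (simp add: valuation_ring_def)

lemma valuation_ring_0 [simp]: "0 \<in> valuation_ring"
  and valuation_ring_1 [simp]: "1 \<in> valuation_ring"
  by (simp_all add: valuation_ring_iff)

lemma tendsto_iff_vabs: "(f \<longlongrightarrow> a) F \<longleftrightarrow> ((\<lambda>x. vabs (f x - a)) \<longlongrightarrow> 0) F"
  by (subst tendsto_dist_iff) (simp add: dist_eq_vabs)

text \<open>Together with the next instance this makes the library rules for limits and continuity
  of sums and products available, although the class only provides a metric.\<close>

instance nonarch_field \<subseteq> topological_ab_group_add
proof
  fix a b :: 'a
  show "((\<lambda>x. fst x + snd x) \<longlongrightarrow> a + b) (nhds a \<times>\<^sub>F nhds b)"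
    unfolding tendsto_iff_vabs
  proof (rule Lim_null_comparison)
    show "\<forall>\<^sub>F x in nhds a \<times>\<^sub>F nhds b. norm (vabs (fst x + snd x - (a + b))) \<le> dist (fst x) a + dist (snd x) b"
    proof (rule always_eventually, rule allI)
      fix x :: "'a \<times> 'a"
      have "vabs (fst x + snd x - (a + b)) \<le> max (dist (fst x) a) (dist (snd x) b)"
        using vabs_add_max[of "fst x - a" "snd x - b"] by (simp add: algebra_simps dist_eq_vabs)
      also have "\<dots> \<le> dist (fst x) a + dist (snd x) b"
        by simp
      finally show "norm (vabs (fst x + snd x - (a + b))) \<le> dist (fst x) a + dist (snd x) b"
        by simp
    qed
    have "((\<lambda>x. dist (fst x) a + dist (snd x) b) \<longlongrightarrow> dist a a + dist b b) (nhds a \<times>\<^sub>F nhds b)"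
      by (intro tendsto_intros filterlim_fst filterlim_snd)
    then show "((\<lambda>x. dist (fst x) a + dist (snd x) b) \<longlongrightarrow> 0) (nhds a \<times>\<^sub>F nhds b)"
      by simp
  qed
  show "(uminus \<longlongrightarrow> - a) (nhds a)"
    using tendsto_dist[OF filterlim_ident[of "nhds a"] tendsto_const[of a]]
    by (simp add: tendsto_iff_vabs[of uminus] dist_eq_vabs vabs_minus_commute)
qed

instance nonarch_field \<subseteq> topological_monoid_mult
proof
  fix a b :: 'a
  show "((\<lambda>x. fst x * snd x) \<longlongrightarrow> a * b) (nhds a \<times>\<^sub>F nhds b)"
    unfolding tendsto_iff_vabs
  proof (rule Lim_null_comparison)
    show "\<forall>\<^sub>F x in nhds a \<times>\<^sub>F nhds b. norm (vabs (fst x * snd x - a * b)) \<le>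
        dist (fst x) a * dist (snd x) 0 + vabs a * dist (snd x) b"
    proof (rule always_eventually, rule allI)
      fix x :: "'a \<times> 'a"
      have "vabs (fst x * snd x - a * b) = vabs ((fst x - a) * snd x + a * (snd x - b))"
        by (simp add: algebra_simps)
      also have "\<dots> \<le> max (vabs ((fst x - a) * snd x)) (vabs (a * (snd x - b)))"
        by (rule vabs_add_max)
      also have "\<dots> \<le> vabs ((fst x - a) * snd x) + vabs (a * (snd x - b))"
        by simp
      finally show "norm (vabs (fst x * snd x - a * b)) \<le>
          dist (fst x) a * dist (snd x) 0 + vabs a * dist (snd x) b"
        by (simp add: vabs_mult dist_eq_vabs)
    qed
    have "((\<lambda>x. dist (fst x) a * dist (snd x) 0 + vabs a * dist (snd x) b) \<longlongrightarrow>
        dist a a * dist b 0 + vabs a * dist b b) (nhds a \<times>\<^sub>F nhds b)"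
      by (intro tendsto_intros filterlim_fst filterlim_snd)
    then show "((\<lambda>x. dist (fst x) a * dist (snd x) 0 + vabs a * dist (snd x) b) \<longlongrightarrow> 0)
        (nhds a \<times>\<^sub>F nhds b)"
      by simp
  qed
qed

lemma tendsto_vabs [tendsto_intros]: "(f \<longlongrightarrow> a) F \<Longrightarrow> ((\<lambda>x. vabs (f x)) \<longlongrightarrow> vabs a) F"
  unfolding vabs_def by (intro tendsto_intros)

lemma continuous_on_vabs [continuous_intros]:
  "continuous_on S f \<Longrightarrow> continuous_on S (\<lambda>x. vabs (f x))"
  unfolding vabs_def by (intro continuous_intros)

lemma closed_vabs_le: "closed {x. vabs (x - a) \<le> r}"
  by (intro closed_Collect_le continuous_intros)

text \<open>Every point of an ultrametric ball is a centre of it, so the radius r itself serves at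
  each point.\<close>

lemma open_vabs_le: "0 < r \<Longrightarrow> open {x. vabs (x - a) \<le> r}"
  unfolding open_dist
proof (intro ballI)
  fix x assume "0 < r" "x \<in> {x. vabs (x - a) \<le> r}"
  then have "0 < r" "vabs (x - a) \<le> r"
    by simp_all
  then show "\<exists>e>0. \<forall>y. dist y x < e \<longrightarrow> y \<in> {x. vabs (x - a) \<le> r}"
    by (intro exI[of _ r]) (auto simp: dist_eq_vabs intro: vabs_diff_trans[of _ x])
qed


section \<open>The field of \<open>l\<close>-adic numbers\<close>

context
  fixes l :: nat
  assumes padic: "is_padic_field l TYPE('q::{nonarch_field, field_char_0, complete_space})"
begin

lemma prime_l: "prime l"
  using padic by (simp add: is_padic_field_def)

lemma l_gt_1: "1 < l"
  using prime_l by (rule prime_gt_1_nat)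

lemma vabs_of_nat_padic: "0 < n \<Longrightarrow> vabs (of_nat n :: 'q) = 1 / real l ^ multiplicity l n"
  using padic by (simp add: is_padic_field_def)

lemma vabs_l: "vabs (of_nat l :: 'q) = 1 / real l"
  using vabs_of_nat_padic[of l] l_gt_1 prime_l by simp

lemma vabs_l_power: "vabs (of_nat (l ^ n) :: 'q) = 1 / real l ^ n"
  by (simp add: vabs_power vabs_l power_one_over)

lemma vabs_of_int_le_iff_dvd: "vabs (of_int k :: 'q) \<le> 1 / real l ^ n \<longleftrightarrow> int (l ^ n) dvd k"
proof (cases "k = 0")
  case False
  define m where "m = nat \<bar>k\<bar>"
  have m: "0 < m"
    using False by (simp add: m_def)
  have "(of_nat m :: 'q) = of_int \<bar>k\<bar>"
    by (simp add: m_def)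
  then have "vabs (of_int k :: 'q) = vabs (of_nat m :: 'q)"
    by (simp add: abs_if)
  also have "\<dots> = 1 / real l ^ multiplicity l m"
    by (rule vabs_of_nat_padic[OF m])
  finally have "vabs (of_int k :: 'q) \<le> 1 / real l ^ n \<longleftrightarrow>
      1 / real l ^ multiplicity l m \<le> 1 / real l ^ n"
    by simp
  also have "\<dots> \<longleftrightarrow> real l ^ n \<le> real l ^ multiplicity l m"
    using l_gt_1 by (simp add: divide_simps)
  also have "\<dots> \<longleftrightarrow> n \<le> multiplicity l m"
    using l_gt_1 by simp
  also have "\<dots> \<longleftrightarrow> l ^ n dvd m"
    using m l_gt_1 by (intro power_dvd_iff_le_multiplicity[symmetric]) auto
  also have "\<dots> \<longleftrightarrow> int (l ^ n) dvd k"
    unfolding m_def by (metis dvd_abs_iff int_dvd_int_iff abs_ge_zero nat_0_le)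
  finally show ?thesis .
qed (simp add: l_gt_1)

text \<open>Density of the rationals gives a nearby fraction a / b. It is integral, so b is
  invertible modulo \<open>l ^ n\<close>, and the residue of a / b is the required natural
  number.\<close>

lemma padic_integer_approx_nat:
  fixes x :: 'q
  assumes "x \<in> valuation_ring"
  obtains k where "k < l ^ n" and "vabs (x - of_nat k) \<le> 1 / real l ^ n"
proof -
  have "x \<in> closure \<rat>"
    using padic by (simp add: is_padic_field_def)
  moreover have "0 < 1 / real l ^ n"
    using l_gt_1 by simp
  ultimately obtain y :: 'q where y: "y \<in> \<rat>" "dist y x < 1 / real l ^ n"
    unfolding closure_approachable by blast
  have small: "vabs (x - y) \<le> 1 / real l ^ n"
    using y(2) by (simp add: dist_eq_vabs vabs_minus_commute)
  moreover have "1 / real l ^ n \<le> 1"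
    using l_gt_1 by simp
  ultimately have "vabs (x - y) \<le> 1"
    by linarith
  then have y1: "vabs y \<le> 1"
    using vabs_diff_le[of x 1 "x - y"] assms by (simp add: valuation_ring_iff)
  obtain a b :: int where ab: "b > 0" "coprime a b" "y = of_int a / of_int b"
    using y(1) by (metis Rats_cases')
  \<comment> \<open>A factor l of b would not divide a, and then a would have larger absolute value
    than b, against \<open>y1\<close>.\<close>
  have "coprime b (int l)"
  proof (rule ccontr)
    assume "\<not> coprime b (int l)"
    then have lb: "int l dvd b"
      using prime_l by (metis coprime_commute prime_imp_coprime prime_nat_int_transfer)
    have "\<not> int l dvd a"
      using ab(2) lb prime_l
      by (metis coprime_common_divisor not_prime_unit prime_nat_int_transfer)
    then have "vabs (of_int a :: 'q) > 1 / real l"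
      using vabs_of_int_le_iff_dvd[of a 1] by auto
    moreover have "vabs (of_int b :: 'q) \<le> 1 / real l"
      using vabs_of_int_le_iff_dvd[of b 1] lb by simp
    ultimately have "vabs (of_int b :: 'q) < vabs (of_int a :: 'q)"
      by linarith
    moreover have "vabs (of_int a :: 'q) \<le> vabs (of_int b :: 'q)"
      using y1 ab by (simp add: vabs_divide field_simps)
    ultimately show False
      by simp
  qed
  then have "coprime b (int (l ^ n))"
    by simp
  then obtain c where "[b * c = 1] (mod int (l ^ n))"
    using cong_solve_coprime_int by blast
  then have "int (l ^ n) dvd b * (a * c) - a"
    by (metis cong_iff_dvd_diff cong_scalar_left mult.left_commute mult.right_neutral)
  \<comment> \<open>Here c inverts b modulo \<open>l ^ n\<close>, so k is the residue of y = a /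
    b.\<close>
  define k where "k = (a * c) mod int (l ^ n)"
  have k: "0 \<le> k" "k < int (l ^ n)"
    using l_gt_1 by (auto simp: k_def)
  have "int (l ^ n) dvd b * k - a"
  proof -
    have "int (l ^ n) dvd a * c - k"
      by (simp add: k_def minus_mod_eq_mult_div del: of_nat_power)
    then have "int (l ^ n) dvd (b * (a * c) - a) - b * (a * c - k)"
      using \<open>int (l ^ n) dvd b * (a * c) - a\<close> by (metis dvd_diff dvd_mult)
    then show ?thesis
      by (simp add: algebra_simps)
  qed
  then have "vabs (of_int (b * k - a) :: 'q) \<le> 1 / real l ^ n"
    by (simp only: vabs_of_int_le_iff_dvd)
  moreover have "vabs (of_int b :: 'q) = 1"
  proof -
    have "\<not> int l dvd b"
      using \<open>coprime b (int l)\<close> prime_l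
      by (metis coprime_common_divisor dvd_refl not_prime_unit prime_nat_int_transfer)
    then have "\<not> l dvd nat b"
      using ab(1) by (metis int_dvd_int_iff int_nat_eq order_less_imp_le)
    then have "vabs (of_nat (nat b) :: 'q) = 1"
      using vabs_of_nat_padic[of "nat b"] ab(1) by (simp add: not_dvd_imp_multiplicity_0)
    then show ?thesis
      using ab(1) by simp
  qed
  moreover have "y - of_int k = - (of_int (b * k - a) / of_int b)"
    using ab(1,3) by (simp add: field_simps)
  ultimately have "vabs (y - of_int k) \<le> 1 / real l ^ n"
    by (simp add: vabs_divide vabs_minus_commute)
  with small have "vabs (x - of_int k) \<le> 1 / real l ^ n"
    by (rule vabs_diff_trans)
  then show ?thesis
    using that[of "nat k"] k by (simp add: nat_less_iff)
qed

text \<open>The integers are closed in a complete space and totally bounded, since the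
  \<open>l ^ n\<close> residues approximate each of them to within l^(-n). Larger balls follow by
  scaling.\<close>

lemma compact_padic_cball:
  fixes r :: real
  shows "compact {x::'q. vabs x \<le> r}"
proof -
  have compact: "compact (valuation_ring :: 'q set)"
    unfolding compact_eq_totally_bounded
  proof (intro conjI allI impI)
    have "closed (valuation_ring :: 'q set)"
      using closed_vabs_le[of "0::'q" 1] by (simp add: valuation_ring_def)
    then show "complete (valuation_ring :: 'q set)"
      by (simp add: complete_eq_closed)
    fix e :: real assume "0 < e"
    obtain n where n: "1 / real l ^ n < e"
      using real_arch_pow_inv[OF \<open>0 < e\<close>, of "1 / real l"] l_gt_1 by (auto simp: power_one_over)
    have "\<exists>k<l ^ n. x \<in> ball (of_nat k) e" if "x \<in> valuation_ring" for x :: 'q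
    proof -
      obtain k where "k < l ^ n" "vabs (x - of_nat k) \<le> 1 / real l ^ n"
        using padic_integer_approx_nat[OF \<open>x \<in> valuation_ring\<close>, of n] by blast
      then show ?thesis
        using n by (intro exI[of _ k]) (auto simp: dist_eq_vabs vabs_minus_commute)
    qed
    note cover = this
    have "(valuation_ring :: 'q set) \<subseteq> (\<Union>x\<in>of_nat ` {..<l ^ n}. ball x e)"
    proof
      fix x :: 'q assume "x \<in> valuation_ring"
      then obtain k where "k < l ^ n" "x \<in> ball (of_nat k) e"
        using cover by blast
      then show "x \<in> (\<Union>x\<in>of_nat ` {..<l ^ n}. ball x e)"
        by simp blast
    qed
    then show "\<exists>k. finite k \<and> (valuation_ring :: 'q set) \<subseteq> (\<Union>x\<in>k. ball x e)"
      by (meson finite_imageI finite_lessThan)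
  qed
  \<comment> \<open>Division by \<open>l ^ n\<close> multiplies absolute values by
    \<open>real l ^ n\<close>, so the image of the integers contains the ball of radius r.\<close>
  obtain n where n: "r < real l ^ n"
    using real_arch_pow[of "real l"] l_gt_1 by auto
  have "compact ((\<lambda>x. x / of_nat (l ^ n)) ` (valuation_ring :: 'q set))"
    unfolding divide_inverse by (intro compact_continuous_image continuous_intros compact)
  moreover have "{x. vabs x \<le> r} \<subseteq> (\<lambda>x. x / of_nat (l ^ n)) ` (valuation_ring :: 'q set)"
  proof
    fix x :: 'q assume x: "x \<in> {x. vabs x \<le> r}"
    have "vabs (x * of_nat (l ^ n)) = vabs x / real l ^ n"
      by (simp only: vabs_mult vabs_l_power) simp
    moreover have "vabs x / real l ^ n \<le> 1"
      using x n l_gt_1 by (simp add: divide_simps)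
    ultimately have "x * of_nat (l ^ n) \<in> valuation_ring"
      by (simp only: valuation_ring_iff)
    then show "x \<in> (\<lambda>x. x / of_nat (l ^ n)) ` (valuation_ring :: 'q set)"
      using l_gt_1 by (intro image_eqI[of _ _ "x * of_nat (l ^ n)"]) auto
  qed
  moreover have "closed {x::'q. vabs x \<le> r}"
    using closed_vabs_le[of "0::'q" r] by simp
  ultimately show ?thesis
    by (metis compact_Int_closed inf.absorb_iff2)
qed

section \<open>The additive character of Q_l attached to a compatible system of roots of
  unity\<close>

context
  fixes \<zeta> :: "nat \<Rightarrow> 'c::nonarch_field"
  assumes roots: "compatible_roots l \<zeta>"
begin

lemma root_power_eq: "\<zeta> (n + m) ^ (l ^ m) = \<zeta> n"
proof (induction m)
  case (Suc m)
  have "\<zeta> (n + Suc m) ^ (l ^ Suc m) = (\<zeta> (Suc (n + m)) ^ l) ^ (l ^ m)"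
    by (simp add: power_mult)
  also have "\<dots> = \<zeta> (n + m) ^ (l ^ m)"
    using roots by (simp add: compatible_roots_def)
  finally show ?case
    using Suc.IH by simp
qed simp

lemma root_power_cong:
  assumes "[int a = int b] (mod int (l ^ n))"
  shows "\<zeta> n ^ a = \<zeta> n ^ b"
proof -
  have "[a = b] (mod l ^ n)"
    using assms by (simp only: cong_int_iff)
  then have "a mod l ^ n = b mod l ^ n"
    by (simp add: cong_def)
  moreover have "\<zeta> n ^ k = \<zeta> n ^ (k mod l ^ n)" for k
  proof -
    have "\<zeta> n ^ k = \<zeta> n ^ (l ^ n * (k div l ^ n) + k mod l ^ n)"
      by simp
    also have "\<dots> = (\<zeta> n ^ (l ^ n)) ^ (k div l ^ n) * \<zeta> n ^ (k mod l ^ n)"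
      by (simp only: power_add power_mult)
    finally show ?thesis
      using roots by (simp add: compatible_roots_def)
  qed
  ultimately show ?thesis
    by metis
qed

text \<open>Fractions congruent modulo Z_l give the same root of unity: over the common denominator
  \<open>l ^ (n + m)\<close> the hypothesis becomes a congruence of numerators, and
  \<open>root_power_eq\<close> lowers the powers of \<open>\<zeta> (n + m)\<close> again.\<close>

lemma root_power_eq_root_power:
  assumes "vabs (of_nat a / of_nat (l ^ n) - of_nat b / of_nat (l ^ m) :: 'q) \<le> 1"
  shows "\<zeta> n ^ a = \<zeta> m ^ b"
proof -
  have "of_int (int (a * l ^ m) - int (b * l ^ n)) =
      (of_nat a / of_nat (l ^ n) - of_nat b / of_nat (l ^ m)) * (of_nat (l ^ (n + m)) :: 'q)"
    using l_gt_1 by (simp add: field_simps power_add)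
  then have "vabs (of_int (int (a * l ^ m) - int (b * l ^ n)) :: 'q) \<le> 1 / real l ^ (n + m)"
    using assms l_gt_1 by (simp only: vabs_mult vabs_l_power) (simp add: field_simps)
  then have "int (l ^ (n + m)) dvd int (a * l ^ m) - int (b * l ^ n)"
    by (simp only: vabs_of_int_le_iff_dvd)
  then have "\<zeta> (n + m) ^ (a * l ^ m) = \<zeta> (n + m) ^ (b * l ^ n)"
    by (intro root_power_cong) (simp only: cong_iff_dvd_diff)
  then have "(\<zeta> (n + m) ^ (l ^ m)) ^ a = (\<zeta> (m + n) ^ (l ^ n)) ^ b"
    by (simp add: mult.commute add.commute flip: power_mult)
  then show ?thesis
    by (simp only: root_power_eq)
qed

text \<open>The value is the same for every presentation l^t u of x and every fraction near x. This
  is what makes the definite description in \<open>zeta_pow\<close> meaningful.\<close>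

lemma zeta_int_pow_eq:
  fixes u :: 'q
  assumes "u \<in> valuation_ring"
    and "vabs (of_nat l powi t * u - of_nat k / of_nat (l ^ n)) \<le> 1"
  shows "zeta_int_pow l \<zeta> (- t) u = \<zeta> n ^ k"
proof (cases "0 < t")
  case True
  have "vabs (of_nat l powi t * u) \<le> 1"
    using assms(1) True vabs_of_nat_le_1[of l, where ?'a = 'q]
    by (auto simp: vabs_mult vabs_power valuation_ring_iff power_int_def
        intro!: mult_le_one power_le_one)
  \<comment> \<open>For t > 0 the element is integral and \<open>zeta_int_pow\<close> takes its
    default value 1, which is matched by the fraction 0 / l^0.\<close>
  from vabs_diff_le[OF this assms(2)] have "vabs (of_nat k / of_nat (l ^ n) - of_nat 0 / of_nat (l ^ 0) :: 'q) \<le> 1"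
    by simp
  from root_power_eq_root_power[OF this] True show ?thesis
    by (simp add: zeta_int_pow_def)
next
  case False
  define m where "m = nat (- t)"
  have t: "t = - int m"
    using False by (simp add: m_def)
  \<comment> \<open>The predicate under \<open>THE\<close> in \<open>zeta_int_pow\<close>. Its
    metric form shows that exactly one residue satisfies it.\<close>
  let ?P = "\<lambda>a. a < l ^ m \<and> (\<exists>v \<in> valuation_ring. u - of_nat a = of_nat (l ^ m) * v)"
  have P_iff: "?P a \<longleftrightarrow> a < l ^ m \<and> vabs (u - of_nat a) \<le> 1 / real l ^ m" for a
  proof -
    have "(\<exists>v \<in> valuation_ring. u - of_nat a = of_nat (l ^ m) * v) \<longleftrightarrow>
        (u - of_nat a) / of_nat (l ^ m) \<in> valuation_ring"
      using l_gt_1 by (auto simp: field_simps intro!: bexI[of _ "(u - of_nat a) / of_nat (l ^ m)"])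
    also have "\<dots> \<longleftrightarrow> vabs (u - of_nat a) \<le> 1 / real l ^ m"
      using l_gt_1 by (simp only: valuation_ring_iff vabs_divide vabs_l_power) (simp add: field_simps)
    finally show ?thesis
      by simp
  qed
  obtain a where a: "a < l ^ m" "vabs (u - of_nat a) \<le> 1 / real l ^ m"
    using padic_integer_approx_nat[OF assms(1)] by blast
  have "(THE k. ?P k) = a"
  proof (rule the_equality)
    show "?P a"
      using a by (subst P_iff) simp
    fix b assume "?P b"
    then have b: "b < l ^ m" "vabs (u - of_nat b) \<le> 1 / real l ^ m"
      using P_iff by blast+
    have "vabs (of_int (int b - int a) :: 'q) \<le> 1 / real l ^ m"
      using vabs_diff_le[OF a(2) b(2)] by simp
    then have "[int b = int a] (mod int (l ^ m))"
      by (simp only: vabs_of_int_le_iff_dvd cong_iff_dvd_diff)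
    then show "b = a"
      using a(1) b(1) by (metis cong_int_iff cong_less_modulus_unique_nat)
  qed
  then have eq: "zeta_int_pow l \<zeta> (- t) u = \<zeta> m ^ a"
    by (simp add: zeta_int_pow_def t)
  have "vabs ((u - of_nat a) / of_nat (l ^ m)) \<le> 1"
    using a(2) l_gt_1 by (simp only: vabs_divide vabs_l_power) (simp add: field_simps)
  moreover have "(u - of_nat a) / of_nat (l ^ m) = of_nat l powi t * u - of_nat a / of_nat (l ^ m)"
    by (simp add: t power_int_minus diff_divide_distrib) (simp add: divide_inverse)
  ultimately have "vabs (of_nat l powi t * u - of_nat a / of_nat (l ^ m)) \<le> 1"
    by simp
  from vabs_diff_le[OF assms(2) this] have "vabs (of_nat a / of_nat (l ^ m) - of_nat k / of_nat (l ^ n) :: 'q) \<le> 1"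
    by simp
  from root_power_eq_root_power[OF this] eq show ?thesis
    by simp
qed

lemma ex_l_power_mult_integral:
  fixes x :: 'q
  obtains n where "\<And>m. n \<le> m \<Longrightarrow> of_nat (l ^ m) * x \<in> valuation_ring"
proof -
  obtain n where n: "vabs x < real l ^ n"
    using real_arch_pow[of "real l"] l_gt_1 by auto
  have "of_nat (l ^ m) * x \<in> valuation_ring" if "n \<le> m" for m
  proof -
    have "real l ^ n \<le> real l ^ m"
      using that l_gt_1 by simp
    then show ?thesis
      using n l_gt_1
      by (simp only: valuation_ring_iff vabs_mult vabs_l_power)
        (simp add: field_simps del: power_increasing_iff)
  qed
  then show ?thesis
    using that by blast
qed

text \<open>The working description of \<open>zeta_pow\<close>: from here on the character is
  computed from any fraction congruent to x modulo Z_l.\<close>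

lemma zeta_pow_eq:
  fixes x :: 'q
  assumes "vabs (x - of_nat k / of_nat (l ^ n)) \<le> 1"
  shows "zeta_pow l \<zeta> x = \<zeta> n ^ k"
  unfolding zeta_pow_def
proof (rule the_equality)
  obtain m where m: "of_nat (l ^ m) * x \<in> valuation_ring"
    using ex_l_power_mult_integral[of x] by blast
  have x: "x = of_nat l powi (- int m) * (of_nat (l ^ m) * x)"
    using l_gt_1 by (simp add: power_int_minus)
  have "zeta_int_pow l \<zeta> (- (- int m)) (of_nat (l ^ m) * x) = \<zeta> n ^ k"
    by (rule zeta_int_pow_eq[OF m]) (use assms x in metis)
  with m x show "\<exists>t u. u \<in> valuation_ring \<and> x = of_nat l powi t * u \<and> \<zeta> n ^ k = zeta_int_pow l \<zeta> (- t) u"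
    by metis
next
  fix z assume "\<exists>t u. u \<in> valuation_ring \<and> x = of_nat l powi t * u \<and> z = zeta_int_pow l \<zeta> (- t) u"
  then show "z = \<zeta> n ^ k"
    using zeta_int_pow_eq assms by metis
qed

text \<open>All large exponents m are allowed, so that two elements can be given a common
  denominator; additivity of the character needs this.\<close>

lemma ex_zeta_pow_eq:
  fixes x :: 'q
  obtains n where "\<And>m. n \<le> m \<Longrightarrow> \<exists>k. vabs (x - of_nat k / of_nat (l ^ m)) \<le> 1"
proof -
  obtain n where n: "\<And>m. n \<le> m \<Longrightarrow> of_nat (l ^ m) * x \<in> valuation_ring"
    using ex_l_power_mult_integral[of x] by blast
  have "\<exists>k. vabs (x - of_nat k / of_nat (l ^ m)) \<le> 1" if m: "n \<le> m" for m
  proof -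
    obtain k where k: "vabs (of_nat (l ^ m) * x - of_nat k) \<le> 1 / real l ^ m"
      using padic_integer_approx_nat[OF n[OF m], of m] by blast
    have "x - of_nat k / of_nat (l ^ m) = (of_nat (l ^ m) * x - of_nat k) / of_nat (l ^ m)"
      using l_gt_1 by (simp add: field_simps)
    then have "vabs (x - of_nat k / of_nat (l ^ m)) = vabs (of_nat (l ^ m) * x - of_nat k) * real l ^ m"
      by (simp only: vabs_divide vabs_l_power) simp
    moreover have "vabs (of_nat (l ^ m) * x - of_nat k) * real l ^ m \<le> 1"
      using k l_gt_1 by (simp add: pos_le_divide_eq)
    ultimately show ?thesis
      by metis
  qed
  then show ?thesis
    using that by blast
qed

lemma zeta_pow_add:
  fixes x y :: 'q
  shows "zeta_pow l \<zeta> (x + y) = zeta_pow l \<zeta> x * zeta_pow l \<zeta> y"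
proof -
  obtain n1 where n1: "\<And>m. n1 \<le> m \<Longrightarrow> \<exists>k. vabs (x - of_nat k / of_nat (l ^ m)) \<le> 1"
    using ex_zeta_pow_eq[of x] by blast
  obtain n2 where n2: "\<And>m. n2 \<le> m \<Longrightarrow> \<exists>k. vabs (y - of_nat k / of_nat (l ^ m)) \<le> 1"
    using ex_zeta_pow_eq[of y] by blast
  define n where "n = max n1 n2"
  have "n1 \<le> n" "n2 \<le> n"
    by (simp_all add: n_def)
  then obtain a b where a: "vabs (x - of_nat a / of_nat (l ^ n)) \<le> 1"
    and b: "vabs (y - of_nat b / of_nat (l ^ n)) \<le> 1"
    using n1 n2 by blast
  have "vabs (x + y - of_nat (a + b) / of_nat (l ^ n)) \<le> 1"
    using vabs_add_le[OF a b] by (simp add: add_divide_distrib algebra_simps)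
  then show ?thesis
    using a b by (simp only: zeta_pow_eq power_add)
qed

lemma zeta_pow_integral:
  fixes x :: 'q
  shows "x \<in> valuation_ring \<Longrightarrow> zeta_pow l \<zeta> x = 1"
  using zeta_pow_eq[of x 0 0] by (simp add: valuation_ring_iff)

lemma vabs_zeta_pow:
  fixes x :: 'q
  shows "vabs (zeta_pow l \<zeta> x) = 1"
proof -
  obtain n k where "vabs (x - of_nat k / of_nat (l ^ n)) \<le> 1"
    using ex_zeta_pow_eq[of x] by blast
  then have "zeta_pow l \<zeta> x = \<zeta> n ^ k"
    by (rule zeta_pow_eq)
  moreover have "vabs (\<zeta> n) = 1"
    using roots l_gt_1 by (intro vabs_eq_1_of_power_eq_1[of _ "l ^ n"]) (auto simp: compatible_roots_def)
  ultimately show ?thesis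
    by (simp add: vabs_power)
qed

lemma zeta_pow_inverse_l: "zeta_pow l \<zeta> (1 / of_nat l :: 'q) \<noteq> 1"
proof -
  have "zeta_pow l \<zeta> (1 / of_nat l :: 'q) = \<zeta> 1 ^ 1"
    by (rule zeta_pow_eq) simp
  moreover have "\<zeta> 1 ^ 1 \<noteq> 1"
    using roots l_gt_1 unfolding compatible_roots_def by (metis less_numeral_extra(1) power_one_right)
  ultimately show ?thesis
    by simp
qed

end

end


section \<open>Finite extensions\<close>

context
  fixes j :: "'q::{nonarch_field, field_char_0, complete_space} \<Rightarrow> 'k::nonarch_field"
  assumes hom: "valued_field_hom j"
begin

lemma hom_1: "j 1 = 1"
  and hom_add: "j (x + y) = j x + j y"
  and hom_mult: "j (x * y) = j x * j y"
  and vabs_hom: "vabs (j x) = vabs x"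
  using hom by (simp_all add: valued_field_hom_def)

lemma hom_0: "j 0 = 0"
  using hom_add[of 0 0] by (metis add.right_neutral add_left_cancel)

lemma hom_minus: "j (- x) = - j x"
  using hom_add[of x "- x"] by (simp add: hom_0 eq_neg_iff_add_eq_0 add.commute)

lemma hom_diff: "j (x - y) = j x - j y"
  using hom_add[of x "- y"] by (simp add: hom_minus)

lemma hom_of_nat: "j (of_nat n) = of_nat n"
  by (induction n) (simp_all add: hom_0 hom_1 hom_add)

lemma continuous_on_hom: "continuous_on S j"
  by (auto simp: continuous_on_iff dist_eq_vabs vabs_hom simp flip: hom_diff)

lemma tendsto_hom: "(f \<longlongrightarrow> a) F \<Longrightarrow> ((\<lambda>x. j (f x)) \<longlongrightarrow> j a) F"
  using continuous_on_hom[of UNIV] by (simp add: continuous_on_eq_continuous_at isCont_tendsto_compose)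

text \<open>Equivalence of norms over a complete field. By induction the coordinates on the span of
  S are controlled, so that span is closed and the new vector b0 has positive distance d from it;
  this bounds the coordinate at b0, and subtracting its contribution bounds the others.\<close>

lemma coords_bounded:
  assumes "finite S"
    and "\<And>c. (\<Sum>b\<in>S. j (c b) * b) = 0 \<Longrightarrow> \<forall>b\<in>S. c b = 0"
  shows "\<exists>C>0. \<forall>c. \<forall>b\<in>S. vabs (c b) \<le> C * vabs (\<Sum>b\<in>S. j (c b) * b)"
  using assms
proof (induction S rule: finite_induct)
  case empty
  show ?case
    by (intro exI[of _ 1]) auto
next
  case (insert b0 S)
  define v where "v c = (\<Sum>b\<in>S. j (c b) * b)" for c
  have sum_insert: "(\<Sum>b\<in>insert b0 S. j (c b) * b) = j (c b0) * b0 + v c" for c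
    using insert.hyps by (simp add: v_def)
  have v_diff: "v (\<lambda>b. c b - c' b) = v c - v c'" for c c'
    by (simp add: v_def hom_diff left_diff_distrib sum_subtractf)
  have "\<forall>b\<in>S. c b = 0" if "(\<Sum>b\<in>S. j (c b) * b) = 0" for c
  proof -
    \<comment> \<open>A relation on S becomes one on the larger set by a zero coefficient at b0,
      which carries the independence hypothesis over.\<close>
    have "v (c(b0 := 0)) = v c"
      unfolding v_def by (rule sum.cong) (use insert.hyps in auto)
    then have "(\<Sum>b\<in>insert b0 S. j ((c(b0 := 0)) b) * b) = 0"
      unfolding sum_insert using that by (simp add: v_def hom_0)
    from insert.prems[OF this] show ?thesis
      using insert.hyps by (metis fun_upd_apply insertI2)
  qed
  from insert.IH[OF this] obtain C where C: "0 < C" "\<And>c b. b \<in> S \<Longrightarrow> vabs (c b) \<le> C * vabs (v c)"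
    unfolding v_def by blast
  \<comment> \<open>The span of \<open>S\<close> is complete, hence closed, so \<open>b0\<close> has positive distance from it.\<close>
  have "\<exists>d>0. \<forall>c. d \<le> vabs (b0 - v c)"
  proof (rule ccontr)
    assume "\<not> ?thesis"
    then have "\<exists>c. vabs (b0 - v c) < 1 / real (Suc n)" for n
      by (metis not_le of_nat_0_less_iff zero_less_Suc zero_less_divide_1_iff)
    then obtain c where c: "\<And>n. vabs (b0 - v (c n)) < 1 / real (Suc n)"
      by metis
    have lim: "(\<lambda>n. v (c n)) \<longlonglongrightarrow> b0"
      unfolding tendsto_iff_vabs
    proof (rule Lim_null_comparison)
      show "\<forall>\<^sub>F n in sequentially. norm (vabs (v (c n) - b0)) \<le> 1 / real (Suc n)"
        using c by (auto simp: vabs_minus_commute less_imp_le)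
      show "(\<lambda>n. 1 / real (Suc n)) \<longlonglongrightarrow> 0"
        by (rule LIMSEQ_Suc[OF lim_1_over_n])
    qed
    \<comment> \<open>The induction hypothesis turns convergence of the vectors into Cauchy
      coordinates, and these converge because their field is complete.\<close>
    have "Cauchy (\<lambda>n. c n b)" if "b \<in> S" for b
      unfolding Cauchy_def
    proof (intro allI impI)
      fix e :: real assume "0 < e"
      then have "0 < e / C"
        using C(1) by simp
      then obtain M where M: "\<And>m n. M \<le> m \<Longrightarrow> M \<le> n \<Longrightarrow> dist (v (c m)) (v (c n)) < e / C"
        using LIMSEQ_imp_Cauchy[OF lim] unfolding Cauchy_def by blast
      have "dist (c m b) (c n b) < e" if "M \<le> m" "M \<le> n" for m n
      proof -
        have "dist (c m b) (c n b) \<le> C * dist (v (c m)) (v (c n))"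
          using C(2)[OF \<open>b \<in> S\<close>, of "\<lambda>b. c m b - c n b"] by (simp add: v_diff dist_eq_vabs)
        also have "\<dots> < C * (e / C)"
          using M[OF that] C(1) by (intro mult_strict_left_mono)
        finally show ?thesis
          using C(1) by simp
      qed
      then show "\<exists>M. \<forall>m\<ge>M. \<forall>n\<ge>M. dist (c m b) (c n b) < e"
        by blast
    qed
    then have "\<exists>a. (\<lambda>n. c n b) \<longlonglongrightarrow> a" if "b \<in> S" for b
      using that by (auto simp: Cauchy_convergent_iff convergent_def)
    then obtain a where a: "\<And>b. b \<in> S \<Longrightarrow> (\<lambda>n. c n b) \<longlonglongrightarrow> a b"
      by metis
    have "(\<lambda>n. v (c n)) \<longlonglongrightarrow> v a"
      unfolding v_def by (intro tendsto_sum tendsto_mult tendsto_hom a tendsto_const)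
    then have "b0 = v a"
      using lim by (rule LIMSEQ_unique[rotated])
    \<comment> \<open>These are the coefficients of the relation b0 - v a = 0; the coefficient 1 at
      b0 contradicts independence.\<close>
    define a' where "a' = (\<lambda>b. - a b)(b0 := 1)"
    have "v a' = v (\<lambda>b. 0 - a b)"
      unfolding v_def by (rule sum.cong) (use insert.hyps in \<open>auto simp: a'_def\<close>)
    also have "\<dots> = - v a"
      unfolding v_diff by (simp add: v_def hom_0)
    finally have "v a' = - v a" .
    moreover have "a' b0 = 1"
      by (simp add: a'_def)
    ultimately have "(\<Sum>b\<in>insert b0 S. j (a' b) * b) = b0 - v a"
      unfolding sum_insert by (simp add: hom_1)
    also have "\<dots> = 0"
      using \<open>b0 = v a\<close> by simp
    finally have "(\<Sum>b\<in>insert b0 S. j (a' b) * b) = 0" .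
    from insert.prems[OF this] show False
      by (simp add: a'_def)
  qed
  then obtain d where d: "0 < d" "\<And>c. d \<le> vabs (b0 - v c)"
    by blast
  \<comment> \<open>The summand 1 / d bounds the coordinate at b0; the other summand bounds the
    coordinates on S, after \<open>v c\<close> has been estimated by x and its b0-component.\<close>
  define C' where "C' = C * (1 + vabs b0 / d) + 1 / d"
  have pos: "0 < 1 + vabs b0 / d" "0 \<le> C * (1 + vabs b0 / d)"
    using C(1) d(1) by (auto intro: add_pos_nonneg mult_nonneg_nonneg)
  have "0 < C'"
    unfolding C'_def using d(1) pos by (simp add: add_nonneg_pos)
  moreover have "vabs (c b) \<le> C' * vabs (\<Sum>b\<in>insert b0 S. j (c b) * b)" if "b \<in> insert b0 S" for c b
  proof -
    define x where "x = j (c b0) * b0 + v c"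
    have c0: "vabs (c b0) \<le> vabs x / d"
    proof (cases "c b0 = 0")
      case False
      \<comment> \<open>Normalised so that x is \<open>j (c b0)\<close> times
        \<open>b0 - v c'\<close>, a vector of absolute value at least d. The form 0 - ... lets
        \<open>v_diff\<close> apply.\<close>
      define c' where "c' b = 0 - c b / c b0" for b
      have "j (c b0) * v c' = - v c"
        unfolding c'_def v_diff
        using False by (simp add: v_def hom_0 sum_distrib_left right_diff_distrib flip: mult.assoc hom_mult)
      then have "x = j (c b0) * (b0 - v c')"
        by (simp add: x_def right_diff_distrib)
      then have "vabs x = vabs (c b0) * vabs (b0 - v c')"
        by (simp add: vabs_mult vabs_hom)
      also have "\<dots> \<ge> vabs (c b0) * d"
        using d(2) by (intro mult_left_mono) auto
      finally show ?thesis
        using d(1) by (simp add: pos_le_divide_eq)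
    qed (use d in simp)
    have "vabs (v c) = vabs (x - j (c b0) * b0)"
      by (simp add: x_def)
    also have "\<dots> \<le> vabs x * (1 + vabs b0 / d)"
    proof (rule vabs_diff_le)
      show "vabs x \<le> vabs x * (1 + vabs b0 / d)"
        using d(1) by (simp add: distrib_left)
      have "vabs (j (c b0) * b0) \<le> vabs x / d * vabs b0"
        unfolding vabs_mult vabs_hom using c0 by (rule mult_right_mono) simp
      also have "\<dots> \<le> vabs x * (1 + vabs b0 / d)"
        by (simp add: distrib_left)
      finally show "vabs (j (c b0) * b0) \<le> vabs x * (1 + vabs b0 / d)" .
    qed
    finally have vc: "C * vabs (v c) \<le> C * (1 + vabs b0 / d) * vabs x"
      using C(1) by (simp add: mult.assoc mult.commute[of "vabs x"])
    have "vabs (c b) \<le> C' * vabs x"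
    proof (cases "b = b0")
      case True
      have "vabs x / d \<le> C' * vabs x"
        using pos(2) by (simp add: C'_def distrib_right)
      then show ?thesis
        using c0 unfolding True by (rule order_trans[rotated])
    next
      case False
      then have "vabs (c b) \<le> C * vabs (v c)"
        using that C(2) by simp
      also note vc
      also have "C * (1 + vabs b0 / d) * vabs x \<le> C' * vabs x"
        using d(1) by (simp add: C'_def distrib_right)
      finally show ?thesis .
    qed
    then show ?thesis
      unfolding sum_insert x_def .
  qed
  ultimately show ?case
    by blast
qed

text \<open>Each further generator makes the set a continuous image of a product of two compact
  sets.\<close>

lemma compact_bounded_combinations:
  assumes "finite S" and "compact D"
  shows "compact {\<Sum>b\<in>S. j (c b) * b | c. \<forall>b\<in>S. c b \<in> D}"
  using assms(1)
proof (induction S rule: finite_induct)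
  case (insert b0 S)
  let ?T = "{\<Sum>b\<in>S. j (c b) * b | c. \<forall>b\<in>S. c b \<in> D}"
  have "{\<Sum>b\<in>insert b0 S. j (c b) * b | c. \<forall>b\<in>insert b0 S. c b \<in> D} =
      (\<lambda>(a, v). j a * b0 + v) ` (D \<times> ?T)" (is "?L = ?R")
  proof (intro equalityI subsetI)
    fix x assume "x \<in> ?L"
    then obtain c where "x = (\<Sum>b\<in>insert b0 S. j (c b) * b)" "\<forall>b\<in>insert b0 S. c b \<in> D"
      by blast
    then show "x \<in> ?R"
      using insert.hyps by (intro image_eqI[of _ _ "(c b0, \<Sum>b\<in>S. j (c b) * b)"]) auto
  next
    fix x assume "x \<in> ?R"
    then obtain a c where x: "x = j a * b0 + (\<Sum>b\<in>S. j (c b) * b)" "a \<in> D" "\<forall>b\<in>S. c b \<in> D"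
      by auto
    have "(\<Sum>b\<in>S. j ((c(b0 := a)) b) * b) = (\<Sum>b\<in>S. j (c b) * b)"
      by (rule sum.cong) (use insert.hyps in auto)
    then have "x = (\<Sum>b\<in>insert b0 S. j ((c(b0 := a)) b) * b)"
      using insert.hyps x by simp
    then show "x \<in> ?L"
      using x insert.hyps by (intro CollectI exI[of _ "c(b0 := a)"]) auto
  qed
  moreover have "compact ((\<lambda>(a, v). j a * b0 + v) ` (D \<times> ?T))"
    unfolding case_prod_beta
    by (intro compact_continuous_image compact_Times insert.IH assms(2) continuous_intros
        continuous_on_compose2[OF continuous_on_hom[of UNIV]]) auto
  ultimately show ?case
    by simp
qed simp

end

section \<open>Trace and compactness for a finite extension K of Q_l\<close>

context
  fixes l :: nat
    and j :: "'q::{nonarch_field, field_char_0, complete_space} \<Rightarrow> 'k::nonarch_field"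
  assumes ext: "is_finite_extension l j"
begin

lemma ext_padic: "is_padic_field l TYPE('q)"
  and ext_hom: "valued_field_hom j"
  using ext by (simp_all add: is_finite_extension_def)


text \<open>The same choice as inside \<open>field_trace\<close>, so that the trace unfolds to a sum
  over this basis without a proof of basis independence.\<close>

definition "ext_basis = (SOME B. finite_dimensional_vector_space (ext_scale j) B)"

lemma finite_dimensional_ext: "finite_dimensional_vector_space (ext_scale j) ext_basis"
  unfolding ext_basis_def by (rule someI_ex) (use ext in \<open>simp add: is_finite_extension_def\<close>)

interpretation E: finite_dimensional_vector_space "ext_scale j" ext_basis
  by (rule finite_dimensional_ext)

lemma sum_coords_eq: "(\<Sum>b\<in>ext_basis. j (E.representation ext_basis x b) * b) = x"
  using E.sum_representation_eq[OF E.independent_Basis, of x ext_basis] E.finite_Basis E.span_Basis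
  by (simp add: ext_scale_def)

lemma ext_coords_bounded: "\<exists>C>0. \<forall>x. \<forall>b\<in>ext_basis. vabs (E.representation ext_basis x b) \<le> C * vabs x"
proof -
  have "\<exists>C>0. \<forall>c. \<forall>b\<in>ext_basis. vabs (c b) \<le> C * vabs (\<Sum>b\<in>ext_basis. j (c b) * b)"
  proof (rule coords_bounded[OF ext_hom E.finite_Basis])
    fix c assume "(\<Sum>b\<in>ext_basis. j (c b) * b) = 0"
    then show "\<forall>b\<in>ext_basis. c b = 0"
      using E.independentD[OF E.independent_Basis E.finite_Basis order_refl, of c]
      by (simp add: ext_scale_def)
  qed
  then show ?thesis
    by (metis sum_coords_eq)
qed

lemma field_trace_eq: "field_trace j x = (\<Sum>b\<in>ext_basis. E.representation ext_basis (x * b) b)"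
  by (simp add: field_trace_def ext_basis_def Let_def)

lemma field_trace_add: "field_trace j (x + y) = field_trace j x + field_trace j y"
  by (simp add: field_trace_eq distrib_right sum.distrib E.span_Basis
      E.representation_add[OF E.independent_Basis])

text \<open>The diagonal coefficients inherit the bound on coordinates. In \<open>M\<close> the
  factor 1 + (sum of the absolute values of the basis) dominates each basis vector and keeps
  \<open>M\<close> positive.\<close>

lemma field_trace_bounded: "\<exists>M>0. \<forall>x. vabs (field_trace j x) \<le> M * vabs x"
proof -
  obtain C where C: "0 < C" "\<And>x b. b \<in> ext_basis \<Longrightarrow> vabs (E.representation ext_basis x b) \<le> C * vabs x"
    using ext_coords_bounded by blast
  define M where "M = C * (1 + (\<Sum>b\<in>ext_basis. vabs b))"
  have M: "0 < M"
    using C(1) by (auto simp: M_def intro!: mult_pos_pos add_pos_nonneg sum_nonneg)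
  moreover have "vabs (field_trace j x) \<le> M * vabs x" for x
    unfolding field_trace_eq
  proof (rule vabs_sum_le)
    fix b assume b: "b \<in> ext_basis"
    have "vabs (E.representation ext_basis (x * b) b) \<le> C * (vabs x * vabs b)"
      using C(2)[OF b, of "x * b"] by (simp add: vabs_mult)
    also have "\<dots> \<le> C * (vabs x * (1 + (\<Sum>b\<in>ext_basis. vabs b)))"
      using C(1) member_le_sum[OF b _ E.finite_Basis, of vabs]
      by (intro mult_left_mono) auto
    finally show "vabs (E.representation ext_basis (x * b) b) \<le> M * vabs x"
      by (simp add: M_def algebra_simps)
  qed (use M in simp)
  ultimately show ?thesis
    by blast
qed

lemma field_trace_hom: "field_trace j (j a) = of_nat (card ext_basis) * a"
proof -
  have "E.representation ext_basis (j a * b) b = a" if "b \<in> ext_basis" for b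
  proof -
    have "E.representation ext_basis (ext_scale j a b) = (\<lambda>v. a * E.representation ext_basis b v)"
      using E.span_Basis by (intro E.representation_scale E.independent_Basis) simp
    then show ?thesis
      using that by (simp add: ext_scale_def E.representation_basis[OF E.independent_Basis])
  qed
  then show ?thesis
    by (simp add: field_trace_eq)
qed

text \<open>A scalar has trace equal to the degree times itself, and the degree is invertible in
  characteristic zero. This yields nontriviality of the character of K.\<close>

lemma ex_field_trace_eq: "\<exists>x. field_trace j x = a"
proof -
  have "ext_basis \<noteq> {}"
    using sum_coords_eq[of 1] by force
  then have "(of_nat (card ext_basis) :: 'q) \<noteq> 0"
    using E.finite_Basis by simp
  then have "field_trace j (j (a / of_nat (card ext_basis))) = a"
    by (simp add: field_trace_hom)
  then show ?thesis
    by blast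
qed

text \<open>Integral elements have bounded coordinates, so the valuation ring is a closed subset of
  a compact set of combinations.\<close>

lemma compact_valuation_ring_ext: "compact (valuation_ring :: 'k set)"
proof -
  obtain C where C: "0 < C" "\<And>x b. b \<in> ext_basis \<Longrightarrow> vabs (E.representation ext_basis x b) \<le> C * vabs x"
    using ext_coords_bounded by blast
  let ?T = "{\<Sum>b\<in>ext_basis. j (c b) * b | c. \<forall>b\<in>ext_basis. c b \<in> {a. vabs a \<le> C}}"
  have closed: "closed (valuation_ring :: 'k set)"
    using closed_vabs_le[of "0::'k" 1] by (simp add: valuation_ring_def)
  have compact: "compact ?T"
    by (rule compact_bounded_combinations[OF ext_hom E.finite_Basis compact_padic_cball[OF ext_padic]])
  have "valuation_ring \<subseteq> ?T"
  proof
    fix x :: 'k assume "x \<in> valuation_ring"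
    then have "C * vabs x \<le> C"
      using C(1) by (simp add: valuation_ring_iff)
    then have "\<forall>b\<in>ext_basis. vabs (E.representation ext_basis x b) \<le> C"
      using C(2) by (meson order_trans)
    then show "x \<in> ?T"
      by (intro CollectI exI[of _ "E.representation ext_basis x"]) (simp add: sum_coords_eq)
  qed
  then have "?T \<inter> valuation_ring = valuation_ring"
    by (rule Int_absorb1)
  then show ?thesis
    using compact_Int_closed[OF compact closed] by simp
qed

lemma vabs_of_nat_ext: "vabs (of_nat n :: 'k) = vabs (of_nat n :: 'q)"
  using vabs_hom[OF ext_hom, of "of_nat n"] by (simp add: hom_of_nat[OF ext_hom])

end


section \<open>Sums over cosets\<close>

definition add_subgroup :: "'a::ab_group_add set \<Rightarrow> bool"
  where "add_subgroup B \<longleftrightarrow> 0 \<in> B \<and> (\<forall>x\<in>B. \<forall>y\<in>B. x - y \<in> B)"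

text \<open>The predicate under \<open>SOME\<close> depends only on the coset of x, so elements of
  one coset get the identical representative; quotients are thus replaced by sets of
  representatives.\<close>

definition coset_rep :: "'a::ab_group_add set \<Rightarrow> 'a \<Rightarrow> 'a"
  where "coset_rep B x = (SOME y. y - x \<in> B)"

text \<open>Stands for the sum over A / B; it does not depend on the representatives when f is
  \<open>coset_invariant\<close> under B.\<close>

definition coset_sum :: "'a::ab_group_add set \<Rightarrow> 'a set \<Rightarrow> ('a \<Rightarrow> 'b::comm_monoid_add) \<Rightarrow> 'b"
  where "coset_sum A B f = (\<Sum>y\<in>coset_rep B ` A. f y)"

definition coset_index :: "'a::ab_group_add set \<Rightarrow> 'a set \<Rightarrow> nat"
  where "coset_index A B = card (coset_rep B ` A)"

definition coset_invariant :: "'a::ab_group_add set \<Rightarrow> ('a \<Rightarrow> 'b) \<Rightarrow> bool"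
  where "coset_invariant B f \<longleftrightarrow> (\<forall>x y. x - y \<in> B \<longrightarrow> f x = f y)"

lemma add_subgroup_0: "add_subgroup B \<Longrightarrow> 0 \<in> B"
  and add_subgroup_diff: "add_subgroup B \<Longrightarrow> x \<in> B \<Longrightarrow> y \<in> B \<Longrightarrow> x - y \<in> B"
  by (auto simp: add_subgroup_def)

lemma add_subgroup_minus: "add_subgroup B \<Longrightarrow> x \<in> B \<Longrightarrow> - x \<in> B"
  using add_subgroup_diff[of B 0 x] by (simp add: add_subgroup_0)

lemma add_subgroup_add: "add_subgroup B \<Longrightarrow> x \<in> B \<Longrightarrow> y \<in> B \<Longrightarrow> x + y \<in> B"
  using add_subgroup_diff[of B x "- y"] by (simp add: add_subgroup_minus)

lemma add_subgroup_diff_commute: "add_subgroup B \<Longrightarrow> x - y \<in> B \<longleftrightarrow> y - x \<in> B"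
  using add_subgroup_minus[of B "x - y"] add_subgroup_minus[of B "y - x"] by auto

lemma add_subgroup_of_nat_mult:
  fixes x :: "'a::ring_1"
  shows "add_subgroup B \<Longrightarrow> x \<in> B \<Longrightarrow> of_nat n * x \<in> B"
  by (induction n) (auto simp: distrib_right add_subgroup_0 intro: add_subgroup_add)

lemma add_subgroup_of_int_mult:
  fixes x :: "'a::ring_1"
  shows "add_subgroup B \<Longrightarrow> x \<in> B \<Longrightarrow> of_int k * x \<in> B"
  by (cases k rule: int_cases2) (auto intro: add_subgroup_of_nat_mult add_subgroup_minus)

lemma coset_rep_diff: "add_subgroup B \<Longrightarrow> coset_rep B x - x \<in> B"
  unfolding coset_rep_def by (rule someI[of _ x]) (simp add: add_subgroup_0)

lemma coset_rep_eq_iff: 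
  assumes "add_subgroup B"
  shows "coset_rep B x = coset_rep B y \<longleftrightarrow> x - y \<in> B"
proof
  assume eq: "coset_rep B x = coset_rep B y"
  have "(coset_rep B y - y) - (coset_rep B x - x) \<in> B"
    by (intro add_subgroup_diff coset_rep_diff assms)
  with eq show "x - y \<in> B"
    by simp
next
  assume xy: "x - y \<in> B"
  have "z - x \<in> B \<longleftrightarrow> z - y \<in> B" for z
    using add_subgroup_add[OF assms _ xy, of "z - x"] add_subgroup_diff[OF assms _ xy, of "z - y"]
    by auto
  then show "coset_rep B x = coset_rep B y"
    by (simp add: coset_rep_def)
qed

lemma coset_rep_coset_rep: "add_subgroup B \<Longrightarrow> coset_rep B (coset_rep B x) = coset_rep B x"
  by (simp add: coset_rep_eq_iff coset_rep_diff)

lemma coset_rep_image_fixed: "add_subgroup B \<Longrightarrow> y \<in> coset_rep B ` A \<Longrightarrow> coset_rep B y = y"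
  by (auto simp: coset_rep_coset_rep)

lemma coset_rep_in: "add_subgroup A \<Longrightarrow> add_subgroup B \<Longrightarrow> B \<subseteq> A \<Longrightarrow> x \<in> A \<Longrightarrow> coset_rep B x \<in> A"
  using add_subgroup_add[of A "coset_rep B x - x" x] coset_rep_diff[of B x] by auto

lemma coset_rep_image_subset:
  "add_subgroup A \<Longrightarrow> add_subgroup B \<Longrightarrow> B \<subseteq> A \<Longrightarrow> coset_rep B ` A \<subseteq> A"
  by (auto intro: coset_rep_in)

lemma coset_invariantD: "coset_invariant B f \<Longrightarrow> x - y \<in> B \<Longrightarrow> f x = f y"
  by (simp add: coset_invariant_def)

lemma coset_invariant_mono: "coset_invariant B f \<Longrightarrow> C \<subseteq> B \<Longrightarrow> coset_invariant C f"
  by (auto simp: coset_invariant_def)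

lemma coset_invariant_coset_rep:
  "add_subgroup B \<Longrightarrow> coset_invariant B f \<Longrightarrow> f (coset_rep B x) = f x"
  by (rule coset_invariantD) (auto intro: coset_rep_diff)

text \<open>Translation by a, followed by \<open>coset_rep\<close>, permutes the
  representatives.\<close>

lemma coset_sum_translate:
  assumes A: "add_subgroup A" and B: "add_subgroup B" and "B \<subseteq> A" and "a \<in> A"
    and f: "coset_invariant B f"
  shows "coset_sum A B (\<lambda>x. f (x + a)) = coset_sum A B f"
  unfolding coset_sum_def
proof (rule sum.reindex_bij_witness[of _ "\<lambda>y. coset_rep B (y - a)" "\<lambda>y. coset_rep B (y + a)"])
  fix y assume y: "y \<in> coset_rep B ` A"
  then have "y \<in> A"
    using assms coset_rep_image_subset by blast
  then show "coset_rep B (y + a) \<in> coset_rep B ` A" "coset_rep B (y - a) \<in> coset_rep B ` A"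
    using assms by (auto intro: add_subgroup_add add_subgroup_diff)
  have "coset_rep B (coset_rep B (y + a) - a) = coset_rep B y"
    unfolding coset_rep_eq_iff[OF B] using coset_rep_diff[OF B, of "y + a"]
    by (simp add: algebra_simps)
  then show "coset_rep B (coset_rep B (y + a) - a) = y"
    using coset_rep_image_fixed[OF B y] by simp
  have "coset_rep B (coset_rep B (y - a) + a) = coset_rep B y"
    unfolding coset_rep_eq_iff[OF B] using coset_rep_diff[OF B, of "y - a"]
    by (simp add: algebra_simps)
  then show "coset_rep B (coset_rep B (y - a) + a) = y"
    using coset_rep_image_fixed[OF B y] by simp
  show "f (coset_rep B (y + a)) = f (y + a)"
    by (rule coset_invariant_coset_rep[OF B f])
qed

text \<open>Translation by y matches the cosets of C inside B with those inside y + B.\<close>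

lemma card_coset_fibre:
  assumes A: "add_subgroup A" and B: "add_subgroup B" and C: "add_subgroup C"
    and "C \<subseteq> B" "B \<subseteq> A" and "y \<in> A"
  shows "card {x \<in> coset_rep C ` A. x - y \<in> B} = coset_index B C"
  unfolding coset_index_def
proof (rule bij_betw_same_card[symmetric], rule bij_betwI)
  show "(\<lambda>x. coset_rep C (x + y)) \<in> coset_rep C ` B \<rightarrow> {x \<in> coset_rep C ` A. x - y \<in> B}"
  proof
    fix x assume "x \<in> coset_rep C ` B"
    then have x: "x \<in> B"
      using coset_rep_image_subset[OF B C] assms by blast
    then have "x + y \<in> A"
      using assms by (auto intro: add_subgroup_add)
    moreover have "(coset_rep C (x + y) - (x + y)) + x \<in> B"
      using x assms coset_rep_diff[OF C] by (intro add_subgroup_add[OF B]) auto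
    ultimately show "coset_rep C (x + y) \<in> {x \<in> coset_rep C ` A. x - y \<in> B}"
      by simp
  qed
  show "(\<lambda>x. coset_rep C (x - y)) \<in> {x \<in> coset_rep C ` A. x - y \<in> B} \<rightarrow> coset_rep C ` B"
    by auto
next
  fix x assume "x \<in> coset_rep C ` B"
  then have "coset_rep C x = x"
    by (rule coset_rep_image_fixed[OF C])
  moreover have "coset_rep C (coset_rep C (x + y) - y) = coset_rep C x"
    unfolding coset_rep_eq_iff[OF C] using coset_rep_diff[OF C, of "x + y"]
    by (simp add: algebra_simps)
  ultimately show "coset_rep C (coset_rep C (x + y) - y) = x"
    by simp
next
  fix x assume "x \<in> {x \<in> coset_rep C ` A. x - y \<in> B}"
  then have "coset_rep C x = x"
    using coset_rep_image_fixed[OF C] by blast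
  moreover have "coset_rep C (coset_rep C (x - y) + y) = coset_rep C x"
    unfolding coset_rep_eq_iff[OF C] using coset_rep_diff[OF C, of "x - y"]
    by (simp add: algebra_simps)
  ultimately show "coset_rep C (coset_rep C (x - y) + y) = x"
    by simp
qed

lemma coset_rep_image_coset_rep:
  assumes "add_subgroup B" and "add_subgroup C" and "C \<subseteq> B"
  shows "coset_rep B ` coset_rep C ` A = coset_rep B ` A"
proof -
  have "coset_rep B (coset_rep C x) = coset_rep B x" for x
    using assms coset_rep_diff[of C x] by (auto simp: coset_rep_eq_iff)
  then show ?thesis
    by (simp add: image_image)
qed

text \<open>The cosets of C are grouped by the coset of B containing them; f is constant on each
  group and all groups have the size given by \<open>card_coset_fibre\<close>.\<close>

lemma coset_sum_tower:
  fixes f :: "'a::ab_group_add \<Rightarrow> 'b::semiring_1"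
  assumes A: "add_subgroup A" and B: "add_subgroup B" and C: "add_subgroup C"
    and "C \<subseteq> B" "B \<subseteq> A"
    and fin: "finite (coset_rep C ` A)" and f: "coset_invariant B f"
  shows "coset_sum A C f = of_nat (coset_index B C) * coset_sum A B f"
proof -
  have img: "coset_rep B ` coset_rep C ` A = coset_rep B ` A"
    by (rule coset_rep_image_coset_rep[OF B C \<open>C \<subseteq> B\<close>])
  have "coset_sum A C f =
      (\<Sum>y\<in>coset_rep B ` A. \<Sum>x\<in>{x. x \<in> coset_rep C ` A \<and> coset_rep B x = y}. f x)"
    unfolding coset_sum_def
    by (rule sum.group[symmetric]) (use fin img finite_imageI[OF fin, of "coset_rep B"] in auto)
  also have "\<dots> = (\<Sum>y\<in>coset_rep B ` A. of_nat (coset_index B C) * f y)"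
  proof (rule sum.cong)
    fix y assume y: "y \<in> coset_rep B ` A"
    have "y \<in> A"
      using y coset_rep_image_subset[OF A B \<open>B \<subseteq> A\<close>] by blast
    have eq: "coset_rep B x = y \<longleftrightarrow> x - y \<in> B" for x
      using coset_rep_image_fixed[OF B y] coset_rep_eq_iff[OF B, of x y] by simp
    have "(\<Sum>x\<in>{x. x \<in> coset_rep C ` A \<and> coset_rep B x = y}. f x) =
        (\<Sum>x\<in>{x \<in> coset_rep C ` A. x - y \<in> B}. f y)"
      by (rule sum.cong) (auto simp: eq intro: coset_invariantD[OF f])
    also have "\<dots> = of_nat (coset_index B C) * f y"
      using card_coset_fibre[OF A B C _ _ \<open>y \<in> A\<close>] assms by simp
    finally show "(\<Sum>x\<in>{x. x \<in> coset_rep C ` A \<and> coset_rep B x = y}. f x) = of_nat (coset_index B C) * f y" .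
  qed simp
  finally show ?thesis
    by (simp add: coset_sum_def sum_distrib_left)
qed

lemma coset_index_tower:
  assumes "add_subgroup A" and "add_subgroup B" and "add_subgroup C"
    and "C \<subseteq> B" "B \<subseteq> A" and "finite (coset_rep C ` A)"
  shows "coset_index A C = coset_index B C * coset_index A B"
  using coset_sum_tower[OF assms, of "\<lambda>_. 1::nat"]
  by (simp add: coset_sum_def coset_index_def coset_invariant_def)

lemma coset_index_scale:
  fixes c :: "'a::field"
  assumes "add_subgroup B" and "c \<noteq> 0"
  shows "coset_index ((*) c ` A) ((*) c ` B) = coset_index A B"
proof -
  have cB: "add_subgroup ((*) c ` B)"
    using assms(1) unfolding add_subgroup_def
    by (auto intro!: image_eqI simp: right_diff_distrib[symmetric])
  have mem: "c * x \<in> (*) c ` B \<longleftrightarrow> x \<in> B" for x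
    using assms(2) by auto
  have "coset_rep ((*) c ` B) (c * x) = coset_rep ((*) c ` B) (c * y) \<longleftrightarrow> coset_rep B x = coset_rep B y" for x y
    by (simp add: coset_rep_eq_iff[OF cB] coset_rep_eq_iff[OF assms(1)] mem flip: right_diff_distrib)
  moreover have "coset_rep B (coset_rep B x) = coset_rep B x" for x
    by (rule coset_rep_coset_rep[OF assms(1)])
  ultimately have "inj_on (\<lambda>y. coset_rep ((*) c ` B) (c * y)) (coset_rep B ` A)"
    and "(\<lambda>y. coset_rep ((*) c ` B) (c * y)) ` (coset_rep B ` A) = coset_rep ((*) c ` B) ` (*) c ` A"
    by (auto simp: inj_on_def image_image)
  then show ?thesis
    unfolding coset_index_def by (metis card_image)
qed

text \<open>Induction on the index of B. If B is not A, adjoining one element a of A outside B gives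
  an intermediate group in which B has index exactly l, since l a lies in B.\<close>

lemma coset_index_prime_power:
  fixes A B :: "'a::comm_ring_1 set"
  assumes A: "add_subgroup A" and l: "prime l"
    and "add_subgroup B" and "B \<subseteq> A" and "finite (coset_rep B ` A)" and "\<And>x. x \<in> A \<Longrightarrow> of_nat l * x \<in> B"
  shows "\<exists>k. coset_index A B = l ^ k"
  using assms(3-)
proof (induction "coset_index A B" arbitrary: B rule: less_induct)
  case less
  note B = \<open>add_subgroup B\<close>
  show ?case
  proof (cases "A = B")
    case True
    then have "coset_rep B ` A = {coset_rep B 0}"
      using coset_rep_eq_iff[OF B, of _ 0] add_subgroup_0[OF B] by auto
    then show ?thesis
      by (intro exI[of _ 0]) (simp add: coset_index_def)
  next
    case False
    then obtain a where a: "a \<in> A" "a \<notin> B"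
      using less.prems by blast
    have l1: "1 < l"
      using l by (rule prime_gt_1_nat)
    define B' where "B' = {b + of_int k * a | b k. b \<in> B}"
    have B': "add_subgroup B'"
      unfolding add_subgroup_def
    proof (intro conjI ballI)
      show "0 \<in> B'"
        unfolding B'_def using add_subgroup_0[OF B] by (intro CollectI exI[of _ 0]) simp
      fix x y assume "x \<in> B'" "y \<in> B'"
      then obtain b k b' k' where "x = b + of_int k * a" "y = b' + of_int k' * a" "b \<in> B" "b' \<in> B"
        unfolding B'_def by blast
      then show "x - y \<in> B'"
        unfolding B'_def using add_subgroup_diff[OF B]
        by (intro CollectI exI[of _ "b - b'"] exI[of _ "k - k'"]) (simp add: algebra_simps)
    qed
    have BB': "B \<subseteq> B'"
      unfolding B'_def by (force intro: exI[of _ 0])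
    have B'A: "B' \<subseteq> A"
      unfolding B'_def using less.prems a add_subgroup_add[OF A] add_subgroup_of_int_mult[OF A] by blast
    \<comment> \<open>Modulo B a multiple of a depends only on its factor modulo l, which leaves at
      most l cosets.\<close>
    have red: "of_int k * a - of_nat (nat (k mod int l)) * a \<in> B" for k
    proof -
      have "of_nat (nat (k mod int l)) = (of_int (k mod int l) :: 'a)"
        using l1 by simp
      then have "of_int k * a - of_nat (nat (k mod int l)) * a = of_int (k - k mod int l) * a"
        by (simp add: left_diff_distrib)
      also have "\<dots> = of_int (k div int l) * (of_nat l * a)"
        by (simp add: minus_mod_eq_mult_div algebra_simps)
      also have "\<dots> \<in> B"
        using less.prems(4)[OF a(1)] by (rule add_subgroup_of_int_mult[OF B])
      finally show ?thesis .
    qed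
    have "coset_rep B ` B' = (\<lambda>n. coset_rep B (of_nat n * a)) ` {..<l}"
    proof (intro equalityI subsetI)
      fix y assume "y \<in> coset_rep B ` B'"
      then obtain b k where bk: "y = coset_rep B (b + of_int k * a)" "b \<in> B"
        unfolding B'_def by blast
      have "b + of_int k * a - of_nat (nat (k mod int l)) * a \<in> B"
        using add_subgroup_add[OF B bk(2) red[of k]] by (simp add: algebra_simps)
      then have "y = coset_rep B (of_nat (nat (k mod int l)) * a)"
        using bk coset_rep_eq_iff[OF B] by blast
      moreover have "nat (k mod int l) < l"
        using l1 by (simp add: nat_less_iff)
      ultimately show "y \<in> (\<lambda>n. coset_rep B (of_nat n * a)) ` {..<l}"
        by blast
    next
      fix y assume "y \<in> (\<lambda>n. coset_rep B (of_nat n * a)) ` {..<l}"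
      then obtain n where "y = coset_rep B (of_nat n * a)"
        by blast
      moreover have "of_nat n * a \<in> B'"
        unfolding B'_def using add_subgroup_0[OF B] by (force intro: exI[of _ "int n"])
      ultimately show "y \<in> coset_rep B ` B'"
        by blast
    qed
    moreover have "inj_on (\<lambda>n. coset_rep B (of_nat n * a)) {..<l}"
    proof (rule inj_onI)
      fix n m assume nm: "n \<in> {..<l}" "m \<in> {..<l}" "coset_rep B (of_nat n * a) = coset_rep B (of_nat m * a)"
      define d where "d = int n - int m"
      have dB: "of_int d * a \<in> B"
        using nm(3) by (simp add: coset_rep_eq_iff[OF B] d_def left_diff_distrib)
      \<comment> \<open>Otherwise a Bezout relation writes a as a combination of d a and l a, both
        in B.\<close>
      have "\<not> coprime d (int l)"
      proof
        assume "coprime d (int l)"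
        then obtain u v where "u * d + v * int l = 1"
          by (metis bezout_int coprime_iff_gcd_eq_1)
        then have "a = of_int (u * d + v * int l) * a"
          by simp
        also have "\<dots> = of_int u * (of_int d * a) + of_int v * (of_nat l * a)"
          by (simp add: algebra_simps)
        also have "\<dots> \<in> B"
          by (rule add_subgroup_add[OF B add_subgroup_of_int_mult[OF B dB]
                add_subgroup_of_int_mult[OF B less.prems(4)[OF a(1)]]])
        finally show False
          using a by simp
      qed
      then have "int l dvd d"
        using l by (metis coprime_commute prime_imp_coprime prime_nat_int_transfer)
      moreover have "\<bar>d\<bar> < int l"
        using nm by (auto simp: d_def)
      ultimately have "d = 0"
        using zdvd_not_zless[of "\<bar>d\<bar>" "int l"] by fastforce
      then show "n = m"
        by (simp add: d_def)
    qed
    ultimately have index: "coset_index B' B = l"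
      by (simp add: coset_index_def card_image)
    have fin: "finite (coset_rep B' ` A)"
      using finite_imageI[OF less.prems(3), of "coset_rep B'"] coset_rep_image_coset_rep[OF B' B BB']
      by simp
    have tower: "coset_index A B = l * coset_index A B'"
      using coset_index_tower[OF A B' B BB' B'A less.prems(3)] index by simp
    have "coset_rep B' ` A \<noteq> {}"
      using a by blast
    then have "0 < coset_index A B'"
      using fin by (simp add: coset_index_def card_gt_0_iff)
    then have "coset_index A B' < coset_index A B"
      using l1 by (simp add: tower)
    then obtain k where "coset_index A B' = l ^ k"
      using less.hyps[OF _ B' B'A fin] less.prems(4) BB' by blast
    then show ?thesis
      by (intro exI[of _ "Suc k"]) (simp add: tower)
  qed
qed


section \<open>Local fields\<close>

text \<open>What the analysis on K requires. The condition \<open>\<pi> \<noteq> 0\<close> excludes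
  the trivial absolute value, whose maximal ideal is generated by 0.\<close>

locale local_field =
  fixes \<pi> :: "'k::nonarch_field"
  assumes uniformizer: "is_uniformizer \<pi>"
    and uniformizer_nonzero: "\<pi> \<noteq> 0"
    and compact_valuation_ring: "compact (valuation_ring :: 'k set)"
begin

definition pball :: "int \<Rightarrow> 'k set"
  where "pball n = {x. vabs x \<le> vabs \<pi> powi n}"

lemma pball_iff: "x \<in> pball n \<longleftrightarrow> vabs x \<le> vabs \<pi> powi n"
  by (simp add: pball_def)

lemma vabs_uniformizer_pos: "0 < vabs \<pi>"
  by (simp add: uniformizer_nonzero)

lemma vabs_uniformizer_less_1: "vabs \<pi> < 1"
proof -
  have "\<pi> * 1 \<in> {\<pi> * y | y. y \<in> valuation_ring}"
    using valuation_ring_1 by blast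
  then have "\<pi> \<in> maximal_ideal"
    using uniformizer unfolding is_uniformizer_def by simp
  then show ?thesis
    by (simp add: maximal_ideal_def)
qed

lemma radius_pos: "0 < vabs \<pi> powi n"
  by (rule zero_less_power_int[OF vabs_uniformizer_pos])

lemma radius_antimono: "n \<le> m \<Longrightarrow> vabs \<pi> powi m \<le> vabs \<pi> powi n"
  using vabs_uniformizer_pos vabs_uniformizer_less_1 by (intro power_int_decreasing) auto

lemma radius_add: "vabs \<pi> powi (n + m) = vabs \<pi> powi n * vabs \<pi> powi m"
  by (rule power_int_add) (simp add: uniformizer_nonzero)

lemma valuation_ring_eq_pball: "valuation_ring = pball 0"
  by (simp add: valuation_ring_def pball_def)

lemma pball_antimono: "n \<le> m \<Longrightarrow> pball m \<subseteq> pball n"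
  using radius_antimono[of n m] by (auto simp: pball_iff)

lemma pball_scale: "(*) (\<pi> powi n) ` pball m = pball (n + m)"
proof (intro equalityI subsetI)
  fix x assume "x \<in> (*) (\<pi> powi n) ` pball m"
  then show "x \<in> pball (n + m)"
    using radius_pos[of n] by (auto simp: pball_iff vabs_mult vabs_powi radius_add intro!: mult_left_mono)
next
  fix x assume "x \<in> pball (n + m)"
  then have "x / \<pi> powi n \<in> pball m"
    using radius_pos[of n] by (simp add: pball_iff vabs_divide vabs_powi radius_add field_simps)
  then show "x \<in> (*) (\<pi> powi n) ` pball m"
    using uniformizer_nonzero by (intro image_eqI[of _ _ "x / \<pi> powi n"]) auto
qed

lemma frac_ideal_eq_pball: "frac_ideal \<pi> n = pball n"
  using pball_scale[of n 0] unfolding frac_ideal_def valuation_ring_eq_pball by auto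

lemma maximal_ideal_eq_pball: "maximal_ideal = pball 1"
proof -
  have "maximal_ideal = (*) \<pi> ` pball 0"
    using uniformizer unfolding is_uniformizer_def valuation_ring_eq_pball by blast
  then show ?thesis
    using pball_scale[of 1 0] by simp
qed

lemma add_subgroup_pball: "add_subgroup (pball n)"
  using radius_pos[of n] by (auto simp: add_subgroup_def pball_iff intro: vabs_diff_le)

lemma pball_0: "0 \<in> pball n"
  by (rule add_subgroup_0[OF add_subgroup_pball])

lemma open_pball: "open (pball n)"
  using open_vabs_le[OF radius_pos, where a = 0] by (simp add: pball_def)

lemma compact_pball: "compact (pball n)"
proof -
  have "compact ((*) (\<pi> powi n) ` pball 0)"
    using compact_valuation_ring unfolding valuation_ring_eq_pball
    by (intro compact_continuous_image continuous_intros)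
  then show ?thesis
    by (simp add: pball_scale)
qed

lemma ex_radius_less:
  assumes "0 < e"
  obtains n where "m \<le> n" and "vabs \<pi> powi n < e"
proof -
  obtain k where "vabs \<pi> ^ k < e"
    using real_arch_pow_inv[OF assms vabs_uniformizer_less_1] by blast
  then have "vabs \<pi> powi (int k) < e"
    by simp
  moreover have "vabs \<pi> powi (max m (int k)) \<le> vabs \<pi> powi (int k)"
    by (rule radius_antimono) simp
  ultimately have "vabs \<pi> powi (max m (int k)) < e"
    by linarith
  then show ?thesis
    using that[of "max m (int k)"] by simp
qed

lemma ex_pball_covers:
  obtains m where "m \<le> n" and "\<And>x. vabs x \<le> r \<Longrightarrow> x \<in> pball m"
proof -
  \<comment> \<open>A radius below e has an inverse above r; the shape 1 + |r| keeps e positive for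
    every real r.\<close>
  define e where "e = 1 / (1 + \<bar>r\<bar>)"
  have "0 < e"
    by (simp add: e_def add_pos_nonneg)
  then obtain k where k: "- n \<le> k" "vabs \<pi> powi k < e"
    using ex_radius_less by blast
  have "r \<le> 1 / e"
    by (simp add: e_def)
  also have "\<dots> \<le> 1 / (vabs \<pi> powi k)"
    using k radius_pos[of k] \<open>0 < e\<close> by (intro divide_left_mono) auto
  also have "\<dots> = vabs \<pi> powi (- k)"
    by (simp add: power_int_minus divide_inverse)
  finally show ?thesis
    using that[of "- k"] k(1) by (force simp: pball_iff)
qed

lemma compact_subset_pball:
  assumes "compact U"
  obtains m where "U \<subseteq> pball m"
proof -
  obtain r where "\<And>x. x \<in> U \<Longrightarrow> dist 0 x \<le> r"
    using compact_imp_bounded[OF assms] bounded_any_center[of U 0] by blast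
  then have r: "\<And>x. x \<in> U \<Longrightarrow> vabs x \<le> r"
    by (simp add: dist_eq_vabs)
  obtain m where "\<And>x. vabs x \<le> r \<Longrightarrow> x \<in> pball m"
    by (rule ex_pball_covers[of 0 r]) blast
  with r show ?thesis
    by (intro that[of m] subsetI) blast
qed

text \<open>Discreteness of the valuation: \<open>\<pi> powi n / r\<close> lies in the maximal
  ideal, hence in \<pi> o_K, which improves a strict inequality by a full factor of
  \<open>vabs \<pi>\<close>.\<close>

lemma radius_gap:
  assumes "r \<notin> pball n"
  shows "vabs \<pi> powi (n - 1) \<le> vabs r"
proof -
  have r: "vabs \<pi> powi n < vabs r"
    using assms by (simp add: pball_iff)
  then have "0 < vabs r"
    using radius_pos[of n] by linarith
  with r have "\<pi> powi n / r \<in> maximal_ideal"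
    by (simp add: maximal_ideal_def vabs_divide vabs_powi)
  then have "vabs \<pi> powi n / vabs r \<le> vabs \<pi>"
    by (simp add: maximal_ideal_eq_pball pball_iff vabs_divide vabs_powi)
  then have "vabs \<pi> powi ((n - 1) + 1) \<le> vabs \<pi> * vabs r"
    using \<open>0 < vabs r\<close> by (simp add: pos_divide_le_eq)
  then show ?thesis
    using vabs_uniformizer_pos by (simp only: radius_add) (simp add: mult.commute)
qed

text \<open>The cosets of \<open>pball n\<close> are open, so finitely many of them cover the
  compact ball \<open>pball m\<close>.\<close>

lemma finite_coset_reps: "finite (coset_rep (pball n) ` pball m)"
proof -
  have "\<exists>D\<subseteq>pball m. finite D \<and> pball m \<subseteq> (\<Union>c\<in>D. {x. vabs (x - c) \<le> vabs \<pi> powi n})"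
    by (rule compactE_image[OF compact_pball[of m], of "pball m" "\<lambda>c. {x. vabs (x - c) \<le> vabs \<pi> powi n}"])
      (use open_vabs_le[OF radius_pos] radius_pos in \<open>auto simp: less_imp_le\<close>)
  then obtain D where D: "finite D" "pball m \<subseteq> (\<Union>c\<in>D. {x. x - c \<in> pball n})"
    unfolding pball_iff by blast
  have "coset_rep (pball n) ` pball m \<subseteq> coset_rep (pball n) ` D"
    using D(2) coset_rep_eq_iff[OF add_subgroup_pball] by blast
  then show ?thesis
    using D(1) finite_surj by blast
qed

text \<open>One side counts representatives and the other equivalence classes; sending a
  representative to its class under \<open>R\<close> is a bijection.\<close>

lemma coset_index_residue: "coset_index (pball 0) (pball 1) = residue_card TYPE('k)"
proof -
  define R :: "('k \<times> 'k) set"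
    where "R = {(x, y). x \<in> valuation_ring \<and> y \<in> valuation_ring \<and> x - y \<in> maximal_ideal}"
  let ?\<rho> = "coset_rep (pball 1)"
  note sub = add_subgroup_pball
  have in0: "?\<rho> x \<in> pball 0" if "x \<in> pball 0" for x
    using that by (intro coset_rep_in sub pball_antimono) auto
  have R_eq: "R `` {x} = {y \<in> pball 0. ?\<rho> y = ?\<rho> x}" if "x \<in> pball 0" for x
    using that add_subgroup_diff_commute[OF sub[of 1]]
    by (auto simp: R_def coset_rep_eq_iff[OF sub] valuation_ring_eq_pball maximal_ideal_eq_pball)
  have "inj_on (\<lambda>y. R `` {y}) (?\<rho> ` pball 0)"
  proof (rule inj_onI)
    fix y z assume yz: "y \<in> ?\<rho> ` pball 0" "z \<in> ?\<rho> ` pball 0" "R `` {y} = R `` {z}"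
    then have "y \<in> pball 0" "z \<in> pball 0"
      using in0 by auto
    then have "y \<in> R `` {z}"
      unfolding yz(3)[symmetric] by (simp add: R_eq)
    then have "?\<rho> y = ?\<rho> z"
      using \<open>z \<in> pball 0\<close> by (simp add: R_eq)
    then show "y = z"
      using yz coset_rep_image_fixed[OF sub] by metis
  qed
  moreover have "(\<lambda>y. R `` {y}) ` (?\<rho> ` pball 0) = valuation_ring // R"
  proof -
    have "R `` {?\<rho> x} = R `` {x}" if "x \<in> pball 0" for x
      using that in0 by (simp add: R_eq coset_rep_coset_rep[OF sub])
    then show ?thesis
      unfolding quotient_def valuation_ring_eq_pball by (auto simp: image_image)
  qed
  ultimately have "card (valuation_ring // R) = card (?\<rho> ` pball 0)"
    by (metis card_image)
  then show ?thesis
    by (simp add: residue_card_def coset_index_def R_def)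
qed

text \<open>Multiplication by a power of \<pi> carries each layer to \<open>pball 0\<close> over
  \<open>pball 1\<close>, and indices multiply in towers.\<close>

lemma coset_index_pball: "coset_index (pball n) (pball (n + int k)) = residue_card TYPE('k) ^ k"
proof (induction k)
  case 0
  have "coset_rep (pball n) ` pball n = {coset_rep (pball n) 0}"
    using coset_rep_eq_iff[OF add_subgroup_pball, of n _ 0] pball_0 by auto
  then show ?case
    by (simp add: coset_index_def)
next
  case (Suc k)
  let ?m = "n + int k"
  have "coset_index (pball ?m) (pball (?m + 1)) = coset_index (pball 0) (pball 1)"
    using coset_index_scale[OF add_subgroup_pball, of "\<pi> powi ?m" "pball 0" 1] uniformizer_nonzero
    by (simp add: pball_scale)
  moreover have "coset_index (pball n) (pball (?m + 1)) =
      coset_index (pball ?m) (pball (?m + 1)) * coset_index (pball n) (pball ?m)"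
    by (intro coset_index_tower add_subgroup_pball pball_antimono finite_coset_reps) auto
  ultimately show ?case
    using Suc.IH by (simp add: coset_index_residue algebra_simps)
qed

text \<open>Multiplication by l maps \<open>pball 0\<close> into \<open>pball 1\<close>, so the
  residue group is killed by l.\<close>

lemma residue_card_prime_power:
  assumes "prime l" and "vabs (of_nat l :: 'k) < 1"
  shows "\<exists>k. residue_card TYPE('k) = l ^ k"
proof -
  have "of_nat l * x \<in> pball 1" if "x \<in> pball 0" for x :: 'k
  proof -
    have "vabs (of_nat l * x) \<le> vabs (of_nat l :: 'k) * 1"
      unfolding vabs_mult using that by (intro mult_left_mono) (auto simp: pball_iff)
    then show ?thesis
      using assms(2) by (simp add: maximal_ideal_eq_pball[symmetric] maximal_ideal_def)
  qed
  then have "\<exists>k. coset_index (pball 0) (pball 1) = l ^ k"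
    by (intro coset_index_prime_power add_subgroup_pball finite_coset_reps pball_antimono assms(1)) auto
  then show ?thesis
    by (simp add: coset_index_residue)
qed

text \<open>Uniform continuity on a compact ball. With \<open>m \<le> n\<close> a point y close to x
  stays in \<open>pball m\<close>, so membership is asked of x alone.\<close>

lemma continuous_uniform_on_pball:
  fixes f :: "'k \<Rightarrow> 'c::nonarch_field"
  assumes "continuous_on UNIV f" and "0 < e"
  obtains n where "m \<le> n" and "\<And>x y. x \<in> pball m \<Longrightarrow> x - y \<in> pball n \<Longrightarrow> vabs (f x - f y) < e"
proof -
  have "uniformly_continuous_on (pball m) f"
    by (rule compact_uniformly_continuous[OF _ compact_pball])
      (rule continuous_on_subset[OF assms(1)], simp)
  then obtain d where d: "0 < d" "\<And>x y. x \<in> pball m \<Longrightarrow> y \<in> pball m \<Longrightarrow> dist y x < d \<Longrightarrow> dist (f y) (f x) < e"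
    unfolding uniformly_continuous_on_def using assms(2) by metis
  obtain n where n: "m \<le> n" "vabs \<pi> powi n < d"
    using ex_radius_less[OF d(1)] by blast
  have "vabs (f x - f y) < e" if "x \<in> pball m" "x - y \<in> pball n" for x y
  proof -
    have "x - (x - y) \<in> pball m"
      by (rule add_subgroup_diff[OF add_subgroup_pball]) (use that pball_antimono[OF n(1)] in auto)
    then have "dist (f y) (f x) < e"
      using that n(2) by (intro d(2)) (auto simp: pball_iff dist_eq_vabs vabs_minus_commute)
    then show ?thesis
      by (simp add: dist_eq_vabs vabs_minus_commute)
  qed
  then show ?thesis
    using that n(1) by blast
qed

end


section \<open>Continuous functions and their dual\<close>

lemma cont_funsI: "continuous_on UNIV f \<Longrightarrow> (\<And>x. vabs (f x) \<le> 1) \<Longrightarrow> f \<in> cont_funs"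
  and cont_funs_continuous: "f \<in> cont_funs \<Longrightarrow> continuous_on UNIV f"
  and cont_funs_vabs: "f \<in> cont_funs \<Longrightarrow> vabs (f x) \<le> 1"
  by (auto simp: cont_funs_def valuation_ring_def image_subset_iff)

lemma cont_funs_zero: "(\<lambda>x. 0) \<in> cont_funs"
  by (rule cont_funsI) auto

lemma cont_funs_add: "f \<in> cont_funs \<Longrightarrow> g \<in> cont_funs \<Longrightarrow> (\<lambda>x. f x + g x) \<in> cont_funs"
  and cont_funs_diff: "f \<in> cont_funs \<Longrightarrow> g \<in> cont_funs \<Longrightarrow> (\<lambda>x. f x - g x) \<in> cont_funs"
  and cont_funs_mult: "f \<in> cont_funs \<Longrightarrow> g \<in> cont_funs \<Longrightarrow> (\<lambda>x. f x * g x) \<in> cont_funs"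
  by (auto intro!: cont_funsI continuous_intros vabs_add_le vabs_diff_le
      simp: cont_funs_continuous cont_funs_vabs vabs_mult mult_le_one)

lemma cont_funs_scale: "a \<in> valuation_ring \<Longrightarrow> f \<in> cont_funs \<Longrightarrow> (\<lambda>x. a * f x) \<in> cont_funs"
  by (auto intro!: cont_funsI continuous_intros
      simp: cont_funs_continuous cont_funs_vabs vabs_mult mult_le_one valuation_ring_iff)

lemma integral_linear_add:
    "\<mu> \<in> integral_linear F \<Longrightarrow> f \<in> F \<Longrightarrow> g \<in> F \<Longrightarrow> \<mu> (\<lambda>x. f x + g x) = \<mu> f + \<mu> g"
  and integral_linear_scale:
    "\<mu> \<in> integral_linear F \<Longrightarrow> a \<in> valuation_ring \<Longrightarrow> f \<in> F \<Longrightarrow> \<mu> (\<lambda>x. a * f x) = a * \<mu> f"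
  and integral_linear_vabs: "\<mu> \<in> integral_linear F \<Longrightarrow> f \<in> F \<Longrightarrow> vabs (\<mu> f) \<le> 1"
  by (auto simp: integral_linear_def valuation_ring_iff)

lemma integral_linear_diff:
  assumes "\<mu> \<in> integral_linear F" "f \<in> F" "g \<in> F" "(\<lambda>x. f x - g x) \<in> F"
  shows "\<mu> (\<lambda>x. f x - g x) = \<mu> f - \<mu> g"
  using integral_linear_add[OF assms(1,4,3)] by (simp add: algebra_simps)

lemma integral_linear_zero:
  "\<mu> \<in> integral_linear F \<Longrightarrow> (\<lambda>x. 0) \<in> F \<Longrightarrow> \<mu> (\<lambda>x. 0) = 0"
  using integral_linear_scale[of \<mu> F 0 "\<lambda>x. 0"] by simp

text \<open>Stated for an arbitrary class F closed under the operations, since both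
  \<open>cont_funs\<close> and \<open>lc_funs\<close> use it.\<close>

lemma integral_linear_sum:
  assumes \<mu>: "\<mu> \<in> integral_linear F" and zero: "(\<lambda>x. 0) \<in> F"
    and add: "\<And>f g. f \<in> F \<Longrightarrow> g \<in> F \<Longrightarrow> (\<lambda>x. f x + g x) \<in> F"
    and scale: "\<And>a f. a \<in> valuation_ring \<Longrightarrow> f \<in> F \<Longrightarrow> (\<lambda>x. a * f x) \<in> F"
    and S: "\<And>s. s \<in> S \<Longrightarrow> c s \<in> valuation_ring" "\<And>s. s \<in> S \<Longrightarrow> f s \<in> F"
  shows "(\<lambda>x. \<Sum>s\<in>S. c s * f s x) \<in> F" (is ?A)
    and "\<mu> (\<lambda>x. \<Sum>s\<in>S. c s * f s x) = (\<Sum>s\<in>S. c s * \<mu> (f s))" (is ?B)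
proof -
  have "?A \<and> ?B"
    using S
  proof (induction S rule: infinite_finite_induct)
    case (insert s S)
    then have "(\<lambda>x. c s * f s x) \<in> F" "(\<lambda>x. \<Sum>s\<in>S. c s * f s x) \<in> F"
      by (auto intro: scale)
    then show ?case
      using insert integral_linear_add[OF \<mu>] integral_linear_scale[OF \<mu>, of "c s" "f s"]
        add[of "\<lambda>x. c s * f s x" "\<lambda>x. \<Sum>s\<in>S. c s * f s x"]
      by simp
  qed (simp_all add: zero integral_linear_zero[OF \<mu> zero])
  then show ?A ?B
    by auto
qed

lemma integral_linear_ext:
  assumes "\<mu> \<in> integral_linear F" "\<nu> \<in> integral_linear F" "\<And>f. f \<in> F \<Longrightarrow> \<mu> f = \<nu> f"
  shows "\<mu> = \<nu>"
  using assms by (intro PiE_ext[of \<mu> F "\<lambda>_. valuation_ring" \<nu>]) (auto simp: integral_linear_def)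

lemma sup_seminorm_le:
  assumes "0 \<le> e" and "\<And>x. x \<in> U \<Longrightarrow> vabs (f x) \<le> e"
  shows "sup_seminorm U f \<le> e"
  unfolding sup_seminorm_def using assms by (intro cSup_least) auto

lemma vabs_le_sup_seminorm:
  assumes "\<And>x. vabs (f x) \<le> 1" and "x \<in> U"
  shows "vabs (f x) \<le> sup_seminorm U f"
  unfolding sup_seminorm_def using assms by (intro cSup_upper bdd_aboveI[of _ 1]) auto

lemma topspace_cont_funs_topology:
  "topspace cont_funs_topology = (cont_funs :: ('k::nonarch_field \<Rightarrow> 'c::nonarch_field) set)"
  unfolding cont_funs_topology_def topology_generated_by_topspace
proof (intro equalityI subsetI)
  fix f :: "'k \<Rightarrow> 'c" assume f: "f \<in> cont_funs"
  show "f \<in> \<Union> {{g \<in> cont_funs. sup_seminorm U (\<lambda>x. g x - f x) < \<epsilon>} | f U \<epsilon>.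
      f \<in> cont_funs \<and> compact U \<and> open U \<and> \<epsilon> > 0}"
  proof (rule UnionI)
    \<comment> \<open>The empty set is compact and open with seminorm 0, so a basic set containing f
      is at hand without any assumption on K.\<close>
    show "f \<in> {g \<in> cont_funs. sup_seminorm {} (\<lambda>x. g x - f x) < 1}"
      using f by (simp add: sup_seminorm_def)
    show "{g \<in> cont_funs. sup_seminorm {} (\<lambda>x. g x - f x) < 1} \<in>
        {{g \<in> cont_funs. sup_seminorm U (\<lambda>x. g x - f x) < \<epsilon>} | f U \<epsilon>.
          f \<in> cont_funs \<and> compact U \<and> open U \<and> \<epsilon> > 0}"
      using f by (intro CollectI exI[of _ f] exI[of _ "{}"] exI[of _ 1]) auto
  qed
qed auto

context local_field
begin

text \<open>The balls \<open>pball m\<close> are compact open and every compact set lies in one of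
  them, so the seminorms of balls already define the topology. The right-hand side is stable under
  finite intersections and unions, which handles the generated topology.\<close>

lemma openin_cont_funs_topology_iff:
  fixes W :: "('k \<Rightarrow> 'c::nonarch_field) set"
  shows "openin cont_funs_topology W \<longleftrightarrow> W \<subseteq> cont_funs \<and>
    (\<forall>g\<in>W. \<exists>m. \<exists>e>0. \<forall>g'\<in>cont_funs. (\<forall>x\<in>pball m. vabs (g' x - g x) \<le> e) \<longrightarrow> g' \<in> W)"
    (is "_ \<longleftrightarrow> ?P W")
proof
  assume "openin cont_funs_topology W"
  then have "generate_topology_on {{g \<in> cont_funs. sup_seminorm U (\<lambda>x. g x - f x) < \<epsilon>} | f U \<epsilon>.
      f \<in> cont_funs \<and> compact U \<and> open U \<and> \<epsilon> > 0} W"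
    unfolding cont_funs_topology_def by (rule openin_topology_generated_by)
  then show "?P W"
  proof (induction rule: generate_topology_on.induct)
    case (Int a b)
    have "\<exists>m. \<exists>e>0. \<forall>g'\<in>cont_funs. (\<forall>x\<in>pball m. vabs (g' x - g x) \<le> e) \<longrightarrow> g' \<in> a \<inter> b"
      if g: "g \<in> a \<inter> b" for g
    proof -
      obtain m e where 1: "0 < e" "\<forall>g'\<in>cont_funs. (\<forall>x\<in>pball m. vabs (g' x - g x) \<le> e) \<longrightarrow> g' \<in> a"
        using bspec[OF conjunct2[OF Int.IH(1)] IntD1[OF g]] by (elim exE conjE)
      obtain m' e' where 2: "0 < e'" "\<forall>g'\<in>cont_funs. (\<forall>x\<in>pball m'. vabs (g' x - g x) \<le> e') \<longrightarrow> g' \<in> b"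
        using bspec[OF conjunct2[OF Int.IH(2)] IntD2[OF g]] by (elim exE conjE)
      have sub: "pball m \<subseteq> pball (min m m')" "pball m' \<subseteq> pball (min m m')"
        by (auto intro!: pball_antimono)
      show ?thesis
      proof (intro exI[of _ "min m m'"] exI[of _ "min e e'"] conjI ballI impI)
        fix g' assume g': "g' \<in> cont_funs" "\<forall>x\<in>pball (min m m'). vabs (g' x - g x) \<le> min e e'"
        have "g' \<in> a"
          by (rule 1(2)[rule_format, OF g'(1)]) (use g'(2) sub in auto)
        moreover have "g' \<in> b"
          by (rule 2(2)[rule_format, OF g'(1)]) (use g'(2) sub in auto)
        ultimately show "g' \<in> a \<inter> b"
          by blast
      qed (use 1 2 in auto)
    qed
    moreover have "a \<inter> b \<subseteq> cont_funs"
      using Int.IH by blast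
    ultimately show ?case
      by simp
  next
    case (UN K)
    have "\<exists>m. \<exists>e>0. \<forall>g'\<in>cont_funs. (\<forall>x\<in>pball m. vabs (g' x - g x) \<le> e) \<longrightarrow> g' \<in> \<Union>K"
      if g: "g \<in> \<Union>K" for g
    proof -
      obtain k where k: "k \<in> K" "g \<in> k"
        using g by blast
      then obtain m e where "0 < e" "\<forall>g'\<in>cont_funs. (\<forall>x\<in>pball m. vabs (g' x - g x) \<le> e) \<longrightarrow> g' \<in> k"
        using bspec[OF conjunct2[OF UN.IH[OF k(1)]] k(2)] by (elim exE conjE)
      then show ?thesis
        using k(1) by (metis UnionI)
    qed
    moreover have "\<Union>K \<subseteq> cont_funs"
      using UN.IH by blast
    ultimately show ?case
      by simp
  next
    case (Basis s)
    then obtain f U \<epsilon> where s: "s = {g \<in> cont_funs. sup_seminorm U (\<lambda>x. g x - f x) < \<epsilon>}"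
      and f: "f \<in> cont_funs" and U: "compact U" and \<epsilon>: "0 < \<epsilon>"
      by blast
    obtain m where m: "U \<subseteq> pball m"
      using compact_subset_pball[OF U] by blast
    have "\<exists>m. \<exists>e>0. \<forall>g'\<in>cont_funs. (\<forall>x\<in>pball m. vabs (g' x - g x) \<le> e) \<longrightarrow> g' \<in> s"
      if "g \<in> s" for g
    proof (intro exI[of _ m] exI[of _ "\<epsilon> / 2"] conjI ballI impI)
      fix g' assume g': "g' \<in> cont_funs" "\<forall>x\<in>pball m. vabs (g' x - g x) \<le> \<epsilon> / 2"
      \<comment> \<open>A bound strictly below \<epsilon> is needed, because pointwise strict
        inequalities would only give a supremum at most \<epsilon>. By the ultrametric inequality t
        bounds \<open>g' - f\<close> as well.\<close>
      define t where "t = max (\<epsilon> / 2) (sup_seminorm U (\<lambda>x. g x - f x))"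
      have g: "g \<in> cont_funs" and "t < \<epsilon>"
        using \<open>g \<in> s\<close> \<epsilon> by (auto simp: s t_def)
      have "sup_seminorm U (\<lambda>x. g' x - f x) \<le> t"
      proof (rule sup_seminorm_le)
        fix x assume x: "x \<in> U"
        have "vabs (g x - f x) \<le> sup_seminorm U (\<lambda>x. g x - f x)"
          by (rule vabs_le_sup_seminorm[OF _ x]) (rule cont_funs_vabs[OF cont_funs_diff[OF g f]])
        moreover have "vabs (g' x - g x) \<le> \<epsilon> / 2"
          by (rule bspec[OF g'(2) subsetD[OF m x]])
        ultimately have "vabs (g' x - g x) \<le> t" "vabs (g x - f x) \<le> t"
          by (auto simp: t_def)
        then show "vabs (g' x - f x) \<le> t"
          by (rule vabs_diff_trans)
      qed (use \<epsilon> in \<open>simp add: t_def\<close>)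
      then show "g' \<in> s"
        using g' \<open>t < \<epsilon>\<close> by (simp add: s)
    qed (use \<epsilon> in simp)
    then show ?case
      by (auto simp: s)
  qed simp
next
  assume W: "?P W"
  show "openin cont_funs_topology W"
    unfolding openin_subopen[of _ W]
  proof
    fix g assume g: "g \<in> W"
    then obtain m e where e: "0 < e"
      and sub: "\<forall>g'\<in>cont_funs. (\<forall>x\<in>pball m. vabs (g' x - g x) \<le> e) \<longrightarrow> g' \<in> W"
      using W by blast
    have gc: "g \<in> cont_funs"
      using W g by blast
    let ?T = "{g' \<in> cont_funs. sup_seminorm (pball m) (\<lambda>x. g' x - g x) < e}"
    have "openin cont_funs_topology ?T"
      unfolding cont_funs_topology_def
      by (rule topology_generated_by_Basis) (use gc e compact_pball open_pball in blast)
    moreover have "g \<in> ?T"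
      using gc e sup_seminorm_le[of 0 "pball m" "\<lambda>x. g x - g x"] by auto
    moreover have "?T \<subseteq> W"
    proof
      fix g' assume g': "g' \<in> ?T"
      have "vabs (g' x - g x) \<le> e" if "x \<in> pball m" for x
      proof -
        have "vabs (g' x - g x) \<le> sup_seminorm (pball m) (\<lambda>x. g' x - g x)"
          by (rule vabs_le_sup_seminorm[OF _ that]) (use cont_funs_vabs[OF cont_funs_diff[OF _ gc]] g' in auto)
        then show ?thesis
          using g' by simp
      qed
      then show "g' \<in> W"
        using sub g' by blast
    qed
    ultimately show "\<exists>T. openin cont_funs_topology T \<and> g \<in> T \<and> T \<subseteq> W"
      by blast
  qed
qed

text \<open>A linear functional is continuous as soon as it is continuous at 0, where the topology
  is tested on balls. All later continuity arguments use this form.\<close>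

lemma cont_dual_iff:
  fixes \<mu> :: "('k \<Rightarrow> 'c::nonarch_field) \<Rightarrow> 'c"
  shows "\<mu> \<in> cont_dual \<longleftrightarrow> \<mu> \<in> integral_linear cont_funs \<and>
    (\<forall>e>0. \<exists>m. \<exists>d>0. \<forall>f\<in>cont_funs. (\<forall>x\<in>pball m. vabs (f x) \<le> d) \<longrightarrow> vabs (\<mu> f) \<le> e)"
    (is "_ \<longleftrightarrow> _ \<and> ?P")
proof (cases "\<mu> \<in> integral_linear cont_funs")
  case True
  have \<mu>0: "\<mu> (\<lambda>x. 0) = 0"
    by (rule integral_linear_zero[OF True cont_funs_zero])
  have "continuous_map cont_funs_topology (top_of_set valuation_ring) \<mu> \<longleftrightarrow> ?P"
  proof
    assume cont: "continuous_map cont_funs_topology (top_of_set valuation_ring) \<mu>"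
    show ?P
    proof (intro allI impI)
      fix e :: real assume "0 < e"
      let ?W = "{f \<in> cont_funs. \<mu> f \<in> valuation_ring \<inter> ball 0 e}"
      have "openin cont_funs_topology ?W"
        using openin_continuous_map_preimage[OF cont openin_open_Int[OF open_ball[of 0 e]]]
        by (simp only: topspace_cont_funs_topology)
      moreover have "(\<lambda>x. 0) \<in> ?W"
        using \<open>0 < e\<close> by (simp add: cont_funs_zero \<mu>0)
      ultimately obtain m d where "0 < d"
        and "\<forall>g'\<in>cont_funs. (\<forall>x\<in>pball m. vabs (g' x - 0) \<le> d) \<longrightarrow> g' \<in> ?W"
        unfolding openin_cont_funs_topology_iff by (metis (no_types, lifting))
      then show "\<exists>m. \<exists>d>0. \<forall>f\<in>cont_funs. (\<forall>x\<in>pball m. vabs (f x) \<le> d) \<longrightarrow> vabs (\<mu> f) \<le> e"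
        by (intro exI[of _ m] exI[of _ d]) (auto simp: dist_eq_vabs)
    qed
  next
    assume P: ?P
    show "continuous_map cont_funs_topology (top_of_set valuation_ring) \<mu>"
      unfolding continuous_map_def topspace_cont_funs_topology
    proof (intro conjI allI impI)
      show "\<mu> \<in> cont_funs \<rightarrow> topspace (top_of_set valuation_ring)"
        using True by (auto simp: integral_linear_def)
      fix V assume "openin (top_of_set (valuation_ring :: 'c set)) V"
      then obtain T where T: "open T" "V = valuation_ring \<inter> T"
        by (auto simp: openin_open)
      have "\<exists>m. \<exists>e>0. \<forall>g'\<in>cont_funs. (\<forall>x\<in>pball m. vabs (g' x - g x) \<le> e) \<longrightarrow> g' \<in> {x \<in> cont_funs. \<mu> x \<in> V}"
        if g: "g \<in> cont_funs" "\<mu> g \<in> V" for g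
      proof -
        obtain e where e: "0 < e" "ball (\<mu> g) e \<subseteq> T"
          using g T open_contains_ball by blast
        then have "0 < e / 2"
          by simp
        then obtain m d where d: "0 < d"
          and *: "\<forall>f\<in>cont_funs. (\<forall>x\<in>pball m. vabs (f x) \<le> d) \<longrightarrow> vabs (\<mu> f) \<le> e / 2"
          using P by blast
        show ?thesis
        proof (intro exI[of _ m] exI[of _ d] conjI ballI impI)
          fix g' assume g': "g' \<in> cont_funs" "\<forall>x\<in>pball m. vabs (g' x - g x) \<le> d"
          have diff: "(\<lambda>x. g' x - g x) \<in> cont_funs"
            by (rule cont_funs_diff[OF g'(1) g(1)])
          have "vabs (\<mu> (\<lambda>x. g' x - g x)) \<le> e / 2"
            by (rule *[rule_format, OF diff]) (use g'(2) in blast)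
          then have "vabs (\<mu> g' - \<mu> g) \<le> e / 2"
            by (simp add: integral_linear_diff[OF True g'(1) g(1) diff])
          then have "\<mu> g' \<in> T"
            using e by (intro subsetD[OF e(2)]) (simp add: dist_eq_vabs vabs_minus_commute)
          then show "g' \<in> {x \<in> cont_funs. \<mu> x \<in> V}"
            using g'(1) T(2) integral_linear_vabs[OF True] by (simp add: valuation_ring_iff)
        qed (use d in simp)
      qed
      then show "openin cont_funs_topology {x \<in> cont_funs. \<mu> x \<in> V}"
        unfolding openin_cont_funs_topology_iff by auto
    qed
  qed
  then show ?thesis
    using True by (simp add: cont_dual_def)
qed (simp add: cont_dual_def)

end


section \<open>Characters and trigonometric sums\<close>

text \<open>An abstract smooth nontrivial character replaces \<zeta>^tr. The assumption
  \<open>residue_unit\<close> makes the normalising factor of Fourier inversion invertible in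
  o_p.\<close>

locale fourier_setting = local_field \<pi> for \<pi> :: "'k::nonarch_field" +
  fixes \<psi> :: "'k \<Rightarrow> 'c::{nonarch_field, complete_space}"
  assumes residue_unit: "vabs (of_nat (residue_card TYPE('k)) :: 'c) = 1"
    and char_add: "\<psi> (x + y) = \<psi> x * \<psi> y"
    and vabs_char: "vabs (\<psi> x) = 1"
    and char_smooth: "\<exists>e>0. \<forall>x. vabs x \<le> e \<longrightarrow> \<psi> x = 1"
    and char_nontrivial: "\<exists>x. \<psi> x \<noteq> 1"
begin


lemma residue_unit_power: "vabs (of_nat (residue_card TYPE('k) ^ n) :: 'c) = 1"
  by (simp add: vabs_power residue_unit)

lemma residue_power_nonzero: "(of_nat (residue_card TYPE('k) ^ n) :: 'c) \<noteq> 0"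
  using residue_unit_power[of n] by (metis vabs_0 zero_neq_one)




text \<open>The exponent of the largest ball on which \<psi> is trivial. Under the pairing
  \<open>\<psi> (r * x)\<close> the dual of \<open>pball n\<close> is then
  \<open>pball (conductor - n)\<close>.\<close>

definition conductor :: int
  where "conductor = (SOME d. (\<forall>x\<in>pball d. \<psi> x = 1) \<and> (\<exists>x\<in>pball (d - 1). \<psi> x \<noteq> 1))"

lemma conductor:
  shows char_conductor: "x \<in> pball conductor \<Longrightarrow> \<psi> x = 1"
    and char_above_conductor: "\<exists>x\<in>pball (conductor - 1). \<psi> x \<noteq> 1"
proof -
  obtain e where e: "0 < e" "\<And>x. vabs x \<le> e \<Longrightarrow> \<psi> x = 1"
    using char_smooth by blast
  obtain x0 where x0: "\<psi> x0 \<noteq> 1"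
    using char_nontrivial by blast
  obtain m where "\<And>x. vabs x \<le> vabs x0 \<Longrightarrow> x \<in> pball m"
    by (rule ex_pball_covers[of 0 "vabs x0"]) blast
  then have m: "x0 \<in> pball m"
    by blast
  obtain n where n: "m \<le> n" "vabs \<pi> powi n < e"
    using ex_radius_less[OF e(1)] by blast
  define P where "P k \<longleftrightarrow> (\<forall>x\<in>pball (m + int k). \<psi> x = 1)" for k
  have "P (nat (n - m))"
    using n e(2) by (auto simp: P_def pball_iff)
  \<comment> \<open>The character is nontrivial on \<open>pball m\<close> and trivial on the smaller
    \<open>pball n\<close>; somewhere between them triviality sets in.\<close>
  have "\<exists>k. \<not> P k \<and> P (Suc k)"
  proof (rule ccontr)
    assume "\<not> ?thesis"
    moreover have "\<not> P 0"
      using m x0 by (auto simp: P_def)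
    ultimately have "\<not> P k" for k
      by (induction k) blast+
    with \<open>P (nat (n - m))\<close> show False
      by blast
  qed
  then obtain k where k: "\<not> P k" "P (Suc k)"
    by blast
  have "\<exists>d. (\<forall>x\<in>pball d. \<psi> x = 1) \<and> (\<exists>x\<in>pball (d - 1). \<psi> x \<noteq> 1)"
    using k by (intro exI[of _ "m + int (Suc k)"]) (auto simp: P_def)
  then have *: "(\<forall>x\<in>pball conductor. \<psi> x = 1) \<and> (\<exists>x\<in>pball (conductor - 1). \<psi> x \<noteq> 1)"
    unfolding conductor_def by (rule someI_ex)
  show "x \<in> pball conductor \<Longrightarrow> \<psi> x = 1" and "\<exists>x\<in>pball (conductor - 1). \<psi> x \<noteq> 1"
    using * by auto
qed

lemma char_trivial:
  assumes "r \<in> pball a" and "x \<in> pball b" and "conductor \<le> a + b"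
  shows "\<psi> (r * x) = 1"
proof (rule char_conductor)
  have "vabs (r * x) \<le> vabs \<pi> powi (a + b)"
    unfolding vabs_mult radius_add using assms radius_pos[of a] by (intro mult_mono) (auto simp: pball_iff)
  also have "\<dots> \<le> vabs \<pi> powi conductor"
    by (rule radius_antimono[OF assms(3)])
  finally show "r * x \<in> pball conductor"
    by (simp add: pball_iff)
qed

text \<open>Divide by r a point y of \<open>pball (conductor - 1)\<close> with
  \<open>\<psi> y \<noteq> 1\<close>. By \<open>radius_gap\<close> r is at least of the radius with
  exponent \<open>conductor - n - 1\<close>, which is just enough to put y / r into
  \<open>pball n\<close>.\<close>

lemma char_not_trivial:
  assumes "r \<notin> pball (conductor - n)"
  shows "\<exists>x\<in>pball n. \<psi> (r * x) \<noteq> 1"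
proof -
  obtain y where y: "y \<in> pball (conductor - 1)" "\<psi> y \<noteq> 1"
    using char_above_conductor by blast
  have gap: "vabs \<pi> powi (conductor - n - 1) \<le> vabs r"
    by (rule radius_gap[OF assms])
  then have r: "r \<noteq> 0"
    using radius_pos[of "conductor - n - 1"] by auto
  have "vabs y \<le> vabs \<pi> powi (n + (conductor - n - 1))"
    using y(1) by (simp add: pball_iff)
  also have "\<dots> \<le> vabs \<pi> powi n * vabs r"
    unfolding radius_add using gap radius_pos[of n] by (intro mult_left_mono) auto
  finally have "y / r \<in> pball n"
    using r by (simp add: pball_iff vabs_divide pos_divide_le_eq)
  then show ?thesis
    using y(2) r by (intro bexI[of _ "y / r"]) auto
qed

text \<open>Orthogonality. The condition on r makes the character invariant under
  \<open>pball n\<close>. If it is not trivial on \<open>pball m\<close>, translation by a suitable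
  a multiplies the sum by \<open>\<psi> (r * a) \<noteq> 1\<close>, so the sum is 0.\<close>

lemma coset_sum_char:
  assumes "m \<le> n" and "r \<in> pball (conductor - n)"
  shows "coset_sum (pball m) (pball n) (\<lambda>x. \<psi> (r * x)) =
    (if r \<in> pball (conductor - m) then of_nat (residue_card TYPE('k) ^ nat (n - m)) else 0)"
proof (cases "r \<in> pball (conductor - m)")
  case True
  have "coset_sum (pball m) (pball n) (\<lambda>x. \<psi> (r * x)) = (\<Sum>x\<in>coset_rep (pball n) ` pball m. 1)"
    unfolding coset_sum_def
  proof (rule sum.cong)
    fix x assume "x \<in> coset_rep (pball n) ` pball m"
    then have "x \<in> pball m"
      using coset_rep_image_subset[OF add_subgroup_pball add_subgroup_pball pball_antimono[OF assms(1)]]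
      by blast
    then show "\<psi> (r * x) = 1"
      using True by (intro char_trivial[of _ "conductor - m" _ m]) auto
  qed simp
  also have "\<dots> = of_nat (coset_index (pball m) (pball (m + int (nat (n - m)))))"
    using assms(1) by (simp add: coset_index_def)
  finally show ?thesis
    using True by (simp only: coset_index_pball if_True)
next
  case False
  obtain a where a: "a \<in> pball m" "\<psi> (r * a) \<noteq> 1"
    using char_not_trivial[OF False] by blast
  let ?S = "coset_sum (pball m) (pball n) (\<lambda>x. \<psi> (r * x))"
  have "coset_invariant (pball n) (\<lambda>x. \<psi> (r * x))"
    unfolding coset_invariant_def
  proof (intro allI impI)
    fix x y assume "x - y \<in> pball n"
    then have "\<psi> (r * (x - y)) = 1"
      using assms(2) by (intro char_trivial[of _ "conductor - n" _ n]) auto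
    then show "\<psi> (r * x) = \<psi> (r * y)"
      using char_add[of "r * (x - y)" "r * y"] by (simp add: algebra_simps)
  qed
  then have "?S = coset_sum (pball m) (pball n) (\<lambda>x. \<psi> (r * (x + a)))"
    by (intro coset_sum_translate[symmetric] add_subgroup_pball pball_antimono assms(1) a(1))
  also have "\<dots> = ?S * \<psi> (r * a)"
    by (simp add: coset_sum_def distrib_left char_add sum_distrib_right)
  finally have "?S = 0"
    using a(2) by simp
  then show ?thesis
    using False by simp
qed

lemma char_eq:
  assumes "r - s \<in> pball a" and "x \<in> pball b" and "conductor \<le> a + b"
  shows "\<psi> (r * x) = \<psi> (s * x)"
proof -
  have "\<psi> ((r - s) * x) = 1"
    by (rule char_trivial[OF assms])
  then show ?thesis
    using char_add[of "(r - s) * x" "s * x"] by (simp add: algebra_simps)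
qed

text \<open>For r in \<open>pball a\<close> the function is constant on cosets of the dual ball
  \<open>pball (conductor - a)\<close>.\<close>

lemma char_cont_fun: "(\<lambda>x. \<psi> (r * x)) \<in> cont_funs"
proof (rule cont_funsI)
  obtain a where "\<And>x. vabs x \<le> vabs r \<Longrightarrow> x \<in> pball a"
    by (rule ex_pball_covers[of 0 "vabs r"]) blast
  then have a: "r \<in> pball a"
    by blast
  show "continuous_on UNIV (\<lambda>x. \<psi> (r * x))"
    unfolding continuous_on_iff
  proof (intro ballI allI impI)
    fix x :: 'k and e :: real assume "0 < e"
    have "dist (\<psi> (r * y)) (\<psi> (r * x)) < e" if "dist y x < vabs \<pi> powi (conductor - a)" for y
    proof -
      have "\<psi> (r * y) = \<psi> (r * x)"
        using char_eq[of y x "conductor - a" r a] a that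
        by (simp add: pball_iff dist_eq_vabs mult.commute)
      then show ?thesis
        using \<open>0 < e\<close> by simp
    qed
    then show "\<exists>d>0. \<forall>y\<in>UNIV. dist y x < d \<longrightarrow> dist (\<psi> (r * y)) (\<psi> (r * x)) < e"
      using radius_pos by blast
  qed
qed (simp add: vabs_char)

section \<open>Trigonometric sums given by finite families of integral coefficients\<close>

definition coefs :: "('k \<Rightarrow> 'c) set"
  where "coefs = {c. finite {r. c r \<noteq> 0} \<and> (\<forall>r. vabs (c r) \<le> 1)}"

text \<open>One pairing serves twice: with the characters as h it is the trigonometric sum of c,
  with a prescribed transform as h it is the value that the measure must take on that sum.\<close>

definition weighted_sum :: "('k \<Rightarrow> 'c) \<Rightarrow> ('k \<Rightarrow> 'c) \<Rightarrow> 'c"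
  where "weighted_sum c h = (\<Sum>r | c r \<noteq> 0. c r * h r)"

abbreviation trig :: "('k \<Rightarrow> 'c) \<Rightarrow> 'k \<Rightarrow> 'c"
  where "trig c x \<equiv> weighted_sum c (\<lambda>r. \<psi> (r * x))"

lemma weighted_sum_superset:
  "finite R \<Longrightarrow> {r. c r \<noteq> 0} \<subseteq> R \<Longrightarrow> weighted_sum c h = (\<Sum>r\<in>R. c r * h r)"
  unfolding weighted_sum_def by (rule sum.mono_neutral_left) auto

lemma coefs_add: "c \<in> coefs \<Longrightarrow> c' \<in> coefs \<Longrightarrow> (\<lambda>r. c r + c' r) \<in> coefs"
proof -
  assume c: "c \<in> coefs" "c' \<in> coefs"
  then have "finite ({r. c r \<noteq> 0} \<union> {r. c' r \<noteq> 0})"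
    by (simp add: coefs_def)
  then have "finite {r. c r + c' r \<noteq> 0}"
    by (rule finite_subset[rotated]) auto
  then show "(\<lambda>r. c r + c' r) \<in> coefs"
    using c by (simp add: coefs_def vabs_add_le)
qed

lemma coefs_scale: "a \<in> valuation_ring \<Longrightarrow> c \<in> coefs \<Longrightarrow> (\<lambda>r. a * c r) \<in> coefs"
proof -
  assume a: "a \<in> valuation_ring" and c: "c \<in> coefs"
  have "finite {r. a * c r \<noteq> 0}"
    by (rule finite_subset[of _ "{r. c r \<noteq> 0}"]) (use c in \<open>auto simp: coefs_def\<close>)
  then show "(\<lambda>r. a * c r) \<in> coefs"
    using a c by (simp add: coefs_def vabs_mult valuation_ring_iff mult_le_one)
qed

lemma weighted_sum_add:
  assumes "c \<in> coefs" "c' \<in> coefs"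
  shows "weighted_sum (\<lambda>r. c r + c' r) h = weighted_sum c h + weighted_sum c' h"
proof -
  define R where "R = {r. c r \<noteq> 0} \<union> {r. c' r \<noteq> 0}"
  have "finite R"
    using assms by (simp add: R_def coefs_def)
  moreover have "{r. c r \<noteq> 0} \<subseteq> R" "{r. c' r \<noteq> 0} \<subseteq> R" "{r. c r + c' r \<noteq> 0} \<subseteq> R"
    by (auto simp: R_def)
  ultimately show ?thesis
    by (simp add: weighted_sum_superset[of R] distrib_right sum.distrib)
qed


lemma weighted_sum_scale:
  assumes "c \<in> coefs"
  shows "weighted_sum (\<lambda>r. a * c r) h = a * weighted_sum c h"
proof -
  have "finite {r. c r \<noteq> 0}" "{r. a * c r \<noteq> 0} \<subseteq> {r. c r \<noteq> 0}"
    using assms by (auto simp: coefs_def)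
  then show ?thesis
    by (simp add: weighted_sum_superset[of "{r. c r \<noteq> 0}"] sum_distrib_left mult.assoc)
qed

lemma vabs_weighted_sum_le:
  assumes "c \<in> coefs" and "\<And>r. vabs (h r) \<le> 1"
  shows "vabs (weighted_sum c h) \<le> 1"
  unfolding weighted_sum_def
  using assms by (intro vabs_sum_le) (auto simp: vabs_mult coefs_def intro: mult_le_one)

lemma coefs_delta: "(\<lambda>t. if t = r then 1 else 0) \<in> coefs"
  by (auto simp: coefs_def)

lemma weighted_sum_delta: "weighted_sum (\<lambda>t. if t = r then 1 else 0) h = h r"
  using weighted_sum_superset[of "{r}" "\<lambda>t. if t = r then 1 else 0" h] by auto

text \<open>
  On \<open>pball m\<close>, a function that is constant modulo \<open>pball n\<close> is a trigonometric sum by Fourier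
  inversion on the finite group \<open>pball m / pball n\<close>, whose order is a unit.
\<close>

lemma trig_dense:
  assumes "f \<in> cont_funs" and "0 < e"
  obtains c where "c \<in> coefs" and "\<And>x. x \<in> pball m \<Longrightarrow> vabs (f x - trig c x) \<le> e"
proof -
  obtain n where n: "m \<le> n" "\<And>x y. x \<in> pball m \<Longrightarrow> x - y \<in> pball n \<Longrightarrow> vabs (f x - f y) < e"
    using continuous_uniform_on_pball[OF cont_funs_continuous[OF assms(1)] assms(2), of m] by blast
  \<comment> \<open>By duality R represents the characters of the finite group
    \<open>pball m / pball n\<close>.\<close>
  define R where "R = coset_rep (pball (conductor - m)) ` pball (conductor - n)"
  define A where "A = coset_rep (pball n) ` pball m"
  define Q :: 'c where "Q = of_nat (residue_card TYPE('k) ^ nat (n - m))"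
  have fin: "finite R" "finite A"
    by (simp_all add: R_def A_def finite_coset_reps)
  have Q: "vabs Q = 1" "Q \<noteq> 0"
    unfolding Q_def by (rule residue_unit_power, rule residue_power_nonzero)
  have A: "A \<subseteq> pball m"
    unfolding A_def by (intro coset_rep_image_subset add_subgroup_pball pball_antimono n(1))
  \<comment> \<open>The Fourier coefficients of f sampled on A; they stay integral because Q, the
    order of the group, has absolute value 1.\<close>
  define c where "c r = (if r \<in> R then (\<Sum>a\<in>A. f a * \<psi> (- (r * a))) / Q else 0)" for r
  have supp: "{r. c r \<noteq> 0} \<subseteq> R"
    by (auto simp: c_def)
  have "vabs (c r) \<le> 1" for r
    using Q by (auto simp: c_def vabs_divide vabs_mult vabs_char cont_funs_vabs[OF assms(1)] intro!: vabs_sum_le)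
  then have "c \<in> coefs"
    using finite_subset[OF supp fin(1)] by (simp add: coefs_def)
  moreover have "vabs (f x - trig c x) \<le> e" if x: "x \<in> pball m" for x
  proof -
    \<comment> \<open>Orthogonality with the roles of r and x exchanged: the dual of
      \<open>pball (conductor - n)\<close> is \<open>pball n\<close> again.\<close>
    have inner: "(\<Sum>r\<in>R. \<psi> (r * (x - a))) = (if x - a \<in> pball n then Q else 0)" if "a \<in> A" for a
    proof -
      have "x - a \<in> pball m"
        using x A that by (intro add_subgroup_diff[OF add_subgroup_pball]) auto
      then have "coset_sum (pball (conductor - n)) (pball (conductor - m)) (\<lambda>r. \<psi> ((x - a) * r)) =
          (if x - a \<in> pball n then Q else 0)"
        using n(1) by (subst coset_sum_char) (auto simp: Q_def)
      then show ?thesis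
        by (simp add: coset_sum_def R_def mult.commute)
    qed
    have "trig c x = (\<Sum>r\<in>R. c r * \<psi> (r * x))"
      by (rule weighted_sum_superset[OF fin(1) supp])
    also have "\<dots> = (\<Sum>r\<in>R. \<Sum>a\<in>A. f a / Q * \<psi> (r * (x - a)))"
    proof (rule sum.cong)
      fix r assume "r \<in> R"
      then have "c r * \<psi> (r * x) = (\<Sum>a\<in>A. f a / Q * (\<psi> (- (r * a)) * \<psi> (r * x)))"
        by (simp add: c_def sum_divide_distrib sum_distrib_right mult.assoc)
      then show "c r * \<psi> (r * x) = (\<Sum>a\<in>A. f a / Q * \<psi> (r * (x - a)))"
        by (simp add: algebra_simps flip: char_add)
    qed simp
    also have "\<dots> = (\<Sum>a\<in>A. f a / Q * (\<Sum>r\<in>R. \<psi> (r * (x - a))))"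
      by (subst sum.swap) (simp add: sum_distrib_left)
    \<comment> \<open>Only the representative of the class of x survives, so the sum reproduces f
      there, and f varies by less than e within the class.\<close>
    also have "\<dots> = (\<Sum>a\<in>A. if a = coset_rep (pball n) x then f a else 0)"
    proof (rule sum.cong)
      fix a assume a: "a \<in> A"
      have "x - a \<in> pball n \<longleftrightarrow> a = coset_rep (pball n) x"
        using coset_rep_eq_iff[OF add_subgroup_pball, of n x a]
          coset_rep_image_fixed[OF add_subgroup_pball a[unfolded A_def]] by auto
      then show "f a / Q * (\<Sum>r\<in>R. \<psi> (r * (x - a))) = (if a = coset_rep (pball n) x then f a else 0)"
        using Q(2) by (simp add: inner[OF a])
    qed simp
    also have "\<dots> = f (coset_rep (pball n) x)"
      using fin(2) x by (simp add: A_def)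
    finally have "trig c x = f (coset_rep (pball n) x)" .
    moreover have "x - coset_rep (pball n) x \<in> pball n"
      using coset_rep_diff[OF add_subgroup_pball, of n x] add_subgroup_diff_commute[OF add_subgroup_pball]
      by blast
    ultimately show ?thesis
      using n(2)[OF x, of "coset_rep (pball n) x"] by simp
  qed
  ultimately show ?thesis
    by (rule that)
qed

text \<open>
  Averaging \<open>trig c\<close> against a character recovers the sum of \<open>c\<close> over a class modulo the dual ball,
  and \<open>h\<close> is nearly constant on such a class.
\<close>

lemma weighted_sum_le_of_trig_le:
  assumes h: "uniformly_continuous_on UNIV h" "\<And>r. vabs (h r) \<le> 1" and e: "0 < e"
  obtains m where "\<And>c. c \<in> coefs \<Longrightarrow> (\<And>x. x \<in> pball m \<Longrightarrow> vabs (trig c x) \<le> e) \<Longrightarrow>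
    vabs (weighted_sum c h) \<le> e"
proof -
  obtain d where d: "0 < d" "\<And>x y. dist x y < d \<Longrightarrow> dist (h x) (h y) < e"
    using h(1) e unfolding uniformly_continuous_on_def by (metis UNIV_I)
  obtain N where "vabs \<pi> powi N < d"
    using ex_radius_less[OF d(1)] by blast
  then have N: "vabs (h x - h y) \<le> e" if "x - y \<in> pball N" for x y
    using that d(2)[of x y] by (simp add: pball_iff dist_eq_vabs)
  \<comment> \<open>The ball dual to \<open>pball N\<close>, on whose cosets h varies by at most e.
    It depends on h and e, not on c.\<close>
  define m where "m = conductor - N"
  have "vabs (weighted_sum c h) \<le> e"
    if c: "c \<in> coefs" and small: "\<And>x. x \<in> pball m \<Longrightarrow> vabs (trig c x) \<le> e" for c
  proof -
    define R where "R = {r. c r \<noteq> 0}"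
    have fin: "finite R" and c1: "vabs (c r) \<le> 1" for r
      using c by (auto simp: coefs_def R_def)
    obtain k0 where "R \<subseteq> pball k0"
      using compact_subset_pball[OF finite_imp_compact[OF fin]] by blast
    \<comment> \<open>All differences of frequencies lie in \<open>pball k\<close>, so the
      characters involved are invariant under \<open>pball (conductor - k)\<close>;
      \<open>k \<le> N\<close> makes this a subgroup of \<open>pball m\<close>.\<close>
    moreover define k where "k = min k0 N"
    ultimately have k: "R \<subseteq> pball k" "k \<le> N"
      using pball_antimono[of k k0] by auto
    have mk: "m \<le> conductor - k"
      using k(2) by (simp add: m_def)
    define Q :: 'c where "Q = of_nat (residue_card TYPE('k) ^ nat (conductor - k - m))"
    have Q: "vabs Q = 1"
      unfolding Q_def by (rule residue_unit_power)
    \<comment> \<open>Summing \<open>trig c x * \<psi> (- (s * x))\<close> over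
      \<open>pball m\<close> modulo \<open>pball (conductor - k)\<close> isolates the frequencies
      congruent to s modulo \<open>pball N\<close>, with the unit factor Q. This bounds the class
      sum by the supremum of \<open>trig c\<close> without loss.\<close>
    have class_sum: "vabs (\<Sum>r\<in>{r \<in> R. r - s \<in> pball N}. c r) \<le> e" if s: "s \<in> R" for s
    proof -
      let ?A = "coset_rep (pball (conductor - k)) ` pball m"
      have A: "?A \<subseteq> pball m"
        by (intro coset_rep_image_subset add_subgroup_pball pball_antimono mk)
      have "(\<Sum>x\<in>?A. trig c x * \<psi> (- (s * x))) = (\<Sum>x\<in>?A. \<Sum>r\<in>R. c r * \<psi> ((r - s) * x))"
      proof (rule sum.cong)
        fix x
        have "trig c x * \<psi> (- (s * x)) = (\<Sum>r\<in>R. c r * (\<psi> (r * x) * \<psi> (- (s * x))))"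
          unfolding weighted_sum_def R_def by (simp add: sum_distrib_right mult.assoc)
        then show "trig c x * \<psi> (- (s * x)) = (\<Sum>r\<in>R. c r * \<psi> ((r - s) * x))"
          by (simp add: algebra_simps flip: char_add)
      qed simp
      also have "\<dots> = (\<Sum>r\<in>R. c r * (\<Sum>x\<in>?A. \<psi> ((r - s) * x)))"
        by (subst sum.swap) (simp add: sum_distrib_left)
      also have "\<dots> = (\<Sum>r\<in>R. if r - s \<in> pball N then Q * c r else 0)"
      proof (rule sum.cong)
        fix r assume "r \<in> R"
        then have "r - s \<in> pball k"
          using k(1) s by (intro add_subgroup_diff[OF add_subgroup_pball]) auto
        then have "(\<Sum>x\<in>?A. \<psi> ((r - s) * x)) = (if r - s \<in> pball N then Q else 0)"
          using coset_sum_char[OF mk, of "r - s"] by (simp add: coset_sum_def Q_def m_def)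
        then show "c r * (\<Sum>x\<in>?A. \<psi> ((r - s) * x)) = (if r - s \<in> pball N then Q * c r else 0)"
          by simp
      qed simp
      also have "\<dots> = Q * (\<Sum>r\<in>{r \<in> R. r - s \<in> pball N}. c r)"
        using fin by (simp add: sum_distrib_left sum.inter_filter if_distrib[of "\<lambda>z. Q * z"] cong: if_cong)
      finally have "vabs (\<Sum>r\<in>{r \<in> R. r - s \<in> pball N}. c r) = vabs (\<Sum>x\<in>?A. trig c x * \<psi> (- (s * x)))"
        by (simp add: vabs_mult Q)
      also have "\<dots> \<le> e"
        using e A small by (intro vabs_sum_le) (auto simp: vabs_mult vabs_char)
      finally show ?thesis .
    qed
    let ?\<rho> = "coset_rep (pball N)"
    have "weighted_sum c h = (\<Sum>y\<in>?\<rho> ` R. \<Sum>r\<in>{r. r \<in> R \<and> ?\<rho> r = y}. c r * h r)"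
      unfolding weighted_sum_def R_def[symmetric] by (rule sum.group[symmetric]) (use fin in auto)
    also have "vabs \<dots> \<le> e"
    proof (rule vabs_sum_le)
      fix y assume "y \<in> ?\<rho> ` R"
      then obtain s where s: "s \<in> R" "y = ?\<rho> s"
        by blast
      let ?C = "{r \<in> R. r - s \<in> pball N}"
      have "(\<Sum>r\<in>{r. r \<in> R \<and> ?\<rho> r = y}. c r * h r) = (\<Sum>r\<in>?C. c r * h r)"
        by (simp add: s(2) coset_rep_eq_iff[OF add_subgroup_pball])
      \<comment> \<open>Freezing h at s leaves a class sum, bounded by e, times an integral value;
        the correction is bounded by e because h hardly varies on the class.\<close>
      also have "\<dots> = (\<Sum>r\<in>?C. c r) * h s + (\<Sum>r\<in>?C. c r * (h r - h s))"
        by (simp add: sum_distrib_right right_diff_distrib sum_subtractf)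
      also have "vabs \<dots> \<le> e"
      proof (rule vabs_add_le)
        have "vabs (\<Sum>r\<in>?C. c r) * vabs (h s) \<le> e * 1"
          using class_sum[OF s(1)] h(2) e by (intro mult_mono) auto
        then show "vabs ((\<Sum>r\<in>?C. c r) * h s) \<le> e"
          by (simp add: vabs_mult)
        show "vabs (\<Sum>r\<in>?C. c r * (h r - h s)) \<le> e"
        proof (rule vabs_sum_le)
          fix r assume "r \<in> ?C"
          then have "vabs (c r) * vabs (h r - h s) \<le> 1 * e"
            using c1 N by (intro mult_mono) auto
          then show "vabs (c r * (h r - h s)) \<le> e"
            by (simp add: vabs_mult)
        qed (use e in simp)
      qed
      finally show "vabs (\<Sum>r\<in>{r. r \<in> R \<and> ?\<rho> r = y}. c r * h r) \<le> e" .
    qed (use e in simp)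
    finally show ?thesis .
  qed
  then show ?thesis
    using that by blast
qed

end


section \<open>Extension by continuity\<close>

text \<open>X is a set of indices, T assigns functions to them and L values. Closure is stated
  existentially so that neither X nor T needs algebraic structure; \<open>small\<close> is
  continuity of L, tested at precision e on the set \<open>D e\<close>.\<close>

locale functional_extension =
  fixes X :: "'x set" and T :: "'x \<Rightarrow> 'k \<Rightarrow> 'c::{nonarch_field, complete_space}"
    and L :: "'x \<Rightarrow> 'c" and D :: "real \<Rightarrow> 'k set"
  assumes add_closed: "a \<in> X \<Longrightarrow> b \<in> X \<Longrightarrow> \<exists>c\<in>X. (\<forall>x. T c x = T a x + T b x) \<and> L c = L a + L b"
    and scale_closed: "r \<in> valuation_ring \<Longrightarrow> a \<in> X \<Longrightarrow> \<exists>c\<in>X. (\<forall>x. T c x = r * T a x) \<and> L c = r * L a"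
    and vabs_le_1: "a \<in> X \<Longrightarrow> vabs (L a) \<le> 1"
    and small: "a \<in> X \<Longrightarrow> 0 < e \<Longrightarrow> (\<And>x. x \<in> D e \<Longrightarrow> vabs (T a x) \<le> e) \<Longrightarrow> vabs (L a) \<le> e"
begin

text \<open>Precision e is required on \<open>D e\<close> alone. For measures these are balls
  varying with e, so convergence need not be uniform on K.\<close>

definition approximates :: "(nat \<Rightarrow> 'x) \<Rightarrow> ('k \<Rightarrow> 'c) \<Rightarrow> bool"
  where "approximates a f \<longleftrightarrow> (\<forall>n. a n \<in> X) \<and>
    (\<forall>e>0. \<forall>\<^sub>F n in sequentially. \<forall>x\<in>D e. vabs (f x - T (a n) x) \<le> e)"

text \<open>The limit along one arbitrary approximating sequence;
  \<open>approximates_tendsto\<close> shows that every other one gives the same limit.\<close>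

definition extend :: "('k \<Rightarrow> 'c) \<Rightarrow> 'c"
  where "extend f = lim (\<lambda>n. L ((SOME a. approximates a f) n))"

lemma approximates_in: "approximates a f \<Longrightarrow> a n \<in> X"
  and approximates_eventually:
    "approximates a f \<Longrightarrow> 0 < e \<Longrightarrow> \<forall>\<^sub>F n in sequentially. \<forall>x\<in>D e. vabs (f x - T (a n) x) \<le> e"
  by (auto simp: approximates_def)

lemma diff_small:
  assumes "a \<in> X" "b \<in> X" "0 < e" "\<And>x. x \<in> D e \<Longrightarrow> vabs (T a x - T b x) \<le> e"
  shows "vabs (L a - L b) \<le> e"
proof -
  obtain b' where b': "b' \<in> X" "\<And>x. T b' x = - 1 * T b x" "L b' = - 1 * L b"
    using scale_closed[of "- 1" b] assms(2) by (auto simp: valuation_ring_iff)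
  obtain c where "c \<in> X" "\<And>x. T c x = T a x + T b' x" "L c = L a + L b'"
    using add_closed[OF assms(1) b'(1)] by blast
  then show ?thesis
    using small[of c e] assms(3,4) b' by simp
qed

text \<open>With a = b this is the Cauchy property of the values, with a and b different the
  independence of the approximating sequence.\<close>

lemma approximates_diff:
  assumes "approximates a f" "approximates b f" "0 < e"
  shows "\<exists>N. \<forall>m\<ge>N. \<forall>n\<ge>N. vabs (L (a m) - L (b n)) \<le> e"
proof -
  have "\<forall>\<^sub>F n in sequentially. (\<forall>x\<in>D e. vabs (f x - T (a n) x) \<le> e) \<and> (\<forall>x\<in>D e. vabs (f x - T (b n) x) \<le> e)"
    using assms by (intro eventually_conj approximates_eventually)
  then obtain N where N: "\<And>n x. N \<le> n \<Longrightarrow> x \<in> D e \<Longrightarrow> vabs (f x - T (a n) x) \<le> e"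
    "\<And>n x. N \<le> n \<Longrightarrow> x \<in> D e \<Longrightarrow> vabs (f x - T (b n) x) \<le> e"
    unfolding eventually_sequentially by blast
  have "vabs (L (a m) - L (b n)) \<le> e" if "N \<le> m" "N \<le> n" for m n
  proof (rule diff_small[OF _ _ assms(3)])
    fix x assume x: "x \<in> D e"
    show "vabs (T (a m) x - T (b n) x) \<le> e"
      using vabs_diff_le[OF N(2)[OF that(2) x] N(1)[OF that(1) x]] by simp
  qed (use assms approximates_in in auto)
  then show ?thesis
    by blast
qed

lemma approximates_tendsto:
  assumes "approximates a f"
  shows "(\<lambda>n. L (a n)) \<longlonglongrightarrow> extend f"
proof -
  define b where "b = (SOME a. approximates a f)"
  have b: "approximates b f"
    unfolding b_def using assms by (rule someI[of "\<lambda>a. approximates a f"])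
  have "Cauchy (\<lambda>n. L (b n))"
    unfolding Cauchy_def
  proof (intro allI impI)
    fix e :: real assume "0 < e"
    then obtain N where N: "\<And>m n. N \<le> m \<Longrightarrow> N \<le> n \<Longrightarrow> vabs (L (b m) - L (b n)) \<le> e / 2"
      using approximates_diff[OF b b, of "e / 2"] by auto
    have "dist (L (b m)) (L (b n)) < e" if "N \<le> m" "N \<le> n" for m n
      using N[OF that] \<open>0 < e\<close> by (simp add: dist_eq_vabs)
    then show "\<exists>M. \<forall>m\<ge>M. \<forall>n\<ge>M. dist (L (b m)) (L (b n)) < e"
      by blast
  qed
  then have lim: "(\<lambda>n. L (b n)) \<longlonglongrightarrow> extend f"
    unfolding extend_def b_def[symmetric] by (simp add: Cauchy_convergent_iff convergent_LIMSEQ_iff)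
  have "(\<lambda>n. L (a n) - L (b n)) \<longlonglongrightarrow> 0"
    unfolding lim_sequentially
  proof (intro allI impI)
    fix e :: real assume "0 < e"
    then obtain N where N: "\<And>m n. N \<le> m \<Longrightarrow> N \<le> n \<Longrightarrow> vabs (L (a m) - L (b n)) \<le> e / 2"
      using approximates_diff[OF assms b, of "e / 2"] by auto
    have "dist (L (a n) - L (b n)) 0 < e" if "N \<le> n" for n
      using N[OF that that] \<open>0 < e\<close> by (simp add: dist_eq_vabs)
    then show "\<exists>N. \<forall>n\<ge>N. dist (L (a n) - L (b n)) 0 < e"
      by blast
  qed
  from tendsto_add[OF this lim] show ?thesis
    by simp
qed

text \<open>The ultrametric inequality lets f, its approximants and the limit share the same e and
  \<open>D e\<close>, so the continuity estimate passes to the extension unchanged.\<close>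

lemma vabs_extend_le:
  assumes "approximates a f" "0 < e" "\<And>x. x \<in> D e \<Longrightarrow> vabs (f x) \<le> e"
  shows "vabs (extend f) \<le> e"
proof (rule tendsto_upperbound[OF tendsto_vabs[OF approximates_tendsto[OF assms(1)]]])
  show "\<forall>\<^sub>F n in sequentially. vabs (L (a n)) \<le> e"
    using approximates_eventually[OF assms(1,2)]
  proof (rule eventually_mono)
    fix n assume n: "\<forall>x\<in>D e. vabs (f x - T (a n) x) \<le> e"
    have "vabs (T (a n) x) \<le> e" if "x \<in> D e" for x
      using vabs_diff_le[OF assms(3)[OF that] n[rule_format, OF that]] by simp
    then show "vabs (L (a n)) \<le> e"
      by (rule small[OF approximates_in[OF assms(1)] assms(2)])
  qed
qed simp

lemma vabs_extend_le_1: "approximates a f \<Longrightarrow> vabs (extend f) \<le> 1"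
  by (rule tendsto_upperbound[OF tendsto_vabs[OF approximates_tendsto]])
    (auto intro!: always_eventually vabs_le_1 approximates_in)

lemma extend_add:
  assumes "approximates a f" "approximates b g"
  shows "extend (\<lambda>x. f x + g x) = extend f + extend g"
proof -
  have "\<exists>c. c \<in> X \<and> (\<forall>x. T c x = T (a n) x + T (b n) x) \<and> L c = L (a n) + L (b n)" for n
    using add_closed[OF approximates_in[OF assms(1)] approximates_in[OF assms(2)]] by blast
  then obtain c where c: "\<And>n. c n \<in> X" "\<And>n x. T (c n) x = T (a n) x + T (b n) x" "\<And>n. L (c n) = L (a n) + L (b n)"
    by metis
  have "approximates c (\<lambda>x. f x + g x)"
    unfolding approximates_def
  proof (intro conjI allI impI)
    fix e :: real assume e: "0 < e"
    have "\<forall>\<^sub>F n in sequentially. (\<forall>x\<in>D e. vabs (f x - T (a n) x) \<le> e) \<and> (\<forall>x\<in>D e. vabs (g x - T (b n) x) \<le> e)"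
      using assms e by (intro eventually_conj approximates_eventually)
    then show "\<forall>\<^sub>F n in sequentially. \<forall>x\<in>D e. vabs (f x + g x - T (c n) x) \<le> e"
    proof (rule eventually_mono, intro ballI)
      fix n x
      assume "(\<forall>x\<in>D e. vabs (f x - T (a n) x) \<le> e) \<and> (\<forall>x\<in>D e. vabs (g x - T (b n) x) \<le> e)" "x \<in> D e"
      then have "vabs ((f x - T (a n) x) + (g x - T (b n) x)) \<le> e"
        by (intro vabs_add_le) auto
      then show "vabs (f x + g x - T (c n) x) \<le> e"
        by (simp add: c(2) algebra_simps)
    qed
  qed (rule c(1))
  from approximates_tendsto[OF this] have "(\<lambda>n. L (a n) + L (b n)) \<longlonglongrightarrow> extend (\<lambda>x. f x + g x)"
    by (simp add: c(3))
  moreover have "(\<lambda>n. L (a n) + L (b n)) \<longlonglongrightarrow> extend f + extend g"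
    by (intro tendsto_add approximates_tendsto assms)
  ultimately show ?thesis
    by (rule LIMSEQ_unique)
qed

lemma extend_scale:
  assumes "approximates a f" "r \<in> valuation_ring"
  shows "extend (\<lambda>x. r * f x) = r * extend f"
proof -
  obtain c where c: "\<And>n. c n \<in> X" "\<And>n x. T (c n) x = r * T (a n) x" "\<And>n. L (c n) = r * L (a n)"
    using scale_closed[OF assms(2) approximates_in[OF assms(1)]] by metis
  have "approximates c (\<lambda>x. r * f x)"
    unfolding approximates_def
  proof (intro conjI allI impI)
    fix e :: real assume e: "0 < e"
    show "\<forall>\<^sub>F n in sequentially. \<forall>x\<in>D e. vabs (r * f x - T (c n) x) \<le> e"
      using approximates_eventually[OF assms(1) e]
    proof (rule eventually_mono, intro ballI)
      fix n x assume "\<forall>x\<in>D e. vabs (f x - T (a n) x) \<le> e" "x \<in> D e"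
      then have "vabs r * vabs (f x - T (a n) x) \<le> 1 * e"
        using assms(2) by (intro mult_mono) (auto simp: valuation_ring_iff)
      then show "vabs (r * f x - T (c n) x) \<le> e"
        by (simp add: c(2) flip: vabs_mult right_diff_distrib)
    qed
  qed (rule c(1))
  from approximates_tendsto[OF this] have "(\<lambda>n. r * L (a n)) \<longlonglongrightarrow> extend (\<lambda>x. r * f x)"
    by (simp add: c(3))
  moreover have "(\<lambda>n. r * L (a n)) \<longlonglongrightarrow> r * extend f"
    by (intro tendsto_mult tendsto_const approximates_tendsto assms)
  ultimately show ?thesis
    by (rule LIMSEQ_unique)
qed

lemma extend_T:
  assumes "c \<in> X"
  shows "extend (T c) = L c"
proof -
  have "approximates (\<lambda>_. c) (T c)"
    using assms by (auto simp: approximates_def)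
  from approximates_tendsto[OF this] show ?thesis
    by (simp add: LIMSEQ_const_iff)
qed

end


section \<open>The Fourier transform of measures\<close>

context fourier_setting
begin

text \<open>Up to e / 2 the functional sees only a ball \<open>pball m\<close>. If s - r lies in the
  dual ball, the characters of s and r coincide on \<open>pball m\<close>, wherever r is; hence
  uniformity.\<close>

lemma dual_char_uniformly_continuous:
  assumes "\<mu> \<in> cont_dual"
  shows "uniformly_continuous_on UNIV (\<lambda>r. \<mu> (\<lambda>x. \<psi> (r * x)))"
  unfolding uniformly_continuous_on_def
proof (intro allI impI)
  fix e :: real assume "0 < e"
  then have "0 < e / 2"
    by simp
  then obtain m d where d: "0 < d"
    "\<forall>f\<in>cont_funs. (\<forall>x\<in>pball m. vabs (f x) \<le> d) \<longrightarrow> vabs (\<mu> f) \<le> e / 2"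
    using assms unfolding cont_dual_iff by blast
  have lin: "\<mu> \<in> integral_linear cont_funs"
    using assms by (simp add: cont_dual_def)
  have "dist (\<mu> (\<lambda>x. \<psi> (s * x))) (\<mu> (\<lambda>x. \<psi> (r * x))) < e"
    if "dist s r < vabs \<pi> powi (conductor - m)" for r s
  proof -
    let ?f = "\<lambda>x. \<psi> (s * x) - \<psi> (r * x)"
    have "s - r \<in> pball (conductor - m)"
      using that by (simp add: pball_iff dist_eq_vabs)
    then have "\<psi> (s * x) = \<psi> (r * x)" if "x \<in> pball m" for x
      by (rule char_eq[OF _ that]) simp
    then have "\<forall>x\<in>pball m. vabs (?f x) \<le> d"
      using d(1) by (metis diff_self less_imp_le vabs_0)
    moreover have f: "?f \<in> cont_funs"
      by (intro cont_funs_diff char_cont_fun)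
    ultimately have "vabs (\<mu> ?f) \<le> e / 2"
      using d(2) by (metis (no_types, lifting))
    then show ?thesis
      using \<open>0 < e\<close> integral_linear_diff[OF lin char_cont_fun char_cont_fun f] by (simp add: dist_eq_vabs)
  qed
  then show "\<exists>d>0. \<forall>x\<in>UNIV. \<forall>x'\<in>UNIV. dist x' x < d \<longrightarrow> dist (\<mu> (\<lambda>xa. \<psi> (x' * xa))) (\<mu> (\<lambda>xa. \<psi> (x * xa))) < e"
    using radius_pos by blast
qed

lemma dual_char_cont_fun:
  assumes "\<mu> \<in> cont_dual"
  shows "(\<lambda>r. \<mu> (\<lambda>x. \<psi> (r * x))) \<in> cont_funs"
proof (rule cont_funsI)
  show "continuous_on UNIV (\<lambda>r. \<mu> (\<lambda>x. \<psi> (r * x)))"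
    by (rule uniformly_continuous_imp_continuous[OF dual_char_uniformly_continuous[OF assms]])
  show "vabs (\<mu> (\<lambda>x. \<psi> (r * x))) \<le> 1" for r
    using assms by (intro integral_linear_vabs[OF _ char_cont_fun]) (simp add: cont_dual_def)
qed

lemma dual_trig:
  assumes "\<mu> \<in> integral_linear cont_funs" and "c \<in> coefs"
  shows "trig c \<in> cont_funs" and "\<mu> (trig c) = weighted_sum c (\<lambda>r. \<mu> (\<lambda>x. \<psi> (r * x)))"
proof -
  have c: "c r \<in> valuation_ring" for r
    using assms(2) by (simp add: coefs_def valuation_ring_iff)
  show "trig c \<in> cont_funs"
    unfolding weighted_sum_def
    by (rule integral_linear_sum(1)[OF assms(1)])
      (simp_all add: c cont_funs_zero cont_funs_add cont_funs_scale char_cont_fun)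
  show "\<mu> (trig c) = weighted_sum c (\<lambda>r. \<mu> (\<lambda>x. \<psi> (r * x)))"
    unfolding weighted_sum_def
    by (rule integral_linear_sum(2)[OF assms(1)])
      (simp_all add: c cont_funs_zero cont_funs_add cont_funs_scale char_cont_fun)
qed

text \<open>Both functionals are determined on trigonometric sums by their transforms. A sum close
  to f on a ball serving both continuity estimates shows that they agree at f up to e, for every
  e.\<close>

lemma dual_char_inj:
  assumes \<mu>: "\<mu> \<in> cont_dual" and \<nu>: "\<nu> \<in> cont_dual"
    and eq: "\<And>r. \<mu> (\<lambda>x. \<psi> (r * x)) = \<nu> (\<lambda>x. \<psi> (r * x))"
  shows "\<mu> = \<nu>"
proof -
  have lin: "\<mu> \<in> integral_linear cont_funs" "\<nu> \<in> integral_linear cont_funs"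
    using \<mu> \<nu> by (simp_all add: cont_dual_def)
  show ?thesis
  proof (rule integral_linear_ext[OF lin])
    fix f :: "'k \<Rightarrow> 'c" assume f: "f \<in> cont_funs"
    show "\<mu> f = \<nu> f"
    proof (rule vabs_le_all_imp_eq)
      fix e :: real assume e: "0 < e"
      obtain m d where d: "0 < d"
        "\<forall>f\<in>cont_funs. (\<forall>x\<in>pball m. vabs (f x) \<le> d) \<longrightarrow> vabs (\<mu> f) \<le> e"
        using \<mu> e unfolding cont_dual_iff by blast
      obtain m' d' where d': "0 < d'"
        "\<forall>f\<in>cont_funs. (\<forall>x\<in>pball m'. vabs (f x) \<le> d') \<longrightarrow> vabs (\<nu> f) \<le> e"
        using \<nu> e unfolding cont_dual_iff by blast
      have "0 < min d d'"
        using d d' by simp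
      then obtain c where c: "c \<in> coefs"
        "\<And>x. x \<in> pball (min m m') \<Longrightarrow> vabs (f x - trig c x) \<le> min d d'"
        using trig_dense[OF f] by blast
      have sub: "pball m \<subseteq> pball (min m m')" "pball m' \<subseteq> pball (min m m')"
        by (auto intro!: pball_antimono)
      have tc: "trig c \<in> cont_funs"
        by (rule dual_trig(1)[OF lin(1) c(1)])
      have diff: "(\<lambda>x. f x - trig c x) \<in> cont_funs"
        by (rule cont_funs_diff[OF f tc])
      have "vabs (\<mu> (\<lambda>x. f x - trig c x)) \<le> e"
        by (rule d(2)[rule_format, OF diff]) (use c(2) sub in force)
      then have 1: "vabs (\<mu> f - \<mu> (trig c)) \<le> e"
        by (simp add: integral_linear_diff[OF lin(1) f tc diff])
      have "vabs (\<nu> (\<lambda>x. f x - trig c x)) \<le> e"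
        by (rule d'(2)[rule_format, OF diff]) (use c(2) sub in force)
      then have 2: "vabs (\<nu> f - \<nu> (trig c)) \<le> e"
        by (simp add: integral_linear_diff[OF lin(2) f tc diff])
      have "\<mu> (trig c) = \<nu> (trig c)"
        using dual_trig(2)[OF lin(1) c(1)] dual_trig(2)[OF lin(2) c(1)] eq by simp
      then show "vabs (\<mu> f - \<nu> f) \<le> e"
        using vabs_diff_le[OF 1 2] by simp
    qed
  qed
qed

lemma dual_char_surj:
  assumes h: "h \<in> cont_funs" "uniformly_continuous_on UNIV h"
  obtains \<mu> where "\<mu> \<in> cont_dual" and "\<And>r. \<mu> (\<lambda>x. \<psi> (r * x)) = h r"
proof -
  have "\<exists>m. \<forall>c\<in>coefs. (\<forall>x\<in>pball m. vabs (trig c x) \<le> e) \<longrightarrow> vabs (weighted_sum c h) \<le> e"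
    if "0 < e" for e
    by (rule weighted_sum_le_of_trig_le[OF h(2) cont_funs_vabs[OF h(1)] that]) blast
  then obtain M where M: "\<And>e c. 0 < e \<Longrightarrow> c \<in> coefs \<Longrightarrow> (\<And>x. x \<in> pball (M e) \<Longrightarrow> vabs (trig c x) \<le> e) \<Longrightarrow>
      vabs (weighted_sum c h) \<le> e"
    by metis
  interpret functional_extension coefs trig "\<lambda>c. weighted_sum c h" "\<lambda>e. pball (M e)"
  proof
    fix a b :: "'k \<Rightarrow> 'c" assume "a \<in> coefs" "b \<in> coefs"
    then show "\<exists>c\<in>coefs. (\<forall>x. trig c x = trig a x + trig b x) \<and> weighted_sum c h = weighted_sum a h + weighted_sum b h"
      by (intro bexI[of _ "\<lambda>r. a r + b r"]) (simp_all add: weighted_sum_add coefs_add)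
  next
    fix r :: 'c and a :: "'k \<Rightarrow> 'c" assume "r \<in> valuation_ring" "a \<in> coefs"
    then show "\<exists>c\<in>coefs. (\<forall>x. trig c x = r * trig a x) \<and> weighted_sum c h = r * weighted_sum a h"
      by (intro bexI[of _ "\<lambda>t. r * a t"]) (simp_all add: weighted_sum_scale coefs_scale)
  qed (use M vabs_weighted_sum_le cont_funs_vabs[OF h(1)] in auto)
  have approx: "\<exists>a. approximates a f" if f: "f \<in> cont_funs" for f
  proof -
    \<comment> \<open>Balls exhausting K with precision tending to 0: one sequence then serves every
      test set \<open>pball (M e)\<close>.\<close>
    have "\<exists>c. c \<in> coefs \<and> (\<forall>x\<in>pball (- int n). vabs (f x - trig c x) \<le> 1 / real (Suc n))" for n
      by (rule trig_dense[OF f, of "1 / real (Suc n)" "- int n"]) auto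
    then obtain a where a: "\<And>n. a n \<in> coefs"
      "\<And>n x. x \<in> pball (- int n) \<Longrightarrow> vabs (f x - trig (a n) x) \<le> 1 / real (Suc n)"
      by metis
    have "approximates a f"
      unfolding approximates_def
    proof (intro conjI allI impI)
      fix e :: real assume "0 < e"
      then have "\<forall>\<^sub>F n in sequentially. 1 / real (Suc n) < e"
        by (intro order_tendstoD(2)[OF LIMSEQ_Suc[OF lim_1_over_n]])
      moreover have "\<forall>\<^sub>F n in sequentially. nat (- M e) \<le> n"
        by (rule eventually_ge_at_top)
      ultimately show "\<forall>\<^sub>F n in sequentially. \<forall>x\<in>pball (M e). vabs (f x - trig (a n) x) \<le> e"
      proof eventually_elim
        case (elim n)
        then have "pball (M e) \<subseteq> pball (- int n)"
          by (intro pball_antimono) linarith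
        then show ?case
          using a(2)[of _ n] elim(1) by (meson less_imp_le order_trans subsetD)
      qed
    qed (rule a(1))
    then show ?thesis
      by blast
  qed
  define \<mu> where "\<mu> = restrict extend cont_funs"
  have \<mu>: "\<mu> f = extend f" if "f \<in> cont_funs" for f
    using that by (simp add: \<mu>_def)
  have lin: "\<mu> \<in> integral_linear cont_funs"
    unfolding integral_linear_def
  proof (intro CollectI conjI ballI)
    show "\<mu> \<in> cont_funs \<rightarrow>\<^sub>E valuation_ring"
      using approx vabs_extend_le_1 unfolding \<mu>_def valuation_ring_def
      by (intro restrict_PiE_iff[THEN iffD2] ballI CollectI) blast
    show "\<mu> (\<lambda>x. f x + g x) = \<mu> f + \<mu> g" if f: "f \<in> cont_funs" and g: "g \<in> cont_funs" for f g
    proof -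
      obtain a b where "approximates a f" "approximates b g"
        using approx[OF f] approx[OF g] by blast
      from extend_add[OF this] show ?thesis
        by (simp add: \<mu> f g cont_funs_add)
    qed
    show "\<mu> (\<lambda>x. r * f x) = r * \<mu> f" if r: "r \<in> valuation_ring" and f: "f \<in> cont_funs" for r f
    proof -
      obtain a where "approximates a f"
        using approx[OF f] by blast
      from extend_scale[OF this r] show ?thesis
        by (simp add: \<mu> f r cont_funs_scale)
    qed
  qed
  have "\<mu> \<in> cont_dual"
    unfolding cont_dual_iff
  proof (intro conjI lin allI impI)
    fix e :: real assume e: "0 < e"
    have "vabs (\<mu> f) \<le> e" if "f \<in> cont_funs" "\<forall>x\<in>pball (M e). vabs (f x) \<le> e" for f
      using approx[OF that(1)] vabs_extend_le[OF _ e] that by (auto simp: \<mu>)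
    then show "\<exists>m. \<exists>d>0. \<forall>f\<in>cont_funs. (\<forall>x\<in>pball m. vabs (f x) \<le> d) \<longrightarrow> vabs (\<mu> f) \<le> e"
      using e by blast
  qed
  moreover have "\<mu> (\<lambda>x. \<psi> (r * x)) = h r" for r
    \<comment> \<open>The trigonometric sum of the unit family at r is the character itself, and its
      pairing with h is \<open>h r\<close>.\<close>
    using extend_T[OF coefs_delta[of r]] char_cont_fun[of r] by (simp add: weighted_sum_delta \<mu>)
  ultimately show ?thesis
    by (rule that)
qed

end


section \<open>The functional \<open>dx\<close>\<close>

context local_field
begin

text \<open>One parameter controls support and invariance together, so that by monotonicity two
  functions have a common level.\<close>

definition smooth_level :: "nat \<Rightarrow> ('k \<Rightarrow> 'c::zero) \<Rightarrow> bool"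
  where "smooth_level k f \<longleftrightarrow> (\<forall>x. x \<notin> pball (- int k) \<longrightarrow> f x = 0) \<and> coset_invariant (pball (int k)) f"

lemma smooth_level_mono: "smooth_level k f \<Longrightarrow> k \<le> k' \<Longrightarrow> smooth_level k' f"
  using pball_antimono[of "- int k'" "- int k"] pball_antimono[of "int k" "int k'"]
  unfolding smooth_level_def by (auto intro: coset_invariant_mono)

lemma smooth_level_intro:
  assumes "\<And>x. x \<notin> pball m \<Longrightarrow> f x = 0" and "coset_invariant (pball n) f"
  shows "\<exists>k. smooth_level k f"
proof -
  define k where "k = nat \<bar>m\<bar> + nat \<bar>n\<bar>"
  have "- int k \<le> m" "n \<le> int k"
    by (simp_all add: k_def)
  then have "pball m \<subseteq> pball (- int k)" "pball (int k) \<subseteq> pball n"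
    by (simp_all add: pball_antimono)
  then have "smooth_level k f"
    using assms unfolding smooth_level_def by (auto intro: coset_invariant_mono)
  then show ?thesis
    by blast
qed

text \<open>By compactness of the support local constancy is uniform; conversely the cosets of
  \<open>pball (int k)\<close> are open and the support lies in a compact ball.\<close>

lemma lc_funs_iff:
  fixes f :: "'k \<Rightarrow> 'c::nonarch_field"
  shows "f \<in> lc_funs \<longleftrightarrow> (\<exists>k. smooth_level k f) \<and> (\<forall>x. vabs (f x) \<le> 1)"
proof
  assume f: "f \<in> lc_funs"
  then have "compact (closure {x. f x \<noteq> 0})"
    by (simp add: lc_funs_def)
  then obtain m where "closure {x. f x \<noteq> 0} \<subseteq> pball m"
    by (rule compact_subset_pball)
  then have m: "f x = 0" if "x \<notin> pball m" for x
    using that closure_subset[of "{x. f x \<noteq> 0}"] by blast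
  let ?G = "{U. open U \<and> (\<forall>x\<in>U. \<forall>y\<in>U. f x = f y)}"
  have "pball m \<subseteq> \<Union>?G"
  proof
    fix x assume "x \<in> pball m"
    obtain U where U: "open U" "x \<in> U" "\<forall>y\<in>U. f y = f x"
      using f unfolding lc_funs_def by blast
    then have "\<forall>y\<in>U. \<forall>z\<in>U. f y = f z"
      by metis
    then show "x \<in> \<Union>?G"
      using U by blast
  qed
  \<comment> \<open>A Lebesgue number for the cover by open sets on which f is constant.\<close>
  then obtain \<epsilon> where \<epsilon>: "0 < \<epsilon>" "\<And>x. x \<in> pball m \<Longrightarrow> \<exists>G \<in> ?G. ball x \<epsilon> \<subseteq> G"
    by (rule Heine_Borel_lemma[OF compact_pball]) auto
  obtain n where n: "m \<le> n" "vabs \<pi> powi n < \<epsilon>"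
    using ex_radius_less[OF \<epsilon>(1)] by blast
  have "coset_invariant (pball n) f"
    unfolding coset_invariant_def
  proof (intro allI impI)
    fix x y assume xy: "x - y \<in> pball n"
    show "f x = f y"
    proof (cases "x \<in> pball m")
      case True
      then obtain G where G: "G \<in> ?G" "ball x \<epsilon> \<subseteq> G"
        using \<epsilon>(2) by blast
      have "x \<in> G" "y \<in> G"
        using \<epsilon>(1) n(2) xy by (auto intro!: subsetD[OF G(2)] simp: dist_eq_vabs pball_iff)
      then show ?thesis
        using G(1) by blast
    next
      case False
      \<comment> \<open>Because \<open>m \<le> n\<close>, the ball \<open>pball m\<close> is a union
        of cosets of \<open>pball n\<close>; so y is outside with x and both values vanish.\<close>
      have "y \<notin> pball m"
      proof
        assume "y \<in> pball m"
        then have "(x - y) + y \<in> pball m"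
          using xy pball_antimono[OF n(1)] by (intro add_subgroup_add[OF add_subgroup_pball]) auto
        with False show False
          by simp
      qed
      then show ?thesis
        using False m by simp
    qed
  qed
  then have "\<exists>k. smooth_level k f"
    using m by (intro smooth_level_intro) auto
  then show "(\<exists>k. smooth_level k f) \<and> (\<forall>x. vabs (f x) \<le> 1)"
    using f by (simp add: lc_funs_def valuation_ring_def image_subset_iff)
next
  assume R: "(\<exists>k. smooth_level k f) \<and> (\<forall>x. vabs (f x) \<le> 1)"
  then obtain k where k: "smooth_level k f"
    by blast
  have "\<exists>U. open U \<and> x \<in> U \<and> (\<forall>y\<in>U. f y = f x)" for x
  proof (intro exI[of _ "{y. vabs (y - x) \<le> vabs \<pi> powi (int k)}"] conjI ballI)
    show "open {y. vabs (y - x) \<le> vabs \<pi> powi (int k)}"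
      by (rule open_vabs_le[OF radius_pos])
    show "x \<in> {y. vabs (y - x) \<le> vabs \<pi> powi (int k)}"
      using radius_pos[of "int k"] by simp
    fix y assume "y \<in> {y. vabs (y - x) \<le> vabs \<pi> powi (int k)}"
    then have "y - x \<in> pball (int k)"
      by (simp add: pball_iff)
    then show "f y = f x"
      using k by (intro coset_invariantD[of "pball (int k)"]) (simp_all add: smooth_level_def)
  qed
  moreover have "compact (closure {x. f x \<noteq> 0})"
  proof -
    have "closure {x. f x \<noteq> 0} \<subseteq> pball (- int k)"
      using k by (intro closure_minimal compact_imp_closed[OF compact_pball]) (auto simp: smooth_level_def)
    then have "pball (- int k) \<inter> closure {x. f x \<noteq> 0} = closure {x. f x \<noteq> 0}"
      by (rule Int_absorb1)
    then show ?thesis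
      using compact_Int_closed[OF compact_pball closed_closure, of "- int k" "{x. f x \<noteq> 0}"] by simp
  qed
  moreover have "range f \<subseteq> valuation_ring"
    using R by (auto simp: valuation_ring_def)
  ultimately show "f \<in> lc_funs"
    by (simp add: lc_funs_def)
qed

lemma lc_funs_common_level:
  fixes f g :: "'k \<Rightarrow> 'c::nonarch_field"
  assumes "f \<in> lc_funs" "g \<in> lc_funs"
  obtains k where "smooth_level k f" "smooth_level k g"
proof -
  obtain k k' where "smooth_level k f" "smooth_level k' g"
    using assms lc_funs_iff by blast
  then show ?thesis
    using that[of "max k k'"] smooth_level_mono by (metis max.cobounded1 max.cobounded2)
qed

lemma smooth_level_add:
    "smooth_level k f \<Longrightarrow> smooth_level k g \<Longrightarrow> smooth_level k (\<lambda>x. f x + g x :: 'c::nonarch_field)"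
  and smooth_level_scale: "smooth_level k f \<Longrightarrow> smooth_level k (\<lambda>x. a * f x :: 'c::nonarch_field)"
  by (auto simp: smooth_level_def coset_invariant_def)

lemma lc_funs_zero: "(\<lambda>x::'k. 0 :: 'c::nonarch_field) \<in> lc_funs"
  by (auto simp: lc_funs_iff smooth_level_def coset_invariant_def)

lemma lc_funs_add:
  fixes f g :: "'k \<Rightarrow> 'c::nonarch_field"
  assumes "f \<in> lc_funs" "g \<in> lc_funs"
  shows "(\<lambda>x. f x + g x) \<in> lc_funs"
proof -
  obtain k where "smooth_level k f" "smooth_level k g"
    using lc_funs_common_level[OF assms] by blast
  then have "smooth_level k (\<lambda>x. f x + g x)"
    by (rule smooth_level_add)
  then show ?thesis
    using assms by (auto simp: lc_funs_iff intro: vabs_add_le)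
qed

lemma lc_funs_scale:
  fixes f :: "'k \<Rightarrow> 'c::nonarch_field"
  assumes "a \<in> valuation_ring" "f \<in> lc_funs"
  shows "(\<lambda>x. a * f x) \<in> lc_funs"
  using assms smooth_level_scale[of _ f a]
  by (auto simp: lc_funs_iff vabs_mult valuation_ring_iff intro: mult_le_one)

lemma mem_coset_iff: "x \<in> (+) a ` pball n \<longleftrightarrow> x - a \<in> pball n"
  by (auto intro: image_eqI[of _ _ "x - a"])

lemma indicator_coset_invariant:
  "coset_invariant (pball n) (indicator ((+) a ` pball n) :: 'k \<Rightarrow> 'c::nonarch_field)"
  unfolding coset_invariant_def
proof (intro allI impI)
  fix x y assume xy: "x - y \<in> pball n"
  have "x - a \<in> pball n \<longleftrightarrow> y - a \<in> pball n"
    using add_subgroup_add[OF add_subgroup_pball xy, of "y - a"]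
      add_subgroup_diff[OF add_subgroup_pball _ xy, of "x - a"] by auto
  then show "(indicator ((+) a ` pball n) x :: 'c) = indicator ((+) a ` pball n) y"
    by (simp add: indicator_def mem_coset_iff)
qed

lemma indicator_lc_funs: "(indicator ((+) a ` pball n) :: 'k \<Rightarrow> 'c::nonarch_field) \<in> lc_funs"
proof -
  obtain m where m: "m \<le> n" "\<And>x. vabs x \<le> vabs a \<Longrightarrow> x \<in> pball m"
    by (rule ex_pball_covers[of n "vabs a"]) blast
  have "(indicator ((+) a ` pball n) x :: 'c) = 0" if "x \<notin> pball m" for x
  proof -
    have "x - a \<notin> pball n"
    proof
      assume "x - a \<in> pball n"
      then have "(x - a) + a \<in> pball m"
        using m pball_antimono[OF m(1)] by (intro add_subgroup_add[OF add_subgroup_pball]) auto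
      with that show False
        by simp
    qed
    then show ?thesis
      by (simp add: indicator_def mem_coset_iff)
  qed
  then have "\<exists>k. smooth_level k (indicator ((+) a ` pball n) :: 'k \<Rightarrow> 'c)"
    using indicator_coset_invariant by (rule smooth_level_intro)
  then show ?thesis
    by (simp add: lc_funs_iff indicator_def)
qed

text \<open>Indicators of cosets span the locally constant functions with integral coefficients;
  uniqueness of dx rests on this.\<close>

lemma smooth_level_expansion:
  fixes f :: "'k \<Rightarrow> 'c::nonarch_field"
  assumes "smooth_level k f"
  shows "f x = (\<Sum>a\<in>coset_rep (pball (int k)) ` pball (- int k). f a * indicator ((+) a ` pball (int k)) x)"
proof -
  let ?A = "coset_rep (pball (int k)) ` pball (- int k)"
  have A: "?A \<subseteq> pball (- int k)"
    by (intro coset_rep_image_subset add_subgroup_pball pball_antimono) simp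
  have inv: "coset_invariant (pball (int k)) f"
    using assms by (simp add: smooth_level_def)
  have "(\<Sum>a\<in>?A. f a * indicator ((+) a ` pball (int k)) x) =
      (\<Sum>a\<in>?A. if a = coset_rep (pball (int k)) x then f a else 0)"
  proof (rule sum.cong)
    fix a assume a: "a \<in> ?A"
    have "x - a \<in> pball (int k) \<longleftrightarrow> a = coset_rep (pball (int k)) x"
      using coset_rep_eq_iff[OF add_subgroup_pball, of "int k" x a]
        coset_rep_image_fixed[OF add_subgroup_pball a] by auto
    then show "f a * indicator ((+) a ` pball (int k)) x = (if a = coset_rep (pball (int k)) x then f a else 0)"
      by (simp add: indicator_def mem_coset_iff)
  qed simp
  also have "\<dots> = (if coset_rep (pball (int k)) x \<in> ?A then f (coset_rep (pball (int k)) x) else 0)"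
    by (simp add: finite_coset_reps)
  also have "\<dots> = f x"
  proof (cases "coset_rep (pball (int k)) x \<in> ?A")
    case False
    then have "x \<notin> pball (- int k)"
      by blast
    then show ?thesis
      using assms False by (simp add: smooth_level_def)
  qed (simp add: coset_invariant_coset_rep[OF add_subgroup_pball inv])
  finally show ?thesis
    by simp
qed

end

text \<open>The constant \<kappa> stands for q^(-\<delta>/2), the volume of o_K; with
  \<open>residue_unit\<close> all volumes have absolute value at most 1.\<close>

locale haar_setting = local_field \<pi> for \<pi> :: "'k::nonarch_field" +
  fixes \<kappa> :: "'c::{nonarch_field, complete_space}"
  assumes residue_unit: "vabs (of_nat (residue_card TYPE('k)) :: 'c) = 1"
    and vabs_const: "vabs \<kappa> \<le> 1"
begin

text \<open>A Riemann sum over the cosets of \<open>pball (int k)\<close>, each of volume \<kappa>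
  q^(-k).\<close>

definition level_sum :: "nat \<Rightarrow> ('k \<Rightarrow> 'c) \<Rightarrow> 'c"
  where "level_sum k f =
    \<kappa> * coset_sum (pball (- int k)) (pball (int k)) f / of_nat (residue_card TYPE('k) ^ k)"

definition smooth_integral :: "('k \<Rightarrow> 'c) \<Rightarrow> 'c"
  where "smooth_integral f = level_sum (LEAST k. smooth_level k f) f"

lemma residue_nonzero: "(of_nat (residue_card TYPE('k)) :: 'c) \<noteq> 0"
  using residue_unit by (metis vabs_0 zero_neq_one)

lemma coset_sum_extend:
  fixes f :: "'k \<Rightarrow> 'c"
  assumes "m' \<le> m" "m \<le> n" "\<And>x. x \<notin> pball m \<Longrightarrow> f x = 0"
  shows "coset_sum (pball m') (pball n) f = coset_sum (pball m) (pball n) f"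
  unfolding coset_sum_def
proof (rule sum.mono_neutral_right)
  show "finite (coset_rep (pball n) ` pball m')"
    by (rule finite_coset_reps)
  show "coset_rep (pball n) ` pball m \<subseteq> coset_rep (pball n) ` pball m'"
    using pball_antimono[OF assms(1)] by blast
  show "\<forall>y\<in>coset_rep (pball n) ` pball m' - coset_rep (pball n) ` pball m. f y = 0"
  proof
    fix y assume y: "y \<in> coset_rep (pball n) ` pball m' - coset_rep (pball n) ` pball m"
    then have "coset_rep (pball n) y = y"
      using coset_rep_image_fixed[OF add_subgroup_pball] by blast
    then have "y \<notin> pball m"
      using y by (metis DiffD2 imageI)
    then show "f y = 0"
      by (rule assms(3))
  qed
qed

text \<open>Refining the cosets repeats each value q^(k' - k) times, which the denominator cancels,
  and enlarging the ball only adds zeros. Hence the choice of level in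
  \<open>smooth_integral\<close> is immaterial.\<close>

lemma level_sum_mono:
  assumes "smooth_level k f" "k \<le> k'"
  shows "level_sum k' f = level_sum k f"
proof -
  let ?q = "of_nat (residue_card TYPE('k)) :: 'c"
  have "coset_sum (pball (- int k')) (pball (int k')) f =
      of_nat (coset_index (pball (int k)) (pball (int k'))) * coset_sum (pball (- int k')) (pball (int k)) f"
    using assms by (intro coset_sum_tower add_subgroup_pball pball_antimono finite_coset_reps)
      (auto simp: smooth_level_def)
  also have "coset_index (pball (int k)) (pball (int k')) = residue_card TYPE('k) ^ (k' - k)"
    using coset_index_pball[of "int k" "k' - k"] assms(2) by (simp add: of_nat_diff)
  also have "coset_sum (pball (- int k')) (pball (int k)) f = coset_sum (pball (- int k)) (pball (int k)) f"
    using assms by (intro coset_sum_extend) (auto simp: smooth_level_def)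
  finally have "level_sum k' f =
      \<kappa> * (?q ^ (k' - k) * coset_sum (pball (- int k)) (pball (int k)) f) / ?q ^ k'"
    by (simp add: level_sum_def)
  also have "?q ^ k' = ?q ^ (k' - k) * ?q ^ k"
    using assms(2) by (simp flip: power_add)
  finally show ?thesis
    using residue_nonzero by (simp add: level_sum_def)
qed

lemma smooth_integral_eq: "smooth_level k f \<Longrightarrow> smooth_integral f = level_sum k f"
  unfolding smooth_integral_def by (metis LeastI Least_le level_sum_mono)

lemma smooth_integral_add:
  assumes "f \<in> lc_funs" "g \<in> lc_funs"
  shows "smooth_integral (\<lambda>x. f x + g x) = smooth_integral f + smooth_integral g"
proof -
  obtain k where k: "smooth_level k f" "smooth_level k g"
    using lc_funs_common_level[OF assms] by blast
  then show ?thesis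
    by (simp add: smooth_integral_eq[of k] smooth_level_add level_sum_def coset_sum_def sum.distrib
        distrib_left add_divide_distrib)
qed

lemma smooth_integral_scale:
  assumes "f \<in> lc_funs"
  shows "smooth_integral (\<lambda>x. a * f x) = a * smooth_integral f"
proof -
  obtain k where "smooth_level k f"
    using assms lc_funs_iff by blast
  then show ?thesis
    by (simp add: smooth_integral_eq[of k] smooth_level_scale level_sum_def coset_sum_def
        mult.left_commute flip: sum_distrib_left)
qed

text \<open>As q has absolute value 1, a Riemann sum is bounded by the largest value of f, however
  large the support is.\<close>

lemma vabs_smooth_integral_le:
  assumes "f \<in> lc_funs" "0 \<le> e" "\<And>x. vabs (f x) \<le> e"
  shows "vabs (smooth_integral f) \<le> e"
proof -
  obtain k where "smooth_level k f"
    using assms(1) lc_funs_iff by blast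
  then have "vabs (smooth_integral f) = vabs \<kappa> * vabs (coset_sum (pball (- int k)) (pball (int k)) f)"
    by (simp add: smooth_integral_eq level_sum_def vabs_divide vabs_mult vabs_power residue_unit)
  also have "\<dots> \<le> 1 * e"
    unfolding coset_sum_def using assms vabs_const by (intro mult_mono vabs_sum_le) auto
  finally show ?thesis
    by simp
qed

lemma smooth_integral_indicator:
  "smooth_integral (indicator ((+) a ` pball n)) = \<kappa> * of_nat (residue_card TYPE('k)) powi (- n)"
proof -
  let ?f = "indicator ((+) a ` pball n) :: 'k \<Rightarrow> 'c"
  let ?q = "of_nat (residue_card TYPE('k)) :: 'c"
  obtain k0 where k0: "smooth_level k0 ?f"
    using indicator_lc_funs lc_funs_iff by blast
  obtain m where m: "m \<le> n" "\<And>x. vabs x \<le> vabs a \<Longrightarrow> x \<in> pball m"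
    by (rule ex_pball_covers[of n "vabs a"]) blast
  \<comment> \<open>Large enough to be a level of the indicator, to have a in
    \<open>pball (- int k)\<close>, and to place \<open>pball n\<close> between
    \<open>pball (int k)\<close> and \<open>pball (- int k)\<close>.\<close>
  define k where "k = k0 + nat \<bar>m\<bar> + nat \<bar>n\<bar>"
  have k: "k0 \<le> k" "- int k \<le> m" "n \<le> int k" "- int k \<le> n"
    by (auto simp: k_def)
  have a: "a \<in> pball (- int k)"
    using m(2)[of a] pball_antimono[OF k(2)] by auto
  have "coset_sum (pball (- int k)) (pball (int k)) ?f =
      (\<Sum>x\<in>coset_rep (pball (int k)) ` pball (- int k). if x - a \<in> pball n then 1 else 0)"
    by (simp add: coset_sum_def indicator_def mem_coset_iff of_bool_def)
  also have "\<dots> = of_nat (card {x \<in> coset_rep (pball (int k)) ` pball (- int k). x - a \<in> pball n})"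
    by (simp add: finite_coset_reps flip: sum.inter_filter)
  also have "card {x \<in> coset_rep (pball (int k)) ` pball (- int k). x - a \<in> pball n} =
      coset_index (pball n) (pball (int k))"
    using k by (intro card_coset_fibre add_subgroup_pball pball_antimono a) auto
  also have "\<dots> = residue_card TYPE('k) ^ nat (int k - n)"
    using coset_index_pball[of n "nat (int k - n)"] k by simp
  finally have "smooth_integral ?f = \<kappa> * ?q ^ nat (int k - n) / ?q ^ k"
    using smooth_level_mono[OF k0 k(1)] by (simp add: smooth_integral_eq level_sum_def)
  also have "?q ^ nat (int k - n) = ?q powi (int k - n)"
    using k(3) by (simp add: power_int_def)
  also have "\<dots> = ?q powi (- n) * ?q ^ k"
    using residue_nonzero by (simp add: power_int_diff power_int_minus field_simps)
  finally show ?thesis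
    using residue_nonzero by simp
qed

lemma smooth_integral_linear: "restrict smooth_integral lc_funs \<in> integral_linear lc_funs"
  unfolding integral_linear_def
proof (intro CollectI conjI ballI)
  show "restrict smooth_integral lc_funs \<in> lc_funs \<rightarrow>\<^sub>E valuation_ring"
    unfolding restrict_PiE_iff valuation_ring_iff
    by (intro ballI vabs_smooth_integral_le) (simp_all add: lc_funs_iff)
qed (simp_all add: lc_funs_add lc_funs_scale smooth_integral_add smooth_integral_scale)

lemma smooth_integral_unique:
  assumes I: "I \<in> integral_linear lc_funs"
    and ind: "\<And>a n. I (indicator ((+) a ` pball n)) = \<kappa> * of_nat (residue_card TYPE('k)) powi (- n)"
  shows "I = restrict smooth_integral lc_funs"
proof (rule integral_linear_ext[OF I smooth_integral_linear])
  fix f :: "'k \<Rightarrow> 'c" assume f: "f \<in> lc_funs"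
  then obtain k where k: "smooth_level k f"
    using lc_funs_iff by blast
  have vals: "f a \<in> valuation_ring" for a
    using f by (simp add: lc_funs_iff valuation_ring_iff)
  let ?A = "coset_rep (pball (int k)) ` pball (- int k)"
  let ?g = "\<lambda>x. \<Sum>a\<in>?A. f a * indicator ((+) a ` pball (int k)) x"
  have f_eq: "f = ?g"
    using smooth_level_expansion[OF k] by blast
  have "J ?g = (\<Sum>a\<in>?A. f a * J (indicator ((+) a ` pball (int k))))" if "J \<in> integral_linear lc_funs" for J
    by (rule integral_linear_sum(2)[OF that])
      (simp_all add: lc_funs_zero lc_funs_add lc_funs_scale vals indicator_lc_funs)
  from this[OF I] this[OF smooth_integral_linear]
  have "I ?g = restrict smooth_integral lc_funs ?g"
    by (simp add: ind smooth_integral_indicator indicator_lc_funs)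
  then show "I f = restrict smooth_integral lc_funs f"
    unfolding f_eq[symmetric] .
qed

sublocale ext: functional_extension lc_funs "\<lambda>g. g" smooth_integral "\<lambda>_. UNIV"
proof
  fix a b :: "'k \<Rightarrow> 'c" assume "a \<in> lc_funs" "b \<in> lc_funs"
  then show "\<exists>c\<in>lc_funs. (\<forall>x. c x = a x + b x) \<and> smooth_integral c = smooth_integral a + smooth_integral b"
    by (intro bexI[of _ "\<lambda>x. a x + b x"]) (simp_all add: smooth_integral_add lc_funs_add)
next
  fix r :: 'c and a :: "'k \<Rightarrow> 'c" assume "r \<in> valuation_ring" "a \<in> lc_funs"
  then show "\<exists>c\<in>lc_funs. (\<forall>x. c x = r * a x) \<and> smooth_integral c = r * smooth_integral a"
    by (intro bexI[of _ "\<lambda>x. r * a x"]) (simp_all add: smooth_integral_scale lc_funs_scale)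
next
  fix a :: "'k \<Rightarrow> 'c" assume "a \<in> lc_funs"
  then show "vabs (smooth_integral a) \<le> 1"
    by (intro vabs_smooth_integral_le) (auto simp: lc_funs_iff)
next
  fix a :: "'k \<Rightarrow> 'c" and e :: real
  assume "a \<in> lc_funs" "0 < e" "\<And>x. x \<in> UNIV \<Longrightarrow> vabs (a x) \<le> e"
  then show "vabs (smooth_integral a) \<le> e"
    by (intro vabs_smooth_integral_le) auto
qed

section \<open>Functions vanishing at infinity and the measures f dx\<close>

definition vanishing :: "('k \<Rightarrow> 'c) \<Rightarrow> bool"
  where "vanishing f \<longleftrightarrow> (\<forall>e>0. \<exists>m. \<forall>x. x \<notin> pball m \<longrightarrow> vabs (f x) \<le> e)"

lemma vanishing_iff: "vanishing f \<longleftrightarrow> (f \<longlongrightarrow> 0) (filtercomap vabs at_top)"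
proof
  assume f: "vanishing f"
  show "(f \<longlongrightarrow> 0) (filtercomap vabs at_top)"
    unfolding tendsto_iff eventually_filtercomap_at_top_linorder
  proof (intro allI impI)
    fix e :: real assume "0 < e"
    then obtain m where m: "\<And>x. x \<notin> pball m \<Longrightarrow> vabs (f x) \<le> e / 2"
      using f unfolding vanishing_def by (meson half_gt_zero)
    \<comment> \<open>The added 1 puts x strictly outside the ball, which is defined by a nonstrict
      inequality.\<close>
    have "dist (f x) 0 < e" if "vabs \<pi> powi m + 1 \<le> vabs x" for x
    proof -
      have "vabs (f x) \<le> e / 2"
        using that by (intro m) (simp add: pball_iff)
      then show ?thesis
        using \<open>0 < e\<close> by (simp add: dist_eq_vabs)
    qed
    then show "\<exists>N. \<forall>x. N \<le> vabs x \<longrightarrow> dist (f x) 0 < e"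
      by blast
  qed
next
  assume f: "(f \<longlongrightarrow> 0) (filtercomap vabs at_top)"
  show "vanishing f"
    unfolding vanishing_def
  proof (intro allI impI)
    fix e :: real assume "0 < e"
    then obtain N where N: "\<And>x. N \<le> vabs x \<Longrightarrow> dist (f x) 0 < e"
      using f unfolding tendsto_iff eventually_filtercomap_at_top_linorder by blast
    obtain m where m: "\<And>x. vabs x \<le> N \<Longrightarrow> x \<in> pball m"
      by (rule ex_pball_covers[of 0 N]) blast
    have "vabs (f x) \<le> e" if "x \<notin> pball m" for x
    proof -
      have "N \<le> vabs x"
        using m[of x] that by linarith
      from N[OF this] show ?thesis
        by (simp add: dist_eq_vabs)
    qed
    then show "\<exists>m. \<forall>x. x \<notin> pball m \<longrightarrow> vabs (f x) \<le> e"
      by blast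
  qed
qed

lemma lc_funs_uniformly_dense:
  assumes "f \<in> cont_funs" "vanishing f" "0 < e"
  shows "\<exists>g\<in>lc_funs. \<forall>x. vabs (f x - g x) \<le> e"
proof -
  obtain m where m: "\<And>x. x \<notin> pball m \<Longrightarrow> vabs (f x) \<le> e"
    using assms unfolding vanishing_def by blast
  obtain n where n: "m \<le> n" "\<And>x y. x \<in> pball m \<Longrightarrow> x - y \<in> pball n \<Longrightarrow> vabs (f x - f y) < e"
    using continuous_uniform_on_pball[OF cont_funs_continuous[OF assms(1)] assms(3), of m] by blast
  \<comment> \<open>Sampled at coset representatives inside the ball and cut off outside, where f is
    already at most e.\<close>
  define g where "g x = (if x \<in> pball m then f (coset_rep (pball n) x) else 0)" for x
  have "coset_invariant (pball n) g"
    unfolding coset_invariant_def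
  proof (intro allI impI)
    fix x y assume xy: "x - y \<in> pball n"
    then have "x - y \<in> pball m"
      using pball_antimono[OF n(1)] by blast
    then have "x \<in> pball m \<longleftrightarrow> y \<in> pball m"
      using add_subgroup_add[OF add_subgroup_pball, of "x - y" m y]
        add_subgroup_diff[OF add_subgroup_pball, of x m "x - y"] by auto
    moreover have "coset_rep (pball n) x = coset_rep (pball n) y"
      using xy coset_rep_eq_iff[OF add_subgroup_pball] by blast
    ultimately show "g x = g y"
      by (simp add: g_def)
  qed
  then have "\<exists>k. smooth_level k g"
    by (rule smooth_level_intro[of m, rotated]) (simp add: g_def)
  then have "g \<in> lc_funs"
    using cont_funs_vabs[OF assms(1)] by (simp add: lc_funs_iff g_def)
  moreover have "vabs (f x - g x) \<le> e" for x
  proof (cases "x \<in> pball m")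
    case True
    have "x - coset_rep (pball n) x \<in> pball n"
      using coset_rep_diff[OF add_subgroup_pball, of n x] add_subgroup_diff_commute[OF add_subgroup_pball]
      by blast
    from n(2)[OF True this] show ?thesis
      using True by (simp add: g_def)
  qed (use m in \<open>simp add: g_def\<close>)
  ultimately show ?thesis
    by blast
qed

lemma uniform_limit_iff_approximates:
  "(\<forall>n. g n \<in> lc_funs) \<and> uniform_limit UNIV g f sequentially \<longleftrightarrow> ext.approximates g f"
proof -
  have "uniform_limit UNIV g f sequentially \<longleftrightarrow>
      (\<forall>e>0. \<forall>\<^sub>F n in sequentially. \<forall>x. vabs (f x - g n x) \<le> e)" (is "?L \<longleftrightarrow> ?R")
  proof
    assume L: ?L
    show ?R
    proof (intro allI impI)
      fix e :: real assume "0 < e"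
      then have "\<forall>\<^sub>F n in sequentially. \<forall>x\<in>UNIV. dist (g n x) (f x) < e"
        using L unfolding uniform_limit_iff by blast
      then show "\<forall>\<^sub>F n in sequentially. \<forall>x. vabs (f x - g n x) \<le> e"
        by (rule eventually_mono) (simp add: dist_eq_vabs vabs_minus_commute less_imp_le)
    qed
  next
    assume R: ?R
    show ?L
      unfolding uniform_limit_iff
    proof (intro allI impI)
      fix e :: real assume e: "0 < e"
      then have "0 < e / 2"
        by simp
      then have "\<forall>\<^sub>F n in sequentially. \<forall>x. vabs (f x - g n x) \<le> e / 2"
        using R by blast
      then show "\<forall>\<^sub>F n in sequentially. \<forall>x\<in>UNIV. dist (g n x) (f x) < e"
      proof (rule eventually_mono)
        fix n assume n: "\<forall>x. vabs (f x - g n x) \<le> e / 2"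
        have "dist (g n x) (f x) < e" for x
          using n[rule_format, of x] e by (simp add: dist_eq_vabs vabs_minus_commute)
        then show "\<forall>x\<in>UNIV. dist (g n x) (f x) < e"
          by blast
      qed
    qed
  qed
  then show ?thesis
    by (simp add: ext.approximates_def)
qed

lemma ex_approximates:
  assumes "f \<in> cont_funs" "vanishing f"
  shows "\<exists>g. ext.approximates g f"
proof -
  have "\<exists>g. g \<in> lc_funs \<and> (\<forall>x. vabs (f x - g x) \<le> 1 / real (Suc n))" for n
    using lc_funs_uniformly_dense[OF assms, of "1 / real (Suc n)"] by auto
  then obtain g where g: "\<And>n. g n \<in> lc_funs" "\<And>n x. vabs (f x - g n x) \<le> 1 / real (Suc n)"
    by metis
  have "ext.approximates g f"
    unfolding ext.approximates_def
  proof (intro conjI allI impI)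
    fix e :: real assume "0 < e"
    then have "\<forall>\<^sub>F n in sequentially. 1 / real (Suc n) < e"
      by (intro order_tendstoD(2)[OF LIMSEQ_Suc[OF lim_1_over_n]])
    then show "\<forall>\<^sub>F n in sequentially. \<forall>x\<in>UNIV. vabs (f x - g n x) \<le> e"
      by (rule eventually_mono) (meson g(2) less_imp_le order_trans)
  qed (rule g(1))
  then show ?thesis
    by blast
qed

lemma vanishing_mult: "vanishing f \<Longrightarrow> g \<in> cont_funs \<Longrightarrow> vanishing (\<lambda>x. f x * g x)"
  unfolding vanishing_def vabs_mult
proof (intro allI impI)
  fix e :: real
  assume "\<forall>e>0. \<exists>m. \<forall>x. x \<notin> pball m \<longrightarrow> vabs (f x) \<le> e" and g: "g \<in> cont_funs" and "0 < e"
  then obtain m where m: "\<And>x. x \<notin> pball m \<Longrightarrow> vabs (f x) \<le> e"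
    by blast
  have "vabs (f x) * vabs (g x) \<le> e * 1" if "x \<notin> pball m" for x
    using m[OF that] cont_funs_vabs[OF g] \<open>0 < e\<close> by (intro mult_mono) auto
  then show "\<exists>m. \<forall>x. x \<notin> pball m \<longrightarrow> vabs (f x) * vabs (g x) \<le> e"
    by auto
qed

text \<open>Let f be at most e off \<open>pball m\<close>. If g is at most e on that ball, then f g
  is at most e everywhere, by f on the outside and by g on the inside; so smallness of g on one ball
  suffices.\<close>

lemma extend_mult_cont_dual:
  assumes f: "f \<in> cont_funs" "vanishing f"
  shows "restrict (\<lambda>g. ext.extend (\<lambda>x. f x * g x)) cont_funs \<in> cont_dual" (is "?\<mu> \<in> _")
proof -
  have approx: "\<exists>a. ext.approximates a (\<lambda>x. f x * g x)" if "g \<in> cont_funs" for g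
    by (intro ex_approximates cont_funs_mult vanishing_mult f that)
  have "?\<mu> \<in> integral_linear cont_funs"
    unfolding integral_linear_def
  proof (intro CollectI conjI ballI)
    show "?\<mu> \<in> cont_funs \<rightarrow>\<^sub>E valuation_ring"
      using approx ext.vabs_extend_le_1 unfolding valuation_ring_def
      by (intro restrict_PiE_iff[THEN iffD2] ballI CollectI) blast
    show "?\<mu> (\<lambda>x. g x + h x) = ?\<mu> g + ?\<mu> h" if g: "g \<in> cont_funs" and h: "h \<in> cont_funs" for g h
    proof -
      obtain a b where "ext.approximates a (\<lambda>x. f x * g x)" "ext.approximates b (\<lambda>x. f x * h x)"
        using approx g h by blast
      from ext.extend_add[OF this] show ?thesis
        by (simp add: g h cont_funs_add distrib_left)
    qed
    show "?\<mu> (\<lambda>x. r * g x) = r * ?\<mu> g" if r: "r \<in> valuation_ring" and g: "g \<in> cont_funs" for r g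
    proof -
      obtain a where "ext.approximates a (\<lambda>x. f x * g x)"
        using approx g by blast
      from ext.extend_scale[OF this r] show ?thesis
        by (simp add: g r cont_funs_scale mult.left_commute)
    qed
  qed
  moreover have "\<exists>m. \<exists>d>0. \<forall>g\<in>cont_funs. (\<forall>x\<in>pball m. vabs (g x) \<le> d) \<longrightarrow> vabs (?\<mu> g) \<le> e"
    if e: "0 < e" for e
  proof -
    obtain m where m: "\<And>x. x \<notin> pball m \<Longrightarrow> vabs (f x) \<le> e"
      using f(2) e unfolding vanishing_def by blast
    have "vabs (?\<mu> g) \<le> e" if g: "g \<in> cont_funs" "\<forall>x\<in>pball m. vabs (g x) \<le> e" for g
    proof -
      obtain a where a: "ext.approximates a (\<lambda>x. f x * g x)"
        using approx g(1) by blast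
      have "vabs (f x * g x) \<le> e" for x
      proof (cases "x \<in> pball m")
        case True
        then have "vabs (f x) * vabs (g x) \<le> 1 * e"
          using g(2) cont_funs_vabs[OF f(1)] by (intro mult_mono) auto
        then show ?thesis
          by (simp add: vabs_mult)
      next
        case False
        then have "vabs (f x) * vabs (g x) \<le> e * 1"
          using m cont_funs_vabs[OF g(1)] e by (intro mult_mono) auto
        then show ?thesis
          by (simp add: vabs_mult)
      qed
      then have "vabs (ext.extend (\<lambda>x. f x * g x)) \<le> e"
        by (intro ext.vabs_extend_le[OF a e])
      then show ?thesis
        using g(1) by simp
    qed
    then show ?thesis
      using e by blast
  qed
  ultimately show ?thesis
    unfolding cont_dual_iff by blast
qed

text \<open>Discharges the definite description in \<open>haar\<close>: existence by
  \<open>smooth_integral_indicator\<close>, uniqueness by expansion into indicators.\<close>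

lemma haar_eq:
  assumes "\<kappa> = s powi (- int \<delta>)"
  shows "haar \<pi> s \<delta> = restrict smooth_integral lc_funs"
  unfolding haar_def
proof (rule the_equality)
  show "restrict smooth_integral lc_funs \<in> integral_linear lc_funs \<and>
    (\<forall>a n. restrict smooth_integral lc_funs (indicator ((+) a ` frac_ideal \<pi> n)) =
      s powi (- int \<delta>) * of_nat (residue_card TYPE('k)) powi (- n))"
    by (simp add: smooth_integral_linear frac_ideal_eq_pball indicator_lc_funs smooth_integral_indicator
        flip: assms)
qed (rule smooth_integral_unique, auto simp: frac_ideal_eq_pball simp flip: assms)

lemma haar_integral_eq:
  assumes "\<kappa> = s powi (- int \<delta>)" and f: "f \<in> cont_funs" "vanishing f"
  shows "haar_integral \<pi> s \<delta> f = ext.extend f"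
  unfolding haar_integral_def haar_eq[OF assms(1)]
proof (rule the_equality)
  obtain g where g: "ext.approximates g f"
    using ex_approximates[OF f] by blast
  then show "\<exists>g. (\<forall>n. g n \<in> lc_funs) \<and> uniform_limit UNIV g f sequentially \<and>
      (\<lambda>n. restrict smooth_integral lc_funs (g n)) \<longlonglongrightarrow> ext.extend f"
    using ext.approximates_tendsto[OF g] ext.approximates_in[OF g]
    by (intro exI[of _ g]) (simp add: uniform_limit_iff_approximates[symmetric])
next
  fix L
  assume "\<exists>g. (\<forall>n. g n \<in> lc_funs) \<and> uniform_limit UNIV g f sequentially \<and>
    (\<lambda>n. restrict smooth_integral lc_funs (g n)) \<longlonglongrightarrow> L"
  then obtain g where g: "ext.approximates g f" "\<And>n. g n \<in> lc_funs"
    and "(\<lambda>n. restrict smooth_integral lc_funs (g n)) \<longlonglongrightarrow> L"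
    unfolding uniform_limit_iff_approximates[symmetric] by blast
  then have "(\<lambda>n. smooth_integral (g n)) \<longlonglongrightarrow> L"
    by simp
  then show "L = ext.extend f"
    using ext.approximates_tendsto[OF g(1)] by (rule LIMSEQ_unique)
qed

end

text \<open>Sums and multiples of measures are restricted to \<open>cont_funs\<close> because
  functionals are extensional there. The filter \<open>filtercomap vabs at_top\<close> expresses x
  tending to infinity in K.\<close>

theorem mainTheorem1:
  fixes l p \<delta> :: nat
    and j :: "'ql::{nonarch_field, field_char_0, complete_space} \<Rightarrow> 'k::nonarch_field"
    and i :: "'qp::{nonarch_field, field_char_0, complete_space} \<Rightarrow>
      'c::{nonarch_field, complete_space}"
    and \<pi> :: 'k and s :: 'c and \<zeta> :: "nat \<Rightarrow> 'c"
  assumes "l \<noteq> p"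
    and "is_finite_extension l j"
    and "is_Cp p i"
    and "is_uniformizer \<pi>"
    and "different j = frac_ideal \<pi> (int \<delta>)"
    and "s ^ 2 = of_nat (residue_card TYPE('k))"
    and "compatible_roots l \<zeta>"
  shows "(\<forall>\<mu> \<in> cont_dual. fourier l j \<zeta> \<mu> \<in> cont_funs) \<and>
    (\<forall>\<mu> \<in> cont_dual. \<forall>\<nu> \<in> cont_dual. \<forall>r.
      fourier l j \<zeta> (restrict (\<lambda>f. \<mu> f + \<nu> f) cont_funs) r = fourier l j \<zeta> \<mu> r + fourier l j \<zeta> \<nu> r) \<and>
    (\<forall>a \<in> valuation_ring. \<forall>\<mu> \<in> cont_dual. \<forall>r.
      fourier l j \<zeta> (restrict (\<lambda>f. a * \<mu> f) cont_funs) r = a * fourier l j \<zeta> \<mu> r) \<and>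
    inj_on (fourier l j \<zeta>) cont_dual \<and>
    fourier l j \<zeta> ` cont_dual = {f \<in> cont_funs. uniformly_continuous_on UNIV f} \<and>
    (\<forall>f \<in> cont_funs. (f \<longlongrightarrow> 0) (filtercomap vabs at_top) \<longrightarrow>
      haar_density \<pi> s \<delta> f \<in> cont_dual \<and>
      (\<forall>\<xi>. fourier l j \<zeta> (haar_density \<pi> s \<delta> f) \<xi> =
        haar_integral \<pi> s \<delta> (\<lambda>x. f x * zeta_pow l \<zeta> (field_trace j (x * \<xi>)))))"
proof -
  note ext = assms(2)
  note padic = ext_padic[OF ext]
  note roots = assms(7)
  define \<psi> where "\<psi> x = zeta_pow l \<zeta> (field_trace j x)" for x
  have l: "prime l" "vabs (of_nat l :: 'k) = 1 / real l" "1 < l"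
    using prime_l[OF padic] vabs_l[OF padic] vabs_of_nat_ext[OF ext, of l] l_gt_1[OF padic] by simp_all
  have lf: "local_field \<pi>"
  proof
    show "is_uniformizer \<pi>"
      by fact
    show "compact (valuation_ring :: 'k set)"
      by (rule compact_valuation_ring_ext[OF ext])
    \<comment> \<open>A nonzero element of the maximal ideal is a multiple of \<pi>, which forces
      \<pi> to be nonzero.\<close>
    have "(of_nat l :: 'k) \<in> maximal_ideal"
      using l by (simp add: maximal_ideal_def)
    then obtain y where "of_nat l = \<pi> * y"
      using assms(4) unfolding is_uniformizer_def by blast
    then show "\<pi> \<noteq> 0"
      using l by auto
  qed
  interpret local_field \<pi>
    by (rule lf)
  \<comment> \<open>Here l \<noteq> p enters: p does not divide l, so l is a p-adic unit, and
    \<open>i\<close> preserves absolute values.\<close>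
  have unit_l: "vabs (of_nat l :: 'c) = 1"
  proof -
    have p: "is_padic_field p TYPE('qp)" and i: "valued_field_hom i"
      using assms(3) by (simp_all add: is_Cp_def)
    have "\<not> p dvd l"
      using assms(1) l(1) prime_l[OF p] primes_dvd_imp_eq by blast
    then have "vabs (of_nat l :: 'qp) = 1"
      using vabs_of_nat_padic[OF p, of l] l(3) by (simp add: not_dvd_imp_multiplicity_0)
    then show ?thesis
      using vabs_hom[OF i, of "of_nat l"] by (simp add: hom_of_nat[OF i])
  qed
  obtain k where "residue_card TYPE('k) = l ^ k"
    using residue_card_prime_power[OF l(1)] l(2,3) by auto
  then have unit: "vabs (of_nat (residue_card TYPE('k)) :: 'c) = 1"
    by (simp add: vabs_power unit_l)
  interpret fourier_setting \<pi> \<psi>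
  proof
    show "vabs (of_nat (residue_card TYPE('k)) :: 'c) = 1"
      by (rule unit)
    show "\<psi> (x + y) = \<psi> x * \<psi> y" for x y
      by (simp add: \<psi>_def field_trace_add[OF ext] zeta_pow_add[OF padic roots])
    show "vabs (\<psi> x) = 1" for x
      unfolding \<psi>_def by (rule vabs_zeta_pow[OF padic roots])
    obtain M where M: "0 < M" "\<And>x. vabs (field_trace j x) \<le> M * vabs x"
      using field_trace_bounded[OF ext] by blast
    have "\<psi> x = 1" if "vabs x \<le> 1 / M" for x
    proof -
      have "M * vabs x \<le> 1"
        using that M(1) by (simp add: field_simps)
      then have "vabs (field_trace j x) \<le> 1"
        using M(2)[of x] by linarith
      then show ?thesis
        unfolding \<psi>_def by (intro zeta_pow_integral[OF padic roots]) (simp add: valuation_ring_iff)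
    qed
    then show "\<exists>e>0. \<forall>x. vabs x \<le> e \<longrightarrow> \<psi> x = 1"
      using M(1) by (intro exI[of _ "1 / M"]) simp
    obtain x where "field_trace j x = 1 / of_nat l"
      using ex_field_trace_eq[OF ext] by blast
    then show "\<exists>x. \<psi> x \<noteq> 1"
      using zeta_pow_inverse_l[OF padic roots] by (intro exI[of _ x]) (simp add: \<psi>_def)
  qed
  \<comment> \<open>The square root of the unit q is a unit as well, so the constant q^(-\<delta>/2)
    is integral.\<close>
  have "vabs s ^ 2 = 1"
    using unit by (simp flip: vabs_power assms(6))
  then have "vabs s = 1"
    by (simp add: power2_eq_1_iff) (metis vabs_ge_0 neg_0_le_iff_le not_one_le_zero)
  then have \<kappa>: "vabs (s powi (- int \<delta>)) \<le> 1"
    by (simp add: vabs_powi)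
  interpret H: haar_setting \<pi> "s powi (- int \<delta>)"
    by unfold_locales (use unit \<kappa> in auto)
  have F: "fourier l j \<zeta> \<mu> r = \<mu> (\<lambda>x. \<psi> (r * x))" for \<mu> r
    by (simp add: fourier_def \<psi>_def)
  then have F': "fourier l j \<zeta> \<mu> = (\<lambda>r. \<mu> (\<lambda>x. \<psi> (r * x)))" for \<mu>
    by blast
  have "fourier l j \<zeta> ` cont_dual = {f \<in> cont_funs. uniformly_continuous_on UNIV f}"
  proof (intro equalityI subsetI)
    fix h assume "h \<in> fourier l j \<zeta> ` cont_dual"
    then show "h \<in> {f \<in> cont_funs. uniformly_continuous_on UNIV f}"
      using dual_char_cont_fun dual_char_uniformly_continuous by (auto simp: F')
  next
    fix h :: "'k \<Rightarrow> 'c" assume "h \<in> {f \<in> cont_funs. uniformly_continuous_on UNIV f}"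
    then obtain \<mu> where "\<mu> \<in> cont_dual" "\<And>r. \<mu> (\<lambda>x. \<psi> (r * x)) = h r"
      using dual_char_surj[of h] by blast
    then show "h \<in> fourier l j \<zeta> ` cont_dual"
      by (intro image_eqI[of _ _ \<mu>]) (auto simp: F')
  qed
  moreover have "inj_on (fourier l j \<zeta>) cont_dual"
    by (rule inj_onI, rule dual_char_inj) (auto simp: F' dest: fun_cong)
  moreover have "haar_density \<pi> s \<delta> f \<in> cont_dual \<and>
      (\<forall>\<xi>. fourier l j \<zeta> (haar_density \<pi> s \<delta> f) \<xi> =
        haar_integral \<pi> s \<delta> (\<lambda>x. f x * zeta_pow l \<zeta> (field_trace j (x * \<xi>))))"
    if f: "f \<in> cont_funs" "(f \<longlongrightarrow> 0) (filtercomap vabs at_top)" for f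
  proof
    have van: "H.vanishing f"
      using f(2) H.vanishing_iff by blast
    have "haar_density \<pi> s \<delta> f = restrict (\<lambda>g. H.ext.extend (\<lambda>x. f x * g x)) cont_funs"
      unfolding haar_density_def
      by (rule restrict_ext) (intro H.haar_integral_eq refl cont_funs_mult H.vanishing_mult f van)
    then show "haar_density \<pi> s \<delta> f \<in> cont_dual"
      using H.extend_mult_cont_dual[OF f(1) van] by simp
    show "\<forall>\<xi>. fourier l j \<zeta> (haar_density \<pi> s \<delta> f) \<xi> =
        haar_integral \<pi> s \<delta> (\<lambda>x. f x * zeta_pow l \<zeta> (field_trace j (x * \<xi>)))"
      by (simp add: F haar_density_def char_cont_fun) (simp add: \<psi>_def mult.commute)
  qed
  ultimately show ?thesis
    using dual_char_cont_fun by (simp add: F F' char_cont_fun)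
qed

end
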